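(* Let $d\ge 3$, and let $\lambda_1\le\lambda_2\le\lambda_3\le\cdots$ be the eigenvalues, counted with multiplicity, of the Laplace--Beltrami operator $-\Delta_{\mathbb{S}^{d-1}}$ on the unit sphere $\mathbb{S}^{d-1}\subset\mathbb{R}^d$. The only Courant sharp cases correspond to the first two eigenvalues; that is, there exists an eigenfunction associated with $\lambda_n$ having exactly $n$ nodal domains if and only if $n\in\{1,2\}$.
   Context: Eigenfunctions are real-valued. The nodal domains of an eigenfunction are the connected components of the complement in $\mathbb{S}^{d-1}$ of its zero set. The eigenvalue $\lambda_n$ (the $n$th eigenvalue, in non-decreasing order and counted with multiplicity) is called Courant sharp if there exists an eigenfunction associated with $\lambda_n$ having exactly $n$ nodal domains. *)

theory Defs
  imports "HOL-Analysis.Analysis" "HOL-Library.Function_Algebras"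
begin

text \<open>The pointwise vector space structure on functions, so that the library's \<^const>\<open>dim\<close>
  applies to spaces of functions.\<close>

instantiation "fun" :: (type, real_vector) real_vector
begin

definition scaleR_fun :: "real \<Rightarrow> ('a \<Rightarrow> 'b) \<Rightarrow> 'a \<Rightarrow> 'b"
  where "scaleR_fun c f = (\<lambda>x. c *\<^sub>R f x)"

instance
  by standard (auto simp: scaleR_fun_def fun_eq_iff scaleR_add_right scaleR_add_left)

end

text \<open>Infinitely differentiable on an open set \<open>U\<close>: differentiable, and all directional
  derivatives are again infinitely differentiable.\<close>

coinductive smooth_on :: "'a::euclidean_space set \<Rightarrow> ('a \<Rightarrow> real) \<Rightarrow> bool"
  for U :: "'a set"
  where
    "(\<And>x. x \<in> U \<Longrightarrow> (f has_derivative D x) (at x)) \<Longrightarrow> (\<And>v. smooth_on U (\<lambda>x. D x v)) \<Longrightarrow>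
       smooth_on U f"

text \<open>Functions and vector fields on the unit sphere are differentiated through their extension
  that is constant along rays. This extension has zero derivative in the normal direction, and in
  the tangent directions it differentiates the given function along the sphere.\<close>

definition radial_extension :: "('a::euclidean_space \<Rightarrow> 'b) \<Rightarrow> 'a \<Rightarrow> 'b"
  where "radial_extension f x = f (x /\<^sub>R norm x)"

definition sphere_smooth :: "('a::euclidean_space \<Rightarrow> real) \<Rightarrow> bool"
  where "sphere_smooth f \<longleftrightarrow> smooth_on (- {0}) (radial_extension f)"

text \<open>For \<open>x\<close> on the sphere this is the tangent vector that represents, in the metric induced from
  the ambient space, the differential of \<open>f\<close> at \<open>x\<close>: its normal component vanishes because the
  extension is constant along rays.\<close>

definition sphere_gradient :: "('a::euclidean_space \<Rightarrow> real) \<Rightarrow> 'a \<Rightarrow> 'a"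
  where "sphere_gradient f x =
    (\<Sum>b\<in>Basis. frechet_derivative (radial_extension f) (at x) b *\<^sub>R b)"

text \<open>The covariant derivative on the sphere is the tangential part of the ambient derivative, and
  the divergence of a tangent field \<open>X\<close> is the trace of \<open>v \<mapsto> \<nabla>\<^sub>v X\<close> over the tangent space. The trace
  below runs over the whole ambient space; the additional normal term vanishes because the
  extension is constant along rays.\<close>

definition sphere_divergence :: "('a::euclidean_space \<Rightarrow> 'a) \<Rightarrow> 'a \<Rightarrow> real"
  where "sphere_divergence X x =
    (\<Sum>b\<in>Basis. frechet_derivative (radial_extension X) (at x) b \<bullet> b)"

definition sphere_laplacian :: "('a::euclidean_space \<Rightarrow> real) \<Rightarrow> 'a \<Rightarrow> real"
  where "sphere_laplacian f x = sphere_divergence (sphere_gradient f) x"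

text \<open>A function on the sphere is represented by a function on the ambient space that vanishes off
  the sphere; the representation is unique, so dimensions of function spaces are the right ones.\<close>

definition eigenspace :: "real \<Rightarrow> ('a::euclidean_space \<Rightarrow> real) set"
  where "eigenspace \<mu> =
    {f. (\<forall>x. x \<notin> sphere 0 1 \<longrightarrow> f x = 0) \<and> sphere_smooth f \<and>
        (\<forall>x\<in>sphere 0 1. - sphere_laplacian f x = \<mu> * f x)}"

definition eigenfunction :: "real \<Rightarrow> ('a::euclidean_space \<Rightarrow> real) \<Rightarrow> bool"
  where "eigenfunction \<mu> f \<longleftrightarrow> f \<in> eigenspace \<mu> \<and> f \<noteq> (\<lambda>x. 0)"

definition eigenvalues :: "'a::euclidean_space itself \<Rightarrow> real set"
  where "eigenvalues _ = {\<mu>. \<exists>f :: 'a \<Rightarrow> real. eigenfunction \<mu> f}"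

definition multiplicity_of :: "'a::euclidean_space itself \<Rightarrow> real \<Rightarrow> nat"
  where "multiplicity_of _ \<mu> = dim (eigenspace \<mu> :: ('a \<Rightarrow> real) set)"

text \<open>The \<open>n\<close>th eigenvalue, \<open>n \<ge> 1\<close>, in non-decreasing order and counted with multiplicity: the
  least eigenvalue \<open>\<mu>\<close> such that the eigenvalues up to \<open>\<mu>\<close> have total multiplicity at least \<open>n\<close>.\<close>

definition nth_eigenvalue :: "'a::euclidean_space itself \<Rightarrow> nat \<Rightarrow> real"
  where "nth_eigenvalue T n =
    (LEAST \<mu>. \<mu> \<in> eigenvalues T \<and>
       n \<le> (\<Sum>\<nu>\<in>{\<nu>\<in>eigenvalues T. \<nu> \<le> \<mu>}. multiplicity_of T \<nu>))"

definition nodal_domains :: "('a::euclidean_space \<Rightarrow> real) \<Rightarrow> 'a set set"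
  where "nodal_domains f = components (sphere 0 1 - {x. f x = 0})"

definition courant_sharp :: "'a::euclidean_space itself \<Rightarrow> nat \<Rightarrow> bool"
  where "courant_sharp T n \<longleftrightarrow>
    (\<exists>f :: 'a \<Rightarrow> real. eigenfunction (nth_eigenvalue T n) f \<and>
       finite (nodal_domains f) \<and> card (nodal_domains f) = n)"

end

theory Submission
  imports Defs
begin

text \<open>The eigenvalues of the sphere are \<open>\<mu>\<^sub>l = l (l + d - 2)\<close>, and the eigenspace \<open>H\<^sub>l\<close> of \<open>\<mu>\<^sub>l\<close>
consists of restrictions of homogeneous polynomials of degree \<open>l\<close>; so its elements are even or odd
according to the parity of \<open>l\<close>. The theorem holds because Courant's bound can be applied inside
the functions of this one parity, which roughly halves the number of competing lower eigenfunctions,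
and this gains more than is lost by counting nodal domains only up to the antipodal map.

In detail, let \<open>f \<in> H\<^sub>l\<close> be nonzero and group its nodal domains into the sets \<open>U \<union> - U\<close>. Multiplying \<open>f\<close> by
one constant per group gives a function \<open>g\<close> with the parity of \<open>f\<close> whose Rayleigh quotient is \<open>\<mu>\<^sub>l\<close>.
It is automatically orthogonal to the eigenfunctions of the other parity. The lower eigenspaces
of the same parity add up to the restrictions of the homogeneous polynomials of degree \<open>l - 2\<close>; let
\<open>N\<close> be the dimension of this space (\<open>N = 0\<close> if \<open>l < 2\<close>). With more than \<open>N + 1\<close> groups the constants can be
chosen not all zero, zero on one group, and such that \<open>g\<close> is orthogonal to all lower eigenspaces. Then \<open>g\<close>
minimizes the Rayleigh quotient on the complement of the lower eigenspaces, so \<open>g \<in> H\<^sub>l\<close>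
(\<open>minimizer_is_eigenfunction\<close>), and a polynomial that vanishes on an open cone is zero, which is a
contradiction. So \<open>f\<close> has at most \<open>2 N + 2\<close> nodal domains (\<open>nodal_domains_le\<close>).
If \<open>l \<ge> 2\<close>, the eigenvalues below \<open>\<mu>\<^sub>l\<close> have total multiplicity at least \<open>2 N + 2\<close>
(\<open>sum_harmonics_dim_ge\<close>), so that \<open>\<lambda>\<^sub>n = \<mu>\<^sub>l\<close> forces \<open>n > 2 N + 2\<close>; if \<open>l < 2\<close>, there are at most two nodal
domains. So only \<open>n \<le> 2\<close> is possible, and constants and coordinate functions realize \<open>n = 1\<close> and \<open>n = 2\<close>.

The function \<open>g\<close> is only continuous, and its energy is measured by finite differences. Rotations by
a small angle in the coordinate planes preserve the measure and the spaces of polynomials, and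
summing second differences along them over all ordered pairs of axes gives twice the
Laplacian (\<open>sphere_laplacian_weak_limit\<close>). Comparing \<open>g\<close> with a rotated copy, the only harmful terms come
from points \<open>x\<close> and \<open>R x\<close> in distinct nodal domains on which \<open>f\<close> has the same sign. Then \<open>f\<close> has a zero on
the arc between them, so that \<open>\<bar>f\<bar> \<le> L t\<close> at both points for a rotation by the angle \<open>t\<close>; the product of the two
values is of order \<open>t\<^sup>2\<close>, and the set where \<open>0 < \<bar>f\<bar> \<le> L t\<close> has a measure that tends to zero. So these terms
are \<open>o(t\<^sup>2)\<close> whatever the zero set of \<open>f\<close> looks like (\<open>rotation_energy_upper_bound\<close>).

The spectrum is found without dimension formulas: by induction on the degree every homogeneous
polynomial is, on the sphere, a sum of polynomial eigenfunctions (\<open>restrict_hpoly_decomposition\<close>), and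
by the Stone--Weierstrass theorem nothing is orthogonal to all of these (\<open>harmonics_complete\<close>).\<close>

abbreviation cont_sph :: "('a::euclidean_space \<Rightarrow> 'b::topological_space) \<Rightarrow> bool"
  where "cont_sph \<equiv> continuous_on (sphere 0 1)"

abbreviation nonzero_set :: "('a::euclidean_space \<Rightarrow> real) \<Rightarrow> 'a set"
  where "nonzero_set f \<equiv> sphere 0 1 - {x. f x = 0}"

section \<open>Rotations in a coordinate plane\<close>

text \<open>The infinitesimal rotation in the plane of the coordinate axes \<open>a\<close> and \<open>b\<close>.\<close>

definition plane_gen :: "'a::euclidean_space \<Rightarrow> 'a \<Rightarrow> 'a \<Rightarrow> 'a"
  where "plane_gen a b x = (x \<bullet> a) *\<^sub>R b - (x \<bullet> b) *\<^sub>R a"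

text \<open>Rodrigues' formula for \<open>exp (t J)\<close> with \<open>J = plane_gen a b\<close>; it is the exponential series summed with
\<open>J\<^sup>3 = - J\<close>. The case \<open>a = b\<close>, where \<open>J = 0\<close> and the rotation is the identity, is included so that sums may
range over all ordered pairs of axes.\<close>

definition rot :: "'a::euclidean_space \<Rightarrow> 'a \<Rightarrow> real \<Rightarrow> 'a \<Rightarrow> 'a"
  where "rot a b t x =
    x + sin t *\<^sub>R plane_gen a b x + (1 - cos t) *\<^sub>R plane_gen a b (plane_gen a b x)"

lemma linear_plane_gen: "linear (plane_gen a b)"
  by (rule linearI) (simp_all add: plane_gen_def algebra_simps inner_add_left)

lemma plane_gen_simps:
  "plane_gen a b (x + y) = plane_gen a b x + plane_gen a b y"
  "plane_gen a b (x - y) = plane_gen a b x - plane_gen a b y"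
  "plane_gen a b (c *\<^sub>R x) = c *\<^sub>R plane_gen a b x"
  "plane_gen a b (- x) = - plane_gen a b x"
  by (simp_all add: linear_plane_gen linear_add linear_diff linear_scale linear_neg)

lemma plane_gen_skew: "plane_gen a b x \<bullet> y = - (x \<bullet> plane_gen a b y)"
  by (simp add: plane_gen_def algebra_simps inner_commute)

lemma plane_gen_inner_self [simp]: "x \<bullet> plane_gen a b x = 0"
  by (simp add: plane_gen_def algebra_simps inner_commute)

lemma plane_gen_cube:
  assumes "a \<in> Basis" "b \<in> Basis"
  shows "plane_gen a b (plane_gen a b (plane_gen a b x)) = - plane_gen a b x"
  using assms
  by (cases "a = b") (auto simp: plane_gen_def inner_Basis algebra_simps)

lemma linear_rot: "linear (rot a b t)"
  by (rule linearI) (simp_all add: rot_def plane_gen_simps algebra_simps)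

lemma rot_0 [simp]: "rot a b 0 x = x"
  by (simp add: rot_def)

lemma rot_add:
  assumes "a \<in> Basis" "b \<in> Basis"
  shows "rot a b s (rot a b t x) = rot a b (s + t) x"
proof -
  define y z where "y = plane_gen a b x" and "z = plane_gen a b (plane_gen a b x)"
  have 1: "plane_gen a b x = y" "plane_gen a b y = z" "plane_gen a b z = - y"
    using plane_gen_cube[OF assms] by (auto simp: y_def z_def)
  have "rot a b s (rot a b t x) = x + (sin s * cos t + cos s * sin t) *\<^sub>R y
          + (1 - (cos s * cos t - sin s * sin t)) *\<^sub>R z"
    by (simp add: rot_def plane_gen_simps 1 algebra_simps)
  then show ?thesis by (simp add: rot_def 1 sin_add cos_add)
qed

lemma rot_inverse:
  assumes "a \<in> Basis" "b \<in> Basis"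
  shows "rot a b t (rot a b (- t) x) = x" "rot a b (- t) (rot a b t x) = x"
  using rot_add[OF assms] by simp_all

lemma norm_rot [simp]:
  assumes "a \<in> Basis" "b \<in> Basis"
  shows "norm (rot a b t x) = norm x"
proof -
  define y z where "y = plane_gen a b x" and "z = plane_gen a b (plane_gen a b x)"
  have xy: "x \<bullet> y = 0" and yz: "y \<bullet> z = 0" and xz: "x \<bullet> z = - (y \<bullet> y)"
    using plane_gen_skew[of a b x y] by (simp_all add: y_def z_def)
  have zz: "z \<bullet> z = y \<bullet> y"
    using plane_gen_skew[of a b y z] plane_gen_cube[OF assms, of x] by (simp add: y_def z_def)
  have sc: "sin t * sin t = 1 - cos t * cos t"
    using sin_cos_squared_add[of t] by (simp add: power2_eq_square)
  have e: "rot a b t x = x + sin t *\<^sub>R y + (1 - cos t) *\<^sub>R z"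
    by (simp add: rot_def y_def z_def)
  have "rot a b t x \<bullet> rot a b t x = x \<bullet> x + (sin t * sin t) * (y \<bullet> y)
      + 2 * (1 - cos t) * (x \<bullet> z) + (1 - cos t) * (1 - cos t) * (z \<bullet> z)
      + 2 * sin t * (x \<bullet> y) + 2 * sin t * (1 - cos t) * (y \<bullet> z)"
    unfolding e by (simp add: inner_add_left inner_add_right inner_commute algebra_simps)
  also have "\<dots> = x \<bullet> x"
    unfolding sc xy yz xz zz by (simp add: algebra_simps)
  finally show ?thesis by (simp add: norm_eq_sqrt_inner)
qed

lemma orthogonal_rot:
  assumes "a \<in> Basis" "b \<in> Basis"
  shows "orthogonal_transformation (rot a b t)"
  using norm_rot[OF assms] linear_rot by (auto simp: orthogonal_transformation)

lemma has_vector_derivative_rot: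
  assumes "a \<in> Basis" "b \<in> Basis"
  shows "((\<lambda>t. rot a b t x) has_vector_derivative plane_gen a b (rot a b t x)) (at t)"
proof -
  have "((\<lambda>t. rot a b t x) has_vector_derivative
      (cos t *\<^sub>R plane_gen a b x + sin t *\<^sub>R plane_gen a b (plane_gen a b x))) (at t)"
    unfolding rot_def
    by (auto intro!: derivative_eq_intros simp: has_real_derivative_iff_has_vector_derivative[symmetric])
  moreover have "plane_gen a b (rot a b t x)
      = cos t *\<^sub>R plane_gen a b x + sin t *\<^sub>R plane_gen a b (plane_gen a b x)"
    using plane_gen_cube[OF assms, of x] by (simp add: rot_def plane_gen_simps algebra_simps)
  ultimately show ?thesis by simp
qed

lemma continuous_on_rot: "continuous_on A (rot a b t)"
  by (simp add: linear_rot linear_continuous_on linear_linear)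

section \<open>Second derivatives along rotations\<close>

lemma linear_eq_sum_Basis:
  fixes D :: "'a::euclidean_space \<Rightarrow> real"
  assumes "linear D"
  shows "D v = (\<Sum>e\<in>Basis. (v \<bullet> e) * D e)"
proof -
  have "D v = D (\<Sum>e\<in>Basis. (v \<bullet> e) *\<^sub>R e)" by (simp add: euclidean_representation)
  then show ?thesis
    by (simp add: linear_sum[OF assms] linear_scale[OF assms] del: euclidean_representation)
qed

lemma bilinear_eq_sum_Basis:
  fixes E :: "'a::euclidean_space \<Rightarrow> 'a \<Rightarrow> real"
  assumes "\<And>w. linear (\<lambda>v. E v w)" "\<And>v. linear (E v)"
  shows "E v w = (\<Sum>a\<in>Basis. \<Sum>b\<in>Basis. (v \<bullet> a) * (w \<bullet> b) * E a b)"
proof -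
  have "E v w = (\<Sum>a\<in>Basis. (v \<bullet> a) * E a w)" by (rule linear_eq_sum_Basis[OF assms(1)])
  also have "\<dots> = (\<Sum>a\<in>Basis. (v \<bullet> a) * (\<Sum>b\<in>Basis. (w \<bullet> b) * E a b))"
    by (intro sum.cong refl arg_cong[where f="(*) _"] linear_eq_sum_Basis[OF assms(2)])
  finally show ?thesis by (simp add: sum_distrib_left mult.assoc)
qed

text \<open>If \<open>E v\<close> is the derivative of \<open>z \<mapsto> D z v\<close> and \<open>D z\<close> is linear, linearity is inherited by uniqueness
of derivatives. Together with the linearity of each \<open>E v\<close> this makes second derivatives bilinear.\<close>

lemma linear_second_derivative:
  fixes D :: "'a::euclidean_space \<Rightarrow> 'a \<Rightarrow> real"
  assumes U: "open U" "y \<in> U" and D: "\<And>z. z \<in> U \<Longrightarrow> linear (D z)"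
    and E: "\<And>v. ((\<lambda>z. D z v) has_derivative E v) (at y)"
  shows "linear (\<lambda>v. E v w)"
proof (rule linearI)
  fix u v :: 'a and c :: real
  have "((\<lambda>z. D z (u + v)) has_derivative (\<lambda>w. E u w + E v w)) (at y)"
    by (rule has_derivative_transform_within_open[OF has_derivative_add[OF E E] U])
       (simp add: D linear_add)
  from has_derivative_unique[OF this E]
  show "E (u + v) w = E u w + E v w" by (rule fun_cong[OF sym])
  have "((\<lambda>z. D z (c *\<^sub>R u)) has_derivative (\<lambda>w. c * E u w)) (at y)"
    by (rule has_derivative_transform_within_open[OF has_derivative_mult_right[OF E] U])
       (simp add: D linear_scale)
  from has_derivative_unique[OF this E]
  show "E (c *\<^sub>R u) w = c *\<^sub>R E u w" by (simp add: fun_eq_iff)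
qed

lemma second_derivative_along_rot:
  fixes G :: "'a::euclidean_space \<Rightarrow> real"
  assumes D: "\<And>y. y \<noteq> 0 \<Longrightarrow> (G has_derivative D y) (at y)"
    and E: "\<And>y v. y \<noteq> 0 \<Longrightarrow> ((\<lambda>y. D y v) has_derivative E y v) (at y)"
    and linE: "\<And>y w. y \<noteq> 0 \<Longrightarrow> linear (\<lambda>v. E y v w)"
    and ab: "a \<in> Basis" "b \<in> Basis" and x: "x \<noteq> 0"
  defines "J \<equiv> plane_gen a b"
  shows "((\<lambda>t. G (rot a b t x)) has_real_derivative D (rot a b t x) (J (rot a b t x))) (at t)"
    and "((\<lambda>t. D (rot a b t x) (J (rot a b t x))) has_real_derivative
      D (rot a b t x) (J (J (rot a b t x))) + E (rot a b t x) (J (rot a b t x)) (J (rot a b t x))) (at t)"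
proof -
  have nz: "rot a b t x \<noteq> 0" for t
    using norm_rot[OF ab, of t x] x by (metis norm_eq_zero)
  have lin: "linear (D y)" if "y \<noteq> 0" for y
    using D[OF that] has_derivative_linear by blast
  have exD: "D y v = (\<Sum>e\<in>Basis. (v \<bullet> e) * D y e)" if "y \<noteq> 0" for y v
    by (rule linear_eq_sum_Basis[OF lin[OF that]])
  have exE: "E y v w = (\<Sum>e\<in>Basis. (v \<bullet> e) * E y e w)" if "y \<noteq> 0" for y v w
    by (rule linear_eq_sum_Basis[OF linE[OF that]])
  have rv: "((\<lambda>t. rot a b t x) has_derivative (\<lambda>h. h *\<^sub>R J (rot a b t x))) (at t)"
    using has_vector_derivative_rot[OF ab, of x t] by (simp add: has_vector_derivative_def J_def)
  show "((\<lambda>t. G (rot a b t x)) has_real_derivative D (rot a b t x) (J (rot a b t x))) (at t)"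
    using has_derivative_compose[OF rv D[OF nz]] lin[OF nz]
    by (simp add: has_field_derivative_def linear_scale mult_commute_abs)
  have comp: "((\<lambda>t. D (rot a b t x) e) has_real_derivative E (rot a b t x) e (J (rot a b t x))) (at t)" for e
    using has_derivative_compose[OF rv E[OF nz, of e]] has_derivative_linear[OF E[OF nz, of e]]
    by (simp add: has_field_derivative_def linear_scale mult_commute_abs)
  have rJ: "((\<lambda>t. J (rot a b t x) \<bullet> e) has_real_derivative J (J (rot a b t x)) \<bullet> e) (at t)" for e
  proof -
    have "bounded_linear (\<lambda>y. J y \<bullet> e)"
      unfolding J_def
      by (rule bounded_linear_compose[OF bounded_linear_inner_left
            linear_plane_gen[unfolded linear_conv_bounded_linear]])
    from bounded_linear.has_derivative[OF this rv]
    show ?thesis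
      by (simp add: has_field_derivative_def J_def plane_gen_simps mult_commute_abs)
  qed
  have "((\<lambda>t. \<Sum>e\<in>Basis. (J (rot a b t x) \<bullet> e) * D (rot a b t x) e) has_real_derivative
      (\<Sum>e\<in>Basis. (J (J (rot a b t x)) \<bullet> e) * D (rot a b t x) e +
          E (rot a b t x) e (J (rot a b t x)) * (J (rot a b t x) \<bullet> e))) (at t)"
    by (intro DERIV_sum DERIV_mult rJ comp)
  moreover have "(\<Sum>e\<in>Basis. (J (J (rot a b t x)) \<bullet> e) * D (rot a b t x) e +
          E (rot a b t x) e (J (rot a b t x)) * (J (rot a b t x) \<bullet> e))
      = D (rot a b t x) (J (J (rot a b t x))) + E (rot a b t x) (J (rot a b t x)) (J (rot a b t x))"
    using exD[OF nz[of t], of "J (J (rot a b t x))"] exE[OF nz[of t], of "J (rot a b t x)" "J (rot a b t x)"]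
    by (simp add: sum.distrib mult.commute)
  ultimately show "((\<lambda>t. D (rot a b t x) (J (rot a b t x))) has_real_derivative
      D (rot a b t x) (J (J (rot a b t x))) + E (rot a b t x) (J (rot a b t x)) (J (rot a b t x))) (at t)"
    by (simp only: exD[OF nz, symmetric])
qed

text \<open>The second derivatives of a function along the rotations in all coordinate planes add up to
derivatives at one point: the cross terms of \<open>E (J x) (J x)\<close> recombine to \<open>E x x\<close>, the squares to \<open>\<bar>x\<bar>\<^sup>2\<close> times
the trace of \<open>E\<close>. Both the Laplacian of a smooth function on the sphere and that of a homogeneous
polynomial are read off from this identity.\<close>

lemma sum_plane_gen_second_order:
  fixes D :: "'a::euclidean_space \<Rightarrow> real" and E :: "'a \<Rightarrow> 'a \<Rightarrow> real"
  assumes D: "linear D" and E1: "\<And>w. linear (\<lambda>v. E v w)" and E2: "\<And>v. linear (E v)"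
  shows "(\<Sum>a\<in>Basis. \<Sum>b\<in>Basis. D (plane_gen a b (plane_gen a b x))
            + E (plane_gen a b x) (plane_gen a b x))
       = 2 * ((x \<bullet> x) * (\<Sum>b\<in>Basis. E b b) - E x x) - 2 * (real DIM('a) - 1) * D x"
proof -
  have Dx: "D x = (\<Sum>e\<in>Basis. (x \<bullet> e) * D e)" by (rule linear_eq_sum_Basis[OF D])
  have Exx: "E x x = (\<Sum>a\<in>Basis. \<Sum>b\<in>Basis. (x \<bullet> a) * (x \<bullet> b) * E a b)"
    by (rule bilinear_eq_sum_Basis[OF E1 E2])
  have xx: "x \<bullet> x = (\<Sum>e\<in>Basis. (x \<bullet> e) * (x \<bullet> e))"
    by (simp add: euclidean_inner[of x x])
  have EJ: "E (plane_gen a b x) (plane_gen a b x)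
      = (x \<bullet> a) * (x \<bullet> a) * E b b - (x \<bullet> a) * (x \<bullet> b) * E b a
        - (x \<bullet> a) * (x \<bullet> b) * E a b + (x \<bullet> b) * (x \<bullet> b) * E a a" for a b
  proof -
    have "E (s *\<^sub>R b - r *\<^sub>R a) (s *\<^sub>R b - r *\<^sub>R a)
        = s * (s * E b b - r * E a b) - r * (s * E b a - r * E a a)" for r s
      by (simp only: linear_diff[OF E1] linear_diff[OF E2] linear_scale[OF E1] linear_scale[OF E2]
          real_scaleR_def)
    from this[of "x \<bullet> a" "x \<bullet> b"] show ?thesis unfolding plane_gen_def by algebra
  qed
  have JJ: "plane_gen a b (plane_gen a b x)
      = (if a = b then 0 else - ((x \<bullet> a) *\<^sub>R a) - (x \<bullet> b) *\<^sub>R b)" if "a \<in> Basis" "b \<in> Basis" for a b :: 'a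
    using that by (auto simp: plane_gen_def inner_Basis algebra_simps)
  have DJ: "D (plane_gen a b (plane_gen a b x))
      = (if a = b then 0 else - ((x \<bullet> a) * D a) - (x \<bullet> b) * D b)" if "a \<in> Basis" "b \<in> Basis" for a b :: 'a
    using JJ[OF that] linear_0[OF D] linear_diff[OF D] linear_scale[OF D] linear_neg[OF D] by auto
  have "(\<Sum>a\<in>Basis. \<Sum>b\<in>Basis. D (plane_gen a b (plane_gen a b x)))
      = (\<Sum>a\<in>(Basis::'a set). \<Sum>b\<in>(Basis::'a set). - ((x \<bullet> a) * D a) - (x \<bullet> b) * D b + (if a = b then 2 * (x \<bullet> a) * D a else 0))"
    by (intro sum.cong refl) (simp add: DJ)
  also have "\<dots> = - 2 * (real DIM('a) - 1) * D x"
    unfolding Dx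
    by (simp add: sum.distrib sum_subtractf sum_negf sum_distrib_left sum_distrib_right algebra_simps)
  finally have 1: "(\<Sum>a\<in>Basis. \<Sum>b\<in>Basis. D (plane_gen a b (plane_gen a b x))) = - 2 * (real DIM('a) - 1) * D x" .
  have a1: "(\<Sum>a\<in>(Basis::'a set). \<Sum>b\<in>Basis. (x \<bullet> a) * (x \<bullet> a) * E b b) = (x \<bullet> x) * (\<Sum>b\<in>Basis. E b b)"
    unfolding xx sum_product ..
  have a2: "(\<Sum>a\<in>Basis. \<Sum>b\<in>Basis. (x \<bullet> b) * (x \<bullet> b) * E a a) = (x \<bullet> x) * (\<Sum>b\<in>Basis. E b b)"
    using a1 by (subst sum.swap) simp
  have a3: "(\<Sum>a\<in>Basis. \<Sum>b\<in>Basis. (x \<bullet> a) * (x \<bullet> b) * E b a) = E x x"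
    unfolding Exx by (subst sum.swap) (simp add: mult.commute)
  have 2: "(\<Sum>a\<in>Basis. \<Sum>b\<in>Basis. E (plane_gen a b x) (plane_gen a b x))
      = 2 * ((x \<bullet> x) * (\<Sum>b\<in>Basis. E b b) - E x x)"
    unfolding EJ by (simp add: sum.distrib sum_subtractf a1 a2 a3 Exx[symmetric])
  show ?thesis unfolding sum.distrib 1 2 by linarith
qed

section \<open>Rotation invariant integration over the sphere\<close>

lemma nn_integral_lborel_translate:
  fixes h :: "'a::euclidean_space \<Rightarrow> ennreal"
  assumes [measurable]: "h \<in> borel_measurable borel"
  shows "(\<integral>\<^sup>+x. h (c + x) \<partial>lborel) = (\<integral>\<^sup>+x. h x \<partial>lborel)"
proof -
  have "(\<integral>\<^sup>+x. h x \<partial>lborel) = (\<integral>\<^sup>+x. h x \<partial>(distr lborel borel ((+) c)))"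
    by (simp add: lborel_distr_plus)
  also have "\<dots> = (\<integral>\<^sup>+x. h (c + x) \<partial>lborel)"
    by (subst nn_integral_distr) auto
  finally show ?thesis by simp
qed

text \<open>The proof is the uniqueness argument for translation invariant measures: with \<open>B\<close> the unit ball,
\<open>\<integral>\<integral> 1\<^sub>A (R x) 1\<^sub>B y dx dy\<close> is computed in two ways, moving translations between the factors by Fubini's
theorem. Since \<open>R\<close> preserves \<open>B\<close>, the common factor \<open>vol B\<close> cancels.\<close>

lemma lborel_distr_orthogonal:
  fixes R :: "'a::euclidean_space \<Rightarrow> 'a"
  assumes R: "orthogonal_transformation R"
  shows "distr lborel borel R = lborel"
proof (rule measure_eqI)
  fix A :: "'a set" assume "A \<in> sets (distr lborel borel R)"
  then have A [measurable]: "A \<in> sets borel" by simp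
  have linR: "linear R" using R by (rule orthogonal_transformation_linear)
  have [measurable]: "R \<in> borel_measurable borel"
    by (intro borel_measurable_continuous_onI linear_continuous_on
        linR[unfolded linear_conv_bounded_linear])
  define B :: "'a set" where "B = ball 0 1"
  have [measurable]: "B \<in> sets borel" by (simp add: B_def)
  have surj: "surj R" using R by (rule orthogonal_transformation_surj)
  define S where "S = inv R"
  have RS: "R (S y) = y" for y unfolding S_def using surj by (simp add: surj_f_inv_f)
  have BR: "R x \<in> B \<longleftrightarrow> x \<in> B" for x
    using R by (simp add: B_def orthogonal_transformation_norm)
  have volB: "emeasure lborel B \<noteq> 0" "emeasure lborel B \<noteq> \<infinity>"
    using emeasure_lborel_ball_finite[of "0::'a" 1]
      less_imp_neq[OF unit_ball_vol_pos[of "real DIM('a)"]]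
    by (auto simp: B_def emeasure_ball)
  have "emeasure (distr lborel borel R) A = (\<integral>\<^sup>+x. indicator A x \<partial>distr lborel borel R)"
    by simp
  also have "\<dots> = (\<integral>\<^sup>+x. indicator A (R x) \<partial>lborel)"
    by (subst nn_integral_distr) auto
  finally have "emeasure (distr lborel borel R) A * emeasure lborel B
      = (\<integral>\<^sup>+x. indicator A (R x) \<partial>lborel) * (\<integral>\<^sup>+y. indicator B y \<partial>lborel)"
    by simp
  also have "\<dots> = (\<integral>\<^sup>+y. (\<integral>\<^sup>+x. indicator A (R x) \<partial>lborel) * indicator B y \<partial>lborel)"
    by (simp add: nn_integral_cmult)
  also have "\<dots> = (\<integral>\<^sup>+y. (\<integral>\<^sup>+x. indicator A (y + R x) \<partial>lborel) * indicator B y \<partial>lborel)"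
  proof (rule nn_integral_cong)
    fix y
    have "(\<integral>\<^sup>+x. indicator A (R x) \<partial>lborel) = (\<integral>\<^sup>+x. indicator A (R (S y + x)) \<partial>lborel)"
      by (rule nn_integral_lborel_translate[symmetric]) measurable
    then show "(\<integral>\<^sup>+x. indicator A (R x) \<partial>lborel) * indicator B y
        = (\<integral>\<^sup>+x. indicator A (y + R x) \<partial>lborel) * indicator B y"
      by (simp add: linear_add[OF linR] RS)
  qed
  also have "\<dots> = (\<integral>\<^sup>+y. (\<integral>\<^sup>+x. indicator A (y + R x) * indicator B y \<partial>lborel) \<partial>lborel)"
    by (intro nn_integral_cong nn_integral_multc[symmetric]) measurable
  also have "\<dots> = (\<integral>\<^sup>+x. (\<integral>\<^sup>+y. indicator A (y + R x) * indicator B y \<partial>lborel) \<partial>lborel)"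
    by (rule lborel_pair.Fubini') measurable
  also have "\<dots> = (\<integral>\<^sup>+x. (\<integral>\<^sup>+y. indicator A y * indicator B (y - R x) \<partial>lborel) \<partial>lborel)"
  proof (rule nn_integral_cong)
    fix x
    have "(\<integral>\<^sup>+y. indicator A y * indicator B (y - R x) \<partial>lborel)
        = (\<integral>\<^sup>+y. indicator A (R x + y) * indicator B (R x + y - R x) \<partial>lborel)"
      by (rule nn_integral_lborel_translate[symmetric]) measurable
    then show "(\<integral>\<^sup>+y. indicator A (y + R x) * indicator B y \<partial>lborel)
        = (\<integral>\<^sup>+y. indicator A y * indicator B (y - R x) \<partial>lborel)"
      by (simp add: add.commute)
  qed
  also have "\<dots> = (\<integral>\<^sup>+y. (\<integral>\<^sup>+x. indicator A y * indicator B (y - R x) \<partial>lborel) \<partial>lborel)"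
    by (rule lborel_pair.Fubini') measurable
  also have "\<dots> = (\<integral>\<^sup>+y. indicator A y * emeasure lborel B \<partial>lborel)"
  proof (rule nn_integral_cong)
    fix y
    have "(\<integral>\<^sup>+x. indicator B (y - R x) \<partial>lborel) = (\<integral>\<^sup>+x. indicator B (y - R (S y + x)) \<partial>lborel)"
      by (rule nn_integral_lborel_translate[symmetric]) measurable
    also have "\<dots> = (\<integral>\<^sup>+x. indicator B x \<partial>lborel)"
      using BR by (intro nn_integral_cong) (simp add: linear_add[OF linR] RS B_def indicator_def
          orthogonal_transformation_norm[OF R])
    finally show "(\<integral>\<^sup>+x. indicator A y * indicator B (y - R x) \<partial>lborel) = indicator A y * emeasure lborel B"
      by (simp add: nn_integral_cmult)
  qed
  also have "\<dots> = emeasure lborel A * emeasure lborel B"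
    by (simp add: nn_integral_multc)
  finally show "emeasure (distr lborel borel R) A = emeasure lborel A"
    using volB by (simp add: mult.commute[of _ "emeasure lborel B"] ennreal_mult_cancel_left)
qed simp

text \<open>A multiple of the surface measure: the image of Lebesgue measure on the punctured unit ball under
central projection. A constant factor does not affect orthogonality or Rayleigh quotients.\<close>

definition sph_measure :: "'a::euclidean_space measure"
  where "sph_measure =
    distr (restrict_space lborel (ball 0 1 - {0})) (restrict_space borel (sphere 0 1)) (\<lambda>x. x /\<^sub>R norm x)"

lemma space_sph_measure [simp]: "space sph_measure = sphere 0 1"
  by (simp add: sph_measure_def space_restrict_space)

lemma sets_sph_measure [measurable_cong]:
  "sets sph_measure = sets (restrict_space borel (sphere 0 1))"
  by (simp add: sph_measure_def)

lemma measurable_normalise: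
  "(\<lambda>x::'a::euclidean_space. x /\<^sub>R norm x) \<in> restrict_space lborel (ball 0 1 - {0}) \<rightarrow>\<^sub>M restrict_space borel (sphere 0 1)"
  by (rule measurable_restrict_space2) (auto simp: space_restrict_space intro!: measurable_restrict_space1)

lemma finite_measure_sph_measure: "finite_measure (sph_measure :: 'a::euclidean_space measure)"
  unfolding sph_measure_def
proof (rule finite_measure.finite_measure_distr[OF _ measurable_normalise])
  show "finite_measure (restrict_space lborel (ball (0::'a) 1 - {0}))"
  proof (rule finite_measureI)
    have "emeasure lborel (ball (0::'a) 1 - {0}) \<le> emeasure lborel (ball (0::'a) 1)"
      by (rule emeasure_mono) auto
    then show "emeasure (restrict_space lborel (ball (0::'a) 1 - {0}))
        (space (restrict_space lborel (ball 0 1 - {0}))) \<noteq> \<infinity>"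
      using emeasure_lborel_ball_finite[of "0::'a" 1]
      by (auto simp: space_restrict_space emeasure_restrict_space)
  qed
qed

lemma sph_measure_orthogonal:
  fixes R :: "'a::euclidean_space \<Rightarrow> 'a"
  assumes R: "orthogonal_transformation R"
  shows "R \<in> sph_measure \<rightarrow>\<^sub>M sph_measure"
    and "distr sph_measure sph_measure R = sph_measure"
proof -
  have linR: "linear R" using R by (rule orthogonal_transformation_linear)
  have RB [measurable]: "R \<in> borel_measurable borel"
    by (intro borel_measurable_continuous_onI linear_continuous_on
        linR[unfolded linear_conv_bounded_linear])
  have nR: "norm (R x) = norm x" for x using R by (rule orthogonal_transformation_norm)
  show m: "R \<in> sph_measure \<rightarrow>\<^sub>M sph_measure"
    unfolding measurable_cong_sets[OF sets_sph_measure sets_sph_measure]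
    by (rule measurable_restrict_space2)
       (auto simp: space_restrict_space nR intro!: measurable_restrict_space1)
  show "distr sph_measure sph_measure R = sph_measure"
  proof (rule measure_eqI)
    fix A assume "A \<in> sets (distr sph_measure sph_measure R)"
    then have As: "A \<in> sets sph_measure" by simp
    then have A: "A \<in> sets borel" "A \<subseteq> sphere 0 1"
      by (auto simp: sets_sph_measure sets_restrict_space)
    note [measurable] = A(1)
    have em: "emeasure sph_measure X = emeasure lborel {x \<in> ball 0 1 - {0}. x /\<^sub>R norm x \<in> X}"
      if "X \<in> sets sph_measure" for X :: "'a set"
      using that unfolding sph_measure_def
      by (subst emeasure_distr[OF measurable_normalise])
         (auto simp: emeasure_restrict_space space_restrict_space intro!: arg_cong[where f="emeasure lborel"])
    have "emeasure (distr sph_measure sph_measure R) A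
        = emeasure sph_measure (R -` A \<inter> sphere 0 1)"
      using emeasure_distr[OF m As] by simp
    also have "\<dots> = emeasure lborel {x \<in> ball 0 1 - {0}. x /\<^sub>R norm x \<in> R -` A \<inter> sphere 0 1}"
      using measurable_sets[OF m As] by (intro em) simp
    also have "{x \<in> ball 0 1 - {0}. x /\<^sub>R norm x \<in> R -` A \<inter> sphere 0 1}
        = R -` {x \<in> ball 0 1 - {0}. x /\<^sub>R norm x \<in> A} \<inter> space lborel"
      using A(2) nR by (auto simp: linear_scale[OF linR] linear_0[OF linR])
    also have "emeasure lborel \<dots> = emeasure (distr lborel borel R) {x \<in> ball 0 1 - {0}. x /\<^sub>R norm x \<in> A}"
      by (subst emeasure_distr) auto
    also have "\<dots> = emeasure sph_measure A"
      using em[OF As] by (simp add: lborel_distr_orthogonal[OF R])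
    finally show "emeasure (distr sph_measure sph_measure R) A = emeasure sph_measure A" .
  qed simp
qed

lemma sph_measure_open_pos:
  fixes A :: "'a::euclidean_space set"
  assumes "openin (top_of_set (sphere 0 1)) A" "A \<noteq> {}"
  shows "emeasure sph_measure A > 0"
proof -
  obtain U where U: "open U" "A = sphere 0 1 \<inter> U" using assms(1) by (auto simp: openin_open)
  have As: "A \<in> sets sph_measure"
    using U by (auto simp: sets_sph_measure sets_restrict_space)
  define V where "V = {x \<in> ball (0::'a) 1 - {0}. x /\<^sub>R norm x \<in> U}"
  have "emeasure sph_measure A = emeasure lborel V"
    using As unfolding sph_measure_def V_def
    by (subst emeasure_distr[OF measurable_normalise])
       (auto simp: emeasure_restrict_space space_restrict_space U intro!: arg_cong[where f="emeasure lborel"])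
  moreover have "open V"
  proof -
    have "continuous_on (ball (0::'a) 1 - {0}) (\<lambda>x. x /\<^sub>R norm x)"
      by (auto intro!: continuous_intros)
    then have "open ((ball (0::'a) 1 - {0}) \<inter> (\<lambda>x. x /\<^sub>R norm x) -` U)"
      by (intro continuous_open_preimage \<open>open U\<close>) auto
    moreover have "(ball (0::'a) 1 - {0}) \<inter> (\<lambda>x. x /\<^sub>R norm x) -` U = V" by (auto simp: V_def)
    ultimately show ?thesis by simp
  qed
  moreover have "V \<noteq> {}"
  proof -
    obtain x where "x \<in> A" using assms by auto
    then have "(1/2) *\<^sub>R x \<in> V" using U by (auto simp: V_def)
    then show ?thesis by auto
  qed
  moreover have "emeasure lborel V > 0" if ne: "open V" "V \<noteq> {}"
  proof -
    obtain x where "x \<in> V" using ne(2) by auto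
    then obtain e where "e > 0" "ball x e \<subseteq> V"
      using \<open>open V\<close> open_contains_ball by blast
    then have "emeasure lborel (ball x e) \<le> emeasure lborel V"
      using \<open>open V\<close> by (intro emeasure_mono) auto
    moreover have "emeasure lborel (ball x e) > 0"
      using \<open>e > 0\<close> by (simp add: emeasure_ball unit_ball_vol_pos)
    ultimately show ?thesis by order
  qed
  ultimately show ?thesis by simp
qed

definition sph_integral :: "('a::euclidean_space \<Rightarrow> real) \<Rightarrow> real"
  where "sph_integral u = integral\<^sup>L sph_measure u"

lemma borel_measurable_sphere:
  "cont_sph u \<Longrightarrow> (u :: 'a::euclidean_space \<Rightarrow> real) \<in> borel_measurable sph_measure"
  unfolding measurable_cong_sets[OF sets_sph_measure refl]
  by (rule borel_measurable_continuous_on_restrict)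

lemma integrable_sphere:
  fixes u :: "'a::euclidean_space \<Rightarrow> real"
  assumes "cont_sph u"
  shows "integrable sph_measure u"
proof -
  have "bounded (u ` sphere 0 1)"
    using assms by (intro compact_imp_bounded compact_continuous_image) auto
  then obtain B where "\<And>x. x \<in> sphere 0 1 \<Longrightarrow> norm (u x) \<le> B"
    by (metis bounded_iff image_eqI)
  then have "AE x in sph_measure. norm (u x) \<le> B"
    by (intro AE_I2) simp
  then show ?thesis
    using finite_measure.integrable_const_bound[OF finite_measure_sph_measure]
      borel_measurable_sphere[OF assms] by blast
qed

lemma sph_integral_orthogonal:
  fixes u :: "'a::euclidean_space \<Rightarrow> real" and R :: "'a \<Rightarrow> 'a"
  assumes "orthogonal_transformation R" "cont_sph u"
  shows "sph_integral (\<lambda>x. u (R x)) = sph_integral u"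
  unfolding sph_integral_def
  by (subst (2) sph_measure_orthogonal(2)[OF assms(1), symmetric],
      subst integral_distr[OF sph_measure_orthogonal(1)[OF assms(1)] borel_measurable_sphere[OF assms(2)]]) simp

lemma sph_integral_cong:
  "(\<And>x. x \<in> sphere 0 1 \<Longrightarrow> u x = v x) \<Longrightarrow> sph_integral u = sph_integral v"
  unfolding sph_integral_def by (intro Bochner_Integration.integral_cong) auto

lemma sph_integral_mono:
  "cont_sph u \<Longrightarrow> cont_sph v \<Longrightarrow>
    (\<And>x. x \<in> sphere 0 1 \<Longrightarrow> u x \<le> v x) \<Longrightarrow> sph_integral u \<le> sph_integral v"
  unfolding sph_integral_def by (intro integral_mono integrable_sphere) auto

lemma sph_integral_add:
  "cont_sph u \<Longrightarrow> cont_sph v \<Longrightarrow>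
    sph_integral (\<lambda>x. u x + v x) = sph_integral u + sph_integral v"
  unfolding sph_integral_def by (intro Bochner_Integration.integral_add integrable_sphere)

lemma sph_integral_diff:
  "cont_sph u \<Longrightarrow> cont_sph v \<Longrightarrow>
    sph_integral (\<lambda>x. u x - v x) = sph_integral u - sph_integral v"
  unfolding sph_integral_def by (intro Bochner_Integration.integral_diff integrable_sphere)

lemma sph_integral_cmult: "sph_integral (\<lambda>x. c * u x) = c * sph_integral u"
  unfolding sph_integral_def by simp

lemma sph_integral_sum:
  "(\<And>i. i \<in> I \<Longrightarrow> cont_sph (u i)) \<Longrightarrow>
    sph_integral (\<lambda>x. \<Sum>i\<in>I. u i x) = (\<Sum>i\<in>I. sph_integral (u i))"
  unfolding sph_integral_def by (intro Bochner_Integration.integral_sum integrable_sphere)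

lemma sph_integral_eq_0:
  fixes u :: "'a::euclidean_space \<Rightarrow> real"
  assumes u: "cont_sph u" and nn: "\<And>x. x \<in> sphere 0 1 \<Longrightarrow> u x \<ge> 0"
    and 0: "sph_integral u = 0" and x: "x \<in> sphere 0 1"
  shows "u x = 0"
proof (rule ccontr)
  assume "u x \<noteq> 0"
  define A where "A = sphere 0 1 \<inter> u -` {0<..}"
  have "openin (top_of_set (sphere 0 1)) A"
    unfolding A_def using u by (rule continuous_openin_preimage_gen) simp
  moreover have "x \<in> A" using \<open>u x \<noteq> 0\<close> nn[OF x] x by (simp add: A_def)
  ultimately have pos: "emeasure sph_measure A > 0"
    using sph_measure_open_pos by blast
  have "AE x in sph_measure. 0 \<le> u x"
    by (rule AE_I2) (simp add: nn)
  then have "AE x in sph_measure. u x = 0"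
    using integral_nonneg_eq_0_iff_AE[OF integrable_sphere[OF u]] 0
    by (simp add: sph_integral_def)
  moreover have [measurable]: "u \<in> borel_measurable sph_measure"
    by (rule borel_measurable_sphere[OF u])
  have meas: "{x \<in> space sph_measure. u x \<noteq> 0} \<in> sets sph_measure" by measurable
  ultimately have "emeasure sph_measure {x \<in> space sph_measure. u x \<noteq> 0} = 0"
    using AE_iff_measurable[OF meas, of "\<lambda>x. u x = 0"] by simp
  moreover have "A \<subseteq> {x \<in> space sph_measure. u x \<noteq> 0}" by (auto simp: A_def)
  then have "emeasure sph_measure A \<le> emeasure sph_measure {x \<in> space sph_measure. u x \<noteq> 0}"
    by (intro emeasure_mono meas)
  ultimately show False using pos by simp
qed

section \<open>The Laplacian of the sphere as a sum of second differences along rotations\<close>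

lemma radial_extension_sphere [simp]: "norm x = 1 \<Longrightarrow> radial_extension f x = f x"
  by (simp add: radial_extension_def)

lemma radial_extension_scale: "c > 0 \<Longrightarrow> radial_extension f (c *\<^sub>R x) = radial_extension f x"
proof -
  assume "c > 0"
  then have "inverse (norm (c *\<^sub>R x)) * c = inverse (norm x)" by (simp add: field_simps)
  then show ?thesis by (simp only: radial_extension_def scaleR_scaleR)
qed

lemma smooth_onE:
  assumes "smooth_on U f"
  obtains D where "\<And>x. x \<in> U \<Longrightarrow> (f has_derivative D x) (at x)" "\<And>v. smooth_on U (\<lambda>x. D x v)"
  using assms
proof (cases rule: smooth_on.cases)
  case (1 D)
  then show ?thesis by (rule that)
qed

lemma smooth_on_imp_continuous_on:
  assumes "smooth_on U f" shows "continuous_on U f"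
proof -
  obtain D where "\<And>x. x \<in> U \<Longrightarrow> (f has_derivative D x) (at x)"
    using smooth_onE[OF assms] by blast
  then have "isCont f x" if "x \<in> U" for x
    using that has_derivative_continuous by blast
  then show ?thesis by (simp add: continuous_at_imp_continuous_on)
qed

text \<open>The last clause holds because the extension is constant along rays.\<close>

lemma sphere_smooth_derivatives:
  fixes f :: "'a::euclidean_space \<Rightarrow> real"
  assumes "sphere_smooth f"
  obtains D E where
    "\<And>y. y \<noteq> 0 \<Longrightarrow> (radial_extension f has_derivative D y) (at y)"
    "\<And>y v. y \<noteq> 0 \<Longrightarrow> ((\<lambda>y. D y v) has_derivative E y v) (at y)"
    "\<And>v. continuous_on (- {0}) (\<lambda>y. D y v)"
    "\<And>v w. continuous_on (- {0}) (\<lambda>y. E y v w)"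
    "\<And>y w. y \<noteq> 0 \<Longrightarrow> linear (\<lambda>v. E y v w)"
    "\<And>y. y \<noteq> 0 \<Longrightarrow> D y y = 0"
proof -
  have "smooth_on (- {0}) (radial_extension f)" using assms by (simp add: sphere_smooth_def)
  then obtain D where D: "\<And>x. x \<in> - {0} \<Longrightarrow> (radial_extension f has_derivative D x) (at x)"
    and D': "\<And>v. smooth_on (- {0}) (\<lambda>x. D x v)" by (rule smooth_onE) blast
  have "\<forall>v. \<exists>E. (\<forall>x\<in>- {0}. ((\<lambda>x. D x v) has_derivative E x) (at x)) \<and> (\<forall>w. smooth_on (- {0}) (\<lambda>x. E x w))"
    using smooth_onE[OF D'] by metis
  then obtain E' where E': "\<And>v x. x \<in> - {0} \<Longrightarrow> ((\<lambda>x. D x v) has_derivative E' v x) (at x)"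
    and E'': "\<And>v w. smooth_on (- {0}) (\<lambda>x. E' v x w)" by metis
  define E where "E y v = E' v y" for y v
  have E: "((\<lambda>y. D y v) has_derivative E y v) (at y)" if "y \<noteq> 0" for y v
    using E'[of y v] that by (simp add: E_def)
  have linD: "linear (D y)" if "y \<noteq> 0" for y
    using D[of y] that has_derivative_linear by blast
  have opn: "open (- {0::'a})" by (simp add: open_Compl)
  have linE: "linear (\<lambda>v. E y v w)" if y: "y \<noteq> 0" for y w
    by (rule linear_second_derivative[OF opn _ _ E[OF y]]) (use y linD in auto)
  have radial: "D y y = 0" if y: "y \<noteq> 0" for y
  proof -
    have 1: "((\<lambda>t. t *\<^sub>R y) has_derivative (\<lambda>t. t *\<^sub>R y)) (at (1::real))"
      by (auto intro!: derivative_eq_intros)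
    have "((\<lambda>t. radial_extension f (t *\<^sub>R y)) has_derivative (\<lambda>t. D y (t *\<^sub>R y))) (at 1)"
      using has_derivative_compose[OF 1, of "radial_extension f" "D y"] D[of y] y by simp
    moreover have "((\<lambda>t. radial_extension f (t *\<^sub>R y)) has_derivative (\<lambda>t. 0)) (at (1::real))"
      by (rule has_derivative_transform_within_open[OF has_derivative_const[of "radial_extension f y"], of "{0<..}"])
         (auto simp: radial_extension_scale)
    ultimately have "(\<lambda>t. D y (t *\<^sub>R y)) = (\<lambda>t. 0)" by (rule has_derivative_unique)
    from fun_cong[OF this, of 1] show ?thesis by simp
  qed
  show ?thesis
  proof (rule that[of D E])
    show "continuous_on (- {0}) (\<lambda>y. E y v w)" for v w
      unfolding E_def by (rule smooth_on_imp_continuous_on[OF E''])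
  qed (use D E linE radial smooth_on_imp_continuous_on[OF D'] in simp_all)
qed

lemma has_derivative_normalise:
  fixes x :: "'a::euclidean_space"
  assumes "norm x = 1"
  shows "((\<lambda>y. y /\<^sub>R norm y) has_derivative (\<lambda>w. w - (x \<bullet> w) *\<^sub>R x)) (at x)"
proof -
  have "x \<noteq> 0" using assms by auto
  then have "(norm has_derivative (\<lambda>h. h \<bullet> x)) (at x)"
    using has_derivative_norm[of x] assms by (simp add: sgn_div_norm)
  with \<open>x \<noteq> 0\<close> show ?thesis
    using assms by (auto intro!: derivative_eq_intros simp: inner_commute)
qed

text \<open>The gradient field is extended along rays before it is differentiated, so the inner map
\<open>y \<mapsto> y / \<bar>y\<bar>\<close> contributes the projection to the tangent space; it removes \<open>E x x x\<close> from the trace.\<close>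

lemma sphere_laplacian_eq_second_derivatives:
  fixes f :: "'a::euclidean_space \<Rightarrow> real"
  assumes D: "\<And>y. y \<noteq> 0 \<Longrightarrow> (radial_extension f has_derivative D y) (at y)"
    and E: "\<And>y v. y \<noteq> 0 \<Longrightarrow> ((\<lambda>y. D y v) has_derivative E y v) (at y)"
    and linE: "\<And>y w. y \<noteq> 0 \<Longrightarrow> linear (\<lambda>v. E y v w)"
    and x: "norm x = 1"
  shows "sphere_laplacian f x = (\<Sum>b\<in>Basis. E x b b) - E x x x"
proof -
  have x0: "x \<noteq> 0" using x by auto
  have fd: "frechet_derivative (radial_extension f) (at y) = D y" if "y \<noteq> 0" for y
    using frechet_derivative_at[OF D[OF that]] by simp
  have "((\<lambda>y. \<Sum>b\<in>Basis. D (y /\<^sub>R norm y) b *\<^sub>R b) has_derivative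
      (\<lambda>w. \<Sum>b\<in>Basis. E x b (w - (x \<bullet> w) *\<^sub>R x) *\<^sub>R b)) (at x)"
  proof (intro has_derivative_sum has_derivative_scaleR_left)
    fix b :: 'a
    have "(x /\<^sub>R norm x) = x" using x by simp
    then show "((\<lambda>y. D (y /\<^sub>R norm y) b) has_derivative (\<lambda>w. E x b (w - (x \<bullet> w) *\<^sub>R x))) (at x)"
      using has_derivative_compose[OF has_derivative_normalise[OF x], of "\<lambda>y. D y b" "E x b"] E[OF x0, of b]
      by simp
  qed
  then have "(radial_extension (sphere_gradient f) has_derivative
      (\<lambda>w. \<Sum>b\<in>Basis. E x b (w - (x \<bullet> w) *\<^sub>R x) *\<^sub>R b)) (at x)"
  proof (rule has_derivative_transform_within_open[of _ _ _ _ "- {0}"])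
    show "open (- {0::'a})" by (simp add: open_Compl)
    show "(\<Sum>b\<in>Basis. D (y /\<^sub>R norm y) b *\<^sub>R b) = radial_extension (sphere_gradient f) y"
      if "y \<in> - {0}" for y
      using that by (simp add: radial_extension_def sphere_gradient_def fd)
  qed (use x0 in simp)
  then have "frechet_derivative (radial_extension (sphere_gradient f)) (at x)
      = (\<lambda>w. \<Sum>b\<in>Basis. E x b (w - (x \<bullet> w) *\<^sub>R x) *\<^sub>R b)"
    by (rule frechet_derivative_at[symmetric])
  then have "sphere_laplacian f x
      = (\<Sum>b\<in>Basis. (\<Sum>c\<in>Basis. E x c (b - (x \<bullet> b) *\<^sub>R x) *\<^sub>R c) \<bullet> b)"
    by (simp add: sphere_laplacian_def sphere_divergence_def)
  also have "\<dots> = (\<Sum>b\<in>Basis. E x b (b - (x \<bullet> b) *\<^sub>R x))"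
    by (intro sum.cong refl) simp
  also have "\<dots> = (\<Sum>b\<in>Basis. E x b b - (x \<bullet> b) * E x b x)"
  proof (intro sum.cong refl)
    fix b :: 'a
    have "linear (E x b)" using E[OF x0] has_derivative_linear by blast
    then show "E x b (b - (x \<bullet> b) *\<^sub>R x) = E x b b - (x \<bullet> b) * E x b x"
      by (simp add: linear_diff linear_scale)
  qed
  finally show ?thesis
    using linear_eq_sum_Basis[OF linE[OF x0], of x x] by (simp add: sum_subtractf)
qed

text \<open>The first and second derivatives along rotations are again functions of the point on the sphere,
because the rotations in a plane form a one-parameter group. Their sum is twice the Laplacian: the first
order term in \<open>sum_plane_gen_second_order\<close> is a radial derivative, which vanishes.\<close>

lemma sphere_smooth_rot:
  fixes f :: "'a::euclidean_space \<Rightarrow> real"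
  assumes "sphere_smooth f"
  obtains G H where
    "\<And>a b. cont_sph (G a b)"
    "\<And>a b. cont_sph (H a b)"
    "\<And>a b x t. a \<in> Basis \<Longrightarrow> b \<in> Basis \<Longrightarrow> norm x = 1 \<Longrightarrow>
        ((\<lambda>t. f (rot a b t x)) has_real_derivative G a b (rot a b t x)) (at t)"
    "\<And>a b x t. a \<in> Basis \<Longrightarrow> b \<in> Basis \<Longrightarrow> norm x = 1 \<Longrightarrow>
        ((\<lambda>t. G a b (rot a b t x)) has_real_derivative H a b (rot a b t x)) (at t)"
    "\<And>x. norm x = 1 \<Longrightarrow> (\<Sum>a\<in>Basis. \<Sum>b\<in>Basis. H a b x) = 2 * sphere_laplacian f x"
proof -
  obtain D E where D: "\<And>y. y \<noteq> 0 \<Longrightarrow> (radial_extension f has_derivative D y) (at y)"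
    and E: "\<And>y v. y \<noteq> 0 \<Longrightarrow> ((\<lambda>y. D y v) has_derivative E y v) (at y)"
    and cD: "\<And>v. continuous_on (- {0}) (\<lambda>y. D y v)"
    and cE: "\<And>v w. continuous_on (- {0}) (\<lambda>y. E y v w)"
    and linE: "\<And>y w. y \<noteq> 0 \<Longrightarrow> linear (\<lambda>v. E y v w)"
    and rad: "\<And>y. y \<noteq> 0 \<Longrightarrow> D y y = 0"
    by (rule sphere_smooth_derivatives[OF assms]) (rule that)
  have linD: "linear (D y)" and linE2: "linear (E y v)" if "y \<noteq> 0" for y v
    using D[OF that] E[OF that] has_derivative_linear by blast+
  define G where "G a b y = D y (plane_gen a b y)" for a b y
  define H where "H a b y = D y (plane_gen a b (plane_gen a b y))
      + E y (plane_gen a b y) (plane_gen a b y)" for a b y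
  have sub: "sphere (0::'a) 1 \<subseteq> - {0}" by auto
  have cJ: "continuous_on A (plane_gen a b)" for A a b
    by (simp add: linear_plane_gen linear_continuous_on[OF linear_plane_gen[unfolded linear_conv_bounded_linear]])
  have contD: "cont_sph (\<lambda>y. D y (g y))" if g: "cont_sph g" for g
  proof -
    have "cont_sph (\<lambda>y. \<Sum>e\<in>Basis. (g y \<bullet> e) * D y e)"
      by (intro continuous_intros g continuous_on_subset[OF cD sub])
    then show ?thesis
      by (rule continuous_on_eq) (use sub in \<open>intro linear_eq_sum_Basis[symmetric] linD, auto\<close>)
  qed
  have contE: "cont_sph (\<lambda>y. E y (g y) (g y))" if g: "cont_sph g" for g
  proof -
    have "cont_sph (\<lambda>y. \<Sum>a\<in>Basis. \<Sum>b\<in>Basis. (g y \<bullet> a) * (g y \<bullet> b) * E y a b)"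
      by (intro continuous_intros g continuous_on_subset[OF cE sub])
    then show ?thesis
      by (rule continuous_on_eq) (use sub in \<open>intro bilinear_eq_sum_Basis[symmetric] linE linE2, auto\<close>)
  qed
  show ?thesis
  proof (rule that[of G H])
    show "cont_sph (G a b)" for a b
      unfolding G_def by (intro contD cJ)
    show "cont_sph (H a b)" for a b
      unfolding H_def
      by (intro continuous_on_add contD contE cJ continuous_on_compose2[OF cJ[of UNIV] cJ]) auto
    fix a b x :: 'a and t :: real
    assume ab: "a \<in> Basis" "b \<in> Basis" and x: "norm x = 1"
    then have x0: "x \<noteq> 0" by auto
    note der = second_derivative_along_rot[OF D E linE ab x0, of t]
    show "((\<lambda>t. f (rot a b t x)) has_real_derivative G a b (rot a b t x)) (at t)"
      using der(1) x ab by (simp add: G_def)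
    show "((\<lambda>t. G a b (rot a b t x)) has_real_derivative H a b (rot a b t x)) (at t)"
      using der(2) by (simp add: G_def H_def)
  next
    fix x :: 'a assume x: "norm x = 1"
    then have x0: "x \<noteq> 0" by auto
    have "(\<Sum>a\<in>Basis. \<Sum>b\<in>Basis. H a b x) = 2 * ((x \<bullet> x) * (\<Sum>b\<in>Basis. E x b b) - E x x x)
        - 2 * (real DIM('a) - 1) * D x x"
      unfolding H_def by (rule sum_plane_gen_second_order[OF linD[OF x0] linE[OF x0] linE2[OF x0]])
    also have "\<dots> = 2 * sphere_laplacian f x"
      using x rad[OF x0] sphere_laplacian_eq_second_derivatives[OF D E linE x]
      by (simp add: dot_square_norm)
    finally show "(\<Sum>a\<in>Basis. \<Sum>b\<in>Basis. H a b x) = 2 * sphere_laplacian f x" .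
  qed
qed

text \<open>The rotations by \<open>t\<close> and \<open>- t\<close> are both used in order to cancel the first derivative.\<close>

definition second_diff :: "('a::euclidean_space \<Rightarrow> real) \<Rightarrow> 'a \<Rightarrow> 'a \<Rightarrow> real \<Rightarrow> 'a \<Rightarrow> real"
  where "second_diff f a b t x = f (rot a b t x) + f (rot a b (- t) x) - 2 * f x"

text \<open>All limits \<open>t \<rightarrow> 0\<close> are taken along this sequence of angles, so that the dominated convergence
theorem for sequences applies.\<close>

definition step :: "nat \<Rightarrow> real" where "step k = inverse (real (Suc k))"

lemma step_pos [simp]: "step k > 0" by (simp add: step_def)

lemma step_nonzero [simp]: "step k \<noteq> 0" by (metis step_pos less_irrefl)

lemma step_tendsto_0: "step \<longlonglongrightarrow> 0"
  unfolding step_def by (rule LIMSEQ_inverse_real_of_nat)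

lemma bounded_on_sphere:
  fixes u :: "'a::euclidean_space \<Rightarrow> real"
  assumes "cont_sph u"
  obtains B where "B \<ge> 0" "\<And>x. norm x = 1 \<Longrightarrow> \<bar>u x\<bar> \<le> B"
proof -
  have "bounded (u ` sphere 0 1)"
    using assms by (intro compact_imp_bounded compact_continuous_image) auto
  then obtain B where "\<forall>y\<in>u ` sphere 0 1. norm y \<le> B" by (auto simp: bounded_iff)
  then have "\<bar>u x\<bar> \<le> \<bar>B\<bar>" if "norm x = 1" for x
    using that by (force simp: abs_le_iff)
  then show ?thesis using that[of "\<bar>B\<bar>"] by simp
qed

lemma sphere_smooth_lipschitz_rot:
  fixes f :: "'a::euclidean_space \<Rightarrow> real"
  assumes f: "sphere_smooth f" and ab: "a \<in> Basis" "b \<in> Basis"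
  obtains L where "L \<ge> 0" "\<And>x s t. norm x = 1 \<Longrightarrow> \<bar>f (rot a b s x) - f (rot a b t x)\<bar> \<le> L * \<bar>s - t\<bar>"
proof -
  obtain G where cG: "cont_sph (G a b)"
    and dG: "\<And>x t. norm x = 1 \<Longrightarrow>
        ((\<lambda>t. f (rot a b t x)) has_real_derivative G a b (rot a b t x)) (at t)"
    by (rule sphere_smooth_rot[OF f]) (use ab that in blast)
  obtain L where L: "L \<ge> 0" "\<And>x. norm x = 1 \<Longrightarrow> \<bar>G a b x\<bar> \<le> L"
    using bounded_on_sphere[OF cG] by metis
  have "\<bar>f (rot a b s x) - f (rot a b t x)\<bar> \<le> L * \<bar>s - t\<bar>" if x: "norm x = 1" for x s t
    using field_differentiable_bound[of UNIV "\<lambda>t. f (rot a b t x)" "\<lambda>t. G a b (rot a b t x)" L s t]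
      dG[OF x] L(2) ab x by simp
  then show ?thesis using that L(1) by blast
qed

text \<open>The mean value form gives a bound by \<open>t\<^sup>2\<close> that is uniform on the sphere, and at the same time the
pointwise limit.\<close>

lemma second_diff_mean_value:
  assumes d1: "\<And>t. (\<phi> has_real_derivative \<gamma> t) (at t)" and d2: "\<And>t. (\<gamma> has_real_derivative \<eta> t) (at t)"
  shows "\<exists>s s'. \<bar>s\<bar> \<le> \<bar>t\<bar> \<and> \<bar>s'\<bar> \<le> \<bar>t\<bar> \<and> \<phi> t + \<phi> (- t) - 2 * \<phi> 0 = t\<^sup>2 * ((\<eta> s + \<eta> s') / 2)"
proof -
  define diff where "diff m = (if m = 0 then \<phi> else if m = 1 then \<gamma> else \<eta>)" for m :: nat
  have *: "\<exists>s. \<bar>s\<bar> \<le> \<bar>t\<bar> \<and> \<phi> t = \<phi> 0 + \<gamma> 0 * t + \<eta> s / 2 * t\<^sup>2" for t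
  proof -
    have "\<exists>s. \<bar>s\<bar> \<le> \<bar>t\<bar> \<and> \<phi> t = (\<Sum>m<2. diff m 0 / fact m * t ^ m) + diff 2 s / fact 2 * t ^ 2"
      using d1 d2 by (intro Maclaurin_bi_le) (auto simp: diff_def less_2_cases_iff)
    then show ?thesis by (simp add: diff_def numeral_2_eq_2)
  qed
  obtain s s' where "\<bar>s\<bar> \<le> \<bar>t\<bar>" "\<phi> t = \<phi> 0 + \<gamma> 0 * t + \<eta> s / 2 * t\<^sup>2"
    "\<bar>s'\<bar> \<le> \<bar>-t\<bar>" "\<phi> (- t) = \<phi> 0 + \<gamma> 0 * (- t) + \<eta> s' / 2 * (- t)\<^sup>2"
    using *[of t] *[of "- t"] by blast
  then show ?thesis by (intro exI[of _ s] exI[of _ s']) (simp add: algebra_simps)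
qed

lemma sphere_smooth_second_diff:
  fixes f :: "'a::euclidean_space \<Rightarrow> real"
  assumes f: "sphere_smooth f"
  obtains H where
    "\<And>a b. cont_sph (H a b)"
    "\<And>a b. a \<in> Basis \<Longrightarrow> b \<in> Basis \<Longrightarrow>
       \<exists>B. \<forall>x t. norm x = 1 \<longrightarrow> \<bar>second_diff f a b t x\<bar> \<le> B * t\<^sup>2"
    "\<And>a b x. a \<in> Basis \<Longrightarrow> b \<in> Basis \<Longrightarrow> norm x = 1 \<Longrightarrow>
       (\<lambda>k. second_diff f a b (step k) x / (step k)\<^sup>2) \<longlonglongrightarrow> H a b x"
    "\<And>x. norm x = 1 \<Longrightarrow> (\<Sum>a\<in>Basis. \<Sum>b\<in>Basis. H a b x) = 2 * sphere_laplacian f x"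
proof -
  obtain G H where cH: "\<And>a b. cont_sph (H a b)"
    and d1: "\<And>a b x t. a \<in> Basis \<Longrightarrow> b \<in> Basis \<Longrightarrow> norm x = 1 \<Longrightarrow>
        ((\<lambda>t. f (rot a b t x)) has_real_derivative G a b (rot a b t x)) (at t)"
    and d2: "\<And>a b x t. a \<in> Basis \<Longrightarrow> b \<in> Basis \<Longrightarrow> norm x = 1 \<Longrightarrow>
        ((\<lambda>t. G a b (rot a b t x)) has_real_derivative H a b (rot a b t x)) (at t)"
    and sum: "\<And>x. norm x = 1 \<Longrightarrow> (\<Sum>a\<in>Basis. \<Sum>b\<in>Basis. H a b x) = 2 * sphere_laplacian f x"
    by (rule sphere_smooth_rot[OF f]) (use that in blast)
  have mv: "\<exists>s s'. \<bar>s\<bar> \<le> \<bar>t\<bar> \<and> \<bar>s'\<bar> \<le> \<bar>t\<bar> \<and>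
      second_diff f a b t x = t\<^sup>2 * ((H a b (rot a b s x) + H a b (rot a b s' x)) / 2)"
    if "a \<in> Basis" "b \<in> Basis" "norm x = 1" for a b x t
    using second_diff_mean_value[OF d1[OF that] d2[OF that], of t]
    by (simp add: second_diff_def)
  have bound: "\<exists>B. \<forall>x t. norm x = 1 \<longrightarrow> \<bar>second_diff f a b t x\<bar> \<le> B * t\<^sup>2"
    if ab: "a \<in> Basis" "b \<in> Basis" for a b
  proof -
    obtain B where B: "B \<ge> 0" "\<And>x. norm x = 1 \<Longrightarrow> \<bar>H a b x\<bar> \<le> B"
      using bounded_on_sphere[OF cH[of a b]] by metis
    have "\<bar>second_diff f a b t x\<bar> \<le> B * t\<^sup>2" if x: "norm x = 1" for x t
    proof -
      obtain s s' where eq: "second_diff f a b t x = t\<^sup>2 * ((H a b (rot a b s x) + H a b (rot a b s' x)) / 2)"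
        using mv[OF ab x] by metis
      have "\<bar>H a b (rot a b s x)\<bar> \<le> B" "\<bar>H a b (rot a b s' x)\<bar> \<le> B"
        using B ab x by simp_all
      then have "\<bar>(H a b (rot a b s x) + H a b (rot a b s' x)) / 2\<bar> \<le> B" by (simp add: abs_le_iff)
      then have "t\<^sup>2 * \<bar>(H a b (rot a b s x) + H a b (rot a b s' x)) / 2\<bar> \<le> t\<^sup>2 * B"
        by (rule mult_left_mono) simp
      then show ?thesis unfolding eq abs_mult by (simp add: mult.commute)
    qed
    then show ?thesis by blast
  qed
  have lim: "(\<lambda>k. second_diff f a b (step k) x / (step k)\<^sup>2) \<longlonglongrightarrow> H a b x"
    if ab: "a \<in> Basis" "b \<in> Basis" and x: "norm x = 1" for a b x
  proof -
    have "\<forall>k. \<exists>s s'. \<bar>s\<bar> \<le> \<bar>step k\<bar> \<and> \<bar>s'\<bar> \<le> \<bar>step k\<bar> \<and>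
      second_diff f a b (step k) x = (step k)\<^sup>2 * ((H a b (rot a b s x) + H a b (rot a b s' x)) / 2)"
      using mv[OF ab x] by blast
    then obtain s s' where s: "\<And>k. \<bar>s k\<bar> \<le> \<bar>step k\<bar>" "\<And>k. \<bar>s' k\<bar> \<le> \<bar>step k\<bar>"
      and eq: "\<And>k. second_diff f a b (step k) x
          = (step k)\<^sup>2 * ((H a b (rot a b (s k) x) + H a b (rot a b (s' k) x)) / 2)"
      by metis
    have s0: "s \<longlonglongrightarrow> 0" "s' \<longlonglongrightarrow> 0"
      by (rule tendsto_rabs_zero_cancel, rule tendsto_sandwich[OF _ _ tendsto_const tendsto_rabs_zero[OF step_tendsto_0]];
          use s in simp)+
    have "continuous_on UNIV (\<lambda>t. rot a b t x)"
      unfolding rot_def by (intro continuous_intros)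
    then have "continuous_on UNIV (\<lambda>t. H a b (rot a b t x))"
      by (rule continuous_on_compose2[OF cH]) (use ab x in auto)
    then have ic: "isCont (\<lambda>t. H a b (rot a b t x)) 0"
      by (simp add: continuous_on_eq_continuous_at)
    have "(\<lambda>k. (H a b (rot a b (s k) x) + H a b (rot a b (s' k) x)) / 2)
        \<longlonglongrightarrow> (H a b (rot a b 0 x) + H a b (rot a b 0 x)) / 2"
      by (intro tendsto_intros isCont_tendsto_compose[OF ic] s0) simp_all
    then show ?thesis by (simp add: eq)
  qed
  show ?thesis by (rule that[of H, OF cH bound lim sum])
qed

lemma sphere_laplacian_pointwise_limit:
  fixes f :: "'a::euclidean_space \<Rightarrow> real"
  assumes f: "sphere_smooth f" and x: "norm x = 1"
  shows "(\<lambda>k. \<Sum>a\<in>Basis. \<Sum>b\<in>Basis. second_diff f a b (step k) x / (step k)\<^sup>2)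
    \<longlonglongrightarrow> 2 * sphere_laplacian f x"
proof -
  obtain H where H: "\<And>a b x. a \<in> Basis \<Longrightarrow> b \<in> Basis \<Longrightarrow> norm x = 1 \<Longrightarrow>
       (\<lambda>k. second_diff f a b (step k) x / (step k)\<^sup>2) \<longlonglongrightarrow> H a b x"
    and sum: "\<And>x. norm x = 1 \<Longrightarrow> (\<Sum>a\<in>Basis. \<Sum>b\<in>Basis. H a b x) = 2 * sphere_laplacian f x"
    by (rule sphere_smooth_second_diff[OF f]) (use that in blast)
  show ?thesis
    unfolding sum[OF x, symmetric] by (intro tendsto_sum H x)
qed

lemma sphere_smooth_continuous_on:
  fixes f :: "'a::euclidean_space \<Rightarrow> real"
  assumes "sphere_smooth f" shows "cont_sph f"
proof -
  have "continuous_on (- {0}) (radial_extension f)"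
    using assms smooth_on_imp_continuous_on by (auto simp: sphere_smooth_def)
  then have "cont_sph (radial_extension f)"
    by (rule continuous_on_subset) auto
  then show ?thesis by (rule continuous_on_eq) simp
qed

lemma continuous_on_compose_rot:
  "cont_sph u \<Longrightarrow> a \<in> Basis \<Longrightarrow> b \<in> Basis \<Longrightarrow>
    cont_sph (\<lambda>x. u (rot a b t x))"
  by (rule continuous_on_compose2[OF _ continuous_on_rot]) auto

lemma continuous_on_second_diff:
  "cont_sph u \<Longrightarrow> a \<in> Basis \<Longrightarrow> b \<in> Basis \<Longrightarrow>
    cont_sph (second_diff u a b t)"
  unfolding second_diff_def by (intro continuous_intros continuous_on_compose_rot)

text \<open>The left-hand side tests the Laplacian against functions that are merely continuous; by rotation
invariance it is symmetric in \<open>f\<close> and \<open>u\<close> when both are smooth, which is the self-adjointness of the Laplacian.\<close>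

lemma sphere_laplacian_weak_limit:
  fixes f u :: "'a::euclidean_space \<Rightarrow> real"
  assumes f: "sphere_smooth f" and u: "cont_sph u"
  shows "(\<lambda>k. \<Sum>a\<in>Basis. \<Sum>b\<in>Basis.
        sph_integral (\<lambda>x. u x * second_diff f a b (step k) x) / (step k)\<^sup>2)
    \<longlonglongrightarrow> 2 * sph_integral (\<lambda>x. u x * sphere_laplacian f x)"
proof -
  obtain H where cH: "\<And>a b. cont_sph (H a b)"
    and bd: "\<And>a b. a \<in> Basis \<Longrightarrow> b \<in> Basis \<Longrightarrow>
       \<exists>B. \<forall>x t. norm x = 1 \<longrightarrow> \<bar>second_diff f a b t x\<bar> \<le> B * t\<^sup>2"
    and H: "\<And>a b x. a \<in> Basis \<Longrightarrow> b \<in> Basis \<Longrightarrow> norm x = 1 \<Longrightarrow>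
       (\<lambda>k. second_diff f a b (step k) x / (step k)\<^sup>2) \<longlonglongrightarrow> H a b x"
    and sum: "\<And>x. norm x = 1 \<Longrightarrow> (\<Sum>a\<in>Basis. \<Sum>b\<in>Basis. H a b x) = 2 * sphere_laplacian f x"
    by (rule sphere_smooth_second_diff[OF f]) (use that in blast)
  have cf: "cont_sph f" using f by (rule sphere_smooth_continuous_on)
  have lim: "(\<lambda>k. sph_integral (\<lambda>x. u x * second_diff f a b (step k) x) / (step k)\<^sup>2)
      \<longlonglongrightarrow> sph_integral (\<lambda>x. u x * H a b x)" if ab: "a \<in> Basis" "b \<in> Basis" for a b
  proof -
    obtain B where B: "\<And>x t. norm x = 1 \<Longrightarrow> \<bar>second_diff f a b t x\<bar> \<le> B * t\<^sup>2"
      using bd[OF ab] by blast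
    have "(\<lambda>k. sph_integral (\<lambda>x. u x * (second_diff f a b (step k) x / (step k)\<^sup>2)))
        \<longlonglongrightarrow> sph_integral (\<lambda>x. u x * H a b x)"
      unfolding sph_integral_def
    proof (rule integral_dominated_convergence[where w="\<lambda>x. \<bar>u x\<bar> * B"])
      show "integrable sph_measure (\<lambda>x. \<bar>u x\<bar> * B)"
        by (intro integrable_sphere continuous_intros u)
      show "(\<lambda>x. u x * H a b x) \<in> borel_measurable sph_measure"
        by (intro borel_measurable_sphere continuous_intros u cH)
      show "(\<lambda>x. u x * (second_diff f a b (step k) x / (step k)\<^sup>2)) \<in> borel_measurable sph_measure" for k
        by (intro borel_measurable_sphere continuous_intros u continuous_on_second_diff ab cf) simp_all
      show "AE x in sph_measure. (\<lambda>k. u x * (second_diff f a b (step k) x / (step k)\<^sup>2)) \<longlonglongrightarrow> u x * H a b x"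
        by (rule AE_I2, intro tendsto_intros H ab) simp
      show "AE x in sph_measure. norm (u x * (second_diff f a b (step k) x / (step k)\<^sup>2)) \<le> \<bar>u x\<bar> * B" for k
      proof (rule AE_I2)
        fix x :: 'a assume "x \<in> space sph_measure"
        then have "\<bar>second_diff f a b (step k) x\<bar> \<le> B * (step k)\<^sup>2" using B by simp
        then have "\<bar>second_diff f a b (step k) x\<bar> / (step k)\<^sup>2 \<le> B" by (simp add: divide_le_eq)
        then show "norm (u x * (second_diff f a b (step k) x / (step k)\<^sup>2)) \<le> \<bar>u x\<bar> * B"
          by (metis abs_ge_zero abs_mult abs_divide abs_power2 mult_left_mono real_norm_def)
      qed
    qed
    moreover have "sph_integral (\<lambda>x. u x * (second_diff f a b (step k) x / (step k)\<^sup>2))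
        = sph_integral (\<lambda>x. u x * second_diff f a b (step k) x) / (step k)\<^sup>2" for k
      by (simp add: sph_integral_def)
    ultimately show ?thesis by simp
  qed
  have "(\<Sum>a\<in>Basis. \<Sum>b\<in>Basis. sph_integral (\<lambda>x. u x * H a b x))
      = sph_integral (\<lambda>x. \<Sum>a\<in>Basis. \<Sum>b\<in>Basis. u x * H a b x)"
    by (simp add: sph_integral_sum continuous_on_sum continuous_on_mult u cH)
  also have "\<dots> = sph_integral (\<lambda>x. 2 * (u x * sphere_laplacian f x))"
    by (rule sph_integral_cong) (simp add: sum_distrib_left[symmetric] sum)
  finally have "2 * sph_integral (\<lambda>x. u x * sphere_laplacian f x)
      = (\<Sum>a\<in>Basis. \<Sum>b\<in>Basis. sph_integral (\<lambda>x. u x * H a b x))"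
    by (simp add: sph_integral_cmult)
  then show ?thesis
    by (simp only:) (intro tendsto_sum lim)
qed

lemma sum_fun_apply [simp]: "(\<Sum>i\<in>I. F i) x = (\<Sum>i\<in>I. F i x)"
  by (induction I rule: infinite_finite_induct) auto

section \<open>Homogeneous polynomials\<close>

fun monomials :: "nat \<Rightarrow> ('a::euclidean_space \<Rightarrow> real) set" where
  "monomials 0 = {\<lambda>x. 1}"
| "monomials (Suc m) = (\<lambda>(b, p) x. (x \<bullet> b) * p x) ` (Basis \<times> monomials m)"

definition hpoly :: "nat \<Rightarrow> ('a::euclidean_space \<Rightarrow> real) set"
  where "hpoly m = span (monomials m)"

lemma finite_monomials: "finite (monomials m)"
  by (induction m) auto

lemma hpoly_add: "p \<in> hpoly m \<Longrightarrow> q \<in> hpoly m \<Longrightarrow> (\<lambda>x. p x + q x) \<in> hpoly m"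
  using span_add[of p "monomials m" q] by (simp add: hpoly_def plus_fun_def)

lemma hpoly_cmult: "p \<in> hpoly m \<Longrightarrow> (\<lambda>x. c * p x) \<in> hpoly m"
  using span_scale[of p "monomials m" c] by (simp add: hpoly_def scaleR_fun_def)

lemma hpoly_zero: "(\<lambda>x. 0) \<in> hpoly m"
  using span_zero[of "monomials m"] by (simp add: hpoly_def zero_fun_def)

lemma hpoly_sum: "(\<And>i. i \<in> I \<Longrightarrow> p i \<in> hpoly m) \<Longrightarrow> (\<lambda>x. \<Sum>i\<in>I. p i x) \<in> hpoly m"
  by (induction I rule: infinite_finite_induct) (auto intro: hpoly_add hpoly_zero)

lemma hpoly_one: "(\<lambda>x. 1) \<in> hpoly 0"
  by (simp add: hpoly_def span_base)

lemma hpoly_const: "(\<lambda>x. c) \<in> hpoly 0"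
  using hpoly_cmult[OF hpoly_one, of c] by simp

lemma hpoly_coord_mult:
  assumes b: "b \<in> Basis" and p: "p \<in> hpoly m"
  shows "(\<lambda>x. (x \<bullet> b) * p x) \<in> hpoly (Suc m)"
  using p unfolding hpoly_def
proof (induction rule: span_induct_alt)
  case base
  then show ?case using hpoly_zero[of "Suc m"] by (simp add: hpoly_def)
next
  case (step c p q)
  have "(\<lambda>x. (x \<bullet> b) * p x) \<in> hpoly (Suc m)"
    unfolding hpoly_def by (rule span_base) (use b step in auto)
  then have "(\<lambda>x. c * ((x \<bullet> b) * p x) + (x \<bullet> b) * q x) \<in> hpoly (Suc m)"
    using step by (intro hpoly_add hpoly_cmult) (simp_all add: hpoly_def)
  then show ?case by (simp add: hpoly_def scaleR_fun_def algebra_simps)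
qed

lemma hpoly_induct [consumes 1, case_names one coord_mult add cmult]:
  assumes p: "p \<in> hpoly m"
    and one: "Q 0 (\<lambda>x. 1)"
    and mult: "\<And>m p b. p \<in> hpoly m \<Longrightarrow> Q m p \<Longrightarrow> b \<in> Basis \<Longrightarrow> Q (Suc m) (\<lambda>x. (x \<bullet> b) * p x)"
    and add: "\<And>m p q. p \<in> hpoly m \<Longrightarrow> q \<in> hpoly m \<Longrightarrow> Q m p \<Longrightarrow> Q m q \<Longrightarrow> Q m (\<lambda>x. p x + q x)"
    and cmult: "\<And>m p c. p \<in> hpoly m \<Longrightarrow> Q m p \<Longrightarrow> Q m (\<lambda>x. c * p x)"
  shows "Q m p"
proof -
  have mono: "\<forall>p\<in>monomials m. Q m p" for m
  proof (induction m)
    case (Suc m)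
    show ?case
    proof
      fix p :: "'a \<Rightarrow> real" assume "p \<in> monomials (Suc m)"
      then obtain b q where bq: "b \<in> Basis" "q \<in> monomials m" "p = (\<lambda>x. (x \<bullet> b) * q x)" by auto
      then have "q \<in> hpoly m" by (simp add: hpoly_def span_base)
      then show "Q (Suc m) p" using mult[of q m b] Suc bq by simp
    qed
  qed (simp add: one)
  obtain q :: "'a \<Rightarrow> real" where q: "q \<in> monomials m"
  proof -
    have "monomials m \<noteq> ({} :: ('a \<Rightarrow> real) set)" by (induction m) auto
    then show ?thesis using that by blast
  qed
  have zero: "Q m (\<lambda>x. 0)"
    using cmult[of q m 0] mono q span_base[of q "monomials m"] by (auto simp: hpoly_def)
  from p have "p \<in> span (monomials m)" by (simp add: hpoly_def)
  then have "p \<in> hpoly m \<and> Q m p"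
  proof (induction rule: span_induct_alt)
    case base
    then show ?case using zero hpoly_zero by (simp add: zero_fun_def)
  next
    case (step c p q)
    then have "p \<in> hpoly m" "Q m p" using mono span_base[of p "monomials m"] by (auto simp: hpoly_def)
    then have "(\<lambda>x. c * p x + q x) \<in> hpoly m \<and> Q m (\<lambda>x. c * p x + q x)"
      using step by (intro conjI add hpoly_add cmult hpoly_cmult) auto
    then show ?case by (simp add: scaleR_fun_def plus_fun_def)
  qed
  then show ?thesis ..
qed

lemma hpoly_inner_mult:
  assumes p: "p \<in> hpoly m"
  shows "(\<lambda>x. (x \<bullet> v) * p x) \<in> hpoly (Suc m)"
proof -
  have "(\<lambda>x. (x \<bullet> v) * p x) = (\<lambda>x. \<Sum>b\<in>Basis. (v \<bullet> b) * ((x \<bullet> b) * p x))"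
    by (simp add: fun_eq_iff euclidean_inner[of _ v] sum_distrib_right sum_distrib_left mult_ac)
  also have "\<dots> \<in> hpoly (Suc m)"
    by (intro hpoly_sum hpoly_cmult hpoly_coord_mult p)
  finally show ?thesis .
qed

lemma hpoly_norm_square_mult:
  assumes p: "p \<in> hpoly m"
  shows "(\<lambda>x. (x \<bullet> x) * p x) \<in> hpoly (Suc (Suc m))"
proof -
  have "(\<lambda>x. (x \<bullet> x) * p x) = (\<lambda>x. \<Sum>b\<in>Basis. (x \<bullet> b) * ((x \<bullet> b) * p x))"
    by (simp add: fun_eq_iff euclidean_inner[of x x for x] sum_distrib_right sum_distrib_left mult_ac)
  also have "\<dots> \<in> hpoly (Suc (Suc m))"
    by (intro hpoly_sum hpoly_coord_mult p)
  finally show ?thesis .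
qed

lemma hpoly_scale: "p \<in> hpoly m \<Longrightarrow> p (c *\<^sub>R x) = c ^ m * p x"
  by (induction arbitrary: x rule: hpoly_induct) (auto simp: algebra_simps)

lemma hpoly_minus: "p \<in> hpoly m \<Longrightarrow> p (- x) = (- 1) ^ m * p x"
  using hpoly_scale[of p m "- 1" x] by simp

lemma hpoly_compose_linear:
  assumes "p \<in> hpoly m" "linear (R :: 'a::euclidean_space \<Rightarrow> 'a)"
  shows "(\<lambda>x. p (R x)) \<in> hpoly m"
  using assms(1)
proof (induction rule: hpoly_induct)
  case (coord_mult m p b)
  have "R x \<bullet> b = x \<bullet> adjoint R b" for x
    using assms(2) by (simp add: adjoint_works)
  then show ?case using hpoly_inner_mult[OF coord_mult.IH] by simp
qed (simp_all add: hpoly_one hpoly_add hpoly_cmult)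

text \<open>The directional derivatives of a homogeneous polynomial are homogeneous of one degree less, and
differentiating along rays gives Euler's identity. In degree \<open>0\<close> the truncated degree \<open>m - 1\<close> carries no
information, so the vanishing of the derivative is stated separately.\<close>

lemma hpoly_derivative:
  assumes "p \<in> hpoly m"
  obtains D where "\<And>x. (p has_derivative D x) (at x)" "\<And>v. (\<lambda>x. D x v) \<in> hpoly (m - 1)"
    "\<And>x. D x x = real m * p x" "\<And>x v. m = 0 \<Longrightarrow> D x v = 0"
proof -
  have "\<exists>D. (\<forall>x. (p has_derivative D x) (at x)) \<and> (\<forall>v. (\<lambda>x. D x v) \<in> hpoly (m - 1)) \<and>
      (\<forall>x. D x x = real m * p x) \<and> (m = 0 \<longrightarrow> (\<forall>x v. D x v = 0))"
    using assms
  proof (induction rule: hpoly_induct)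
    case one
    show ?case by (rule exI[of _ "\<lambda>x v. 0"]) (simp add: hpoly_zero)
  next
    case (coord_mult m p b)
    then obtain D where D: "\<And>x. (p has_derivative D x) (at x)" "\<And>v. (\<lambda>x. D x v) \<in> hpoly (m - 1)"
      "\<And>x. D x x = real m * p x" "m = 0 \<Longrightarrow> \<forall>x v. D x v = 0" by blast
    show ?case
    proof (intro exI[of _ "\<lambda>x v. (x \<bullet> b) * D x v + (v \<bullet> b) * p x"] conjI allI)
      show "((\<lambda>x. (x \<bullet> b) * p x) has_derivative (\<lambda>v. (x \<bullet> b) * D x v + (v \<bullet> b) * p x)) (at x)" for x
        by (rule has_derivative_mult[OF _ D(1)]) (auto intro!: derivative_eq_intros)
      show "(\<lambda>x. (x \<bullet> b) * D x v + (v \<bullet> b) * p x) \<in> hpoly (Suc m - 1)" for v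
      proof (cases "m = 0")
        case True
        then show ?thesis using D(4) hpoly_cmult[OF coord_mult.hyps(1)] by simp
      next
        case False
        then have "(\<lambda>x. (x \<bullet> b) * D x v) \<in> hpoly m"
          using hpoly_coord_mult[OF coord_mult.hyps(2) D(2)[of v]] by simp
        from hpoly_add[OF this hpoly_cmult[OF coord_mult.hyps(1), of "v \<bullet> b"]] show ?thesis by simp
      qed
      show "(x \<bullet> b) * D x x + (x \<bullet> b) * p x = real (Suc m) * ((x \<bullet> b) * p x)" for x
        by (simp add: D(3) algebra_simps)
    qed simp
  next
    case (add m p q)
    then obtain D D' where D: "\<And>x. (p has_derivative D x) (at x)" "\<And>v. (\<lambda>x. D x v) \<in> hpoly (m - 1)"
      "\<And>x. D x x = real m * p x" "m = 0 \<Longrightarrow> \<forall>x v. D x v = 0"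
      and D': "\<And>x. (q has_derivative D' x) (at x)" "\<And>v. (\<lambda>x. D' x v) \<in> hpoly (m - 1)"
      "\<And>x. D' x x = real m * q x" "m = 0 \<Longrightarrow> \<forall>x v. D' x v = 0" by blast
    show ?case
      by (intro exI[of _ "\<lambda>x v. D x v + D' x v"] conjI allI has_derivative_add D(1) D'(1)
          hpoly_add D(2) D'(2)) (use D(3,4) D'(3,4) in \<open>auto simp: algebra_simps\<close>)
  next
    case (cmult m p c)
    then obtain D where D: "\<And>x. (p has_derivative D x) (at x)" "\<And>v. (\<lambda>x. D x v) \<in> hpoly (m - 1)"
      "\<And>x. D x x = real m * p x" "m = 0 \<Longrightarrow> \<forall>x v. D x v = 0" by blast
    show ?case
      by (intro exI[of _ "\<lambda>x v. c * D x v"] conjI allI has_derivative_mult_right D(1)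
          hpoly_cmult D(2)) (use D(3,4) in auto)
  qed
  then obtain D where D: "(\<forall>x. (p has_derivative D x) (at x)) \<and> (\<forall>v. (\<lambda>x. D x v) \<in> hpoly (m - 1)) \<and>
      (\<forall>x. D x x = real m * p x) \<and> (m = 0 \<longrightarrow> (\<forall>x v. D x v = 0))" ..
  show ?thesis by (rule that[of D]) (use D in blast)+
qed

text \<open>By Euler's identity a polynomial of positive degree is determined by its derivatives, which also
vanish on \<open>A\<close>.\<close>

lemma hpoly_zero_on_open:
  assumes "p \<in> hpoly m" "open A" "A \<noteq> {}" "\<And>x. x \<in> A \<Longrightarrow> p x = 0"
  shows "p = (\<lambda>x. 0)"
  using assms
proof (induction m arbitrary: p)
  case 0
  obtain D where D: "\<And>x. (p has_derivative D x) (at x)" "\<And>x v. D x v = 0"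
    using hpoly_derivative[OF 0(1)] by metis
  have "D x = (\<lambda>v. 0)" for x using D(2) by (simp add: fun_eq_iff)
  then have "(p has_derivative (\<lambda>v. 0)) (at x)" for x using D(1)[of x] by simp
  then obtain c where "\<And>x. p x = c"
    using has_derivative_zero_constant[of UNIV p] by auto
  then show ?case using 0 by auto
next
  case (Suc m)
  obtain D where D: "\<And>x. (p has_derivative D x) (at x)" "\<And>v. (\<lambda>x. D x v) \<in> hpoly (Suc m - 1)"
    "\<And>x. D x x = real (Suc m) * p x"
    by (rule hpoly_derivative[OF Suc.prems(1)]) (rule that)
  have "(\<lambda>x. D x v) = (\<lambda>x. 0)" for v
  proof (rule Suc.IH[OF D(2)[unfolded diff_Suc_1] Suc.prems(2,3)])
    fix x assume x: "x \<in> A"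
    have "(p has_derivative (\<lambda>v. 0)) (at x)"
      by (rule has_derivative_transform_within_open[OF has_derivative_const[of 0] Suc.prems(2) x])
         (simp add: Suc.prems(4))
    from has_derivative_unique[OF this D(1)] show "D x v = 0" by metis
  qed
  then have "D x x = 0" for x by metis
  then show ?case using D(3) by (simp add: fun_eq_iff)
qed

lemma polynomial_is_sum_of_homogeneous:
  assumes "real_polynomial_function (q :: 'a::euclidean_space \<Rightarrow> real)"
  shows "\<exists>n. q \<in> span (\<Union>j\<le>n. hpoly j)"
proof -
  define V where "V n = span (\<Union>j\<le>n. hpoly j :: ('a \<Rightarrow> real) set)" for n
  have mono: "V n \<subseteq> V n'" if "n \<le> n'" for n n'
    unfolding V_def using that by (intro span_mono UN_mono) auto
  have base: "p \<in> V n" if "p \<in> hpoly j" "j \<le> n" for p j n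
    unfolding V_def using that by (intro span_base) auto
  have hh: "(\<lambda>x. p x * q x) \<in> hpoly (i + j)" if "p \<in> hpoly i" "q \<in> hpoly j" for p q :: "'a \<Rightarrow> real" and i j
    using that(1)
  proof (induction rule: hpoly_induct)
    case (coord_mult m p b)
    then show ?case using hpoly_coord_mult[of b "\<lambda>x. p x * q x" "m + j"] by (simp add: mult.assoc)
  next
    case (add m p p')
    then show ?case using hpoly_add[of "\<lambda>x. p x * q x" "m + j" "\<lambda>x. p' x * q x"] by (simp add: algebra_simps)
  next
    case (cmult m p c)
    then show ?case using hpoly_cmult[of "\<lambda>x. p x * q x" "m + j" c] by (simp add: mult.assoc)
  qed (simp add: that)
  have h_mult: "(\<lambda>x. p x * q x) \<in> V (n + j)" if "q \<in> V n" and p: "p \<in> hpoly j" for p q n j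
    using that(1) unfolding V_def
  proof (induction rule: span_induct_alt)
    case base
    show ?case using span_zero[of "\<Union>j\<le>n + j. hpoly j"] by (simp add: zero_fun_def)
  next
    case (step c q r)
    obtain i where i: "i \<le> n" "q \<in> hpoly i" using step(1) by auto
    have "(\<lambda>x. p x * q x) \<in> V (n + j)" by (rule base[OF hh[OF p i(2)]]) (use i in simp)
    then have "c *\<^sub>R (\<lambda>x. p x * q x) + (\<lambda>x. p x * r x) \<in> V (n + j)"
      using step(2) unfolding V_def by (intro span_add span_scale)
    then show ?case by (simp add: V_def scaleR_fun_def plus_fun_def algebra_simps)
  qed
  have mult: "(\<lambda>x. p x * q x) \<in> V (n + n')" if "p \<in> V n'" and q: "q \<in> V n" for p q n n'
    using that(1) unfolding V_def
  proof (induction rule: span_induct_alt)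
    case base
    show ?case using span_zero[of "\<Union>j\<le>n + n'. hpoly j"] by (simp add: zero_fun_def)
  next
    case (step c p r)
    obtain i where i: "i \<le> n'" "p \<in> hpoly i" using step(1) by auto
    have "(\<lambda>x. p x * q x) \<in> V (n + n')"
      using h_mult[OF q i(2)] mono[of "n + i" "n + n'"] i by auto
    then have "c *\<^sub>R (\<lambda>x. p x * q x) + (\<lambda>x. r x * q x) \<in> V (n + n')"
      using step(2) unfolding V_def by (intro span_add span_scale)
    then show ?case by (simp add: V_def scaleR_fun_def plus_fun_def algebra_simps)
  qed
  have "\<exists>n. q \<in> V n"
    using assms
  proof (induction rule: real_polynomial_function.induct)
    case (linear f)
    then have lin: "linear f" by (rule bounded_linear.linear)
    have "f x = (\<Sum>b\<in>Basis. f b * ((x \<bullet> b) * 1))" for x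
      using linear_eq_sum_Basis[OF lin, of x] by (simp add: mult.commute)
    then have "f = (\<lambda>x. \<Sum>b\<in>Basis. f b * ((x \<bullet> b) * 1))" by (rule ext)
    also have "\<dots> \<in> hpoly (Suc 0)"
      by (intro hpoly_sum hpoly_cmult hpoly_coord_mult hpoly_one)
    finally have "f \<in> hpoly (Suc 0)" .
    then show ?case using base by blast
  next
    case (const c)
    then show ?case using base[OF hpoly_const] by blast
  next
    case (add f g)
    then obtain n n' where "f \<in> V n" "g \<in> V n'" by blast
    then have "f \<in> V (max n n')" "g \<in> V (max n n')" using mono[of n "max n n'"] mono[of n' "max n n'"] by auto
    then have "f + g \<in> V (max n n')" unfolding V_def by (rule span_add)
    then show ?case by (auto simp: plus_fun_def)
  next
    case (mult f g)
    then show ?case using \<open>\<And>p q n n'. p \<in> V n' \<Longrightarrow> q \<in> V n \<Longrightarrow> (\<lambda>x. p x * q x) \<in> V (n + n')\<close> by blast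
  qed
  then show ?thesis by (simp add: V_def)
qed

section \<open>Smooth functions on the sphere and polynomials\<close>

definition on_sphere :: "('a::euclidean_space \<Rightarrow> real) \<Rightarrow> 'a \<Rightarrow> real"
  where "on_sphere p x = (if norm x = 1 then p x else 0)"

lemma on_sphere_on [simp]: "norm x = 1 \<Longrightarrow> on_sphere p x = p x"
  by (simp add: on_sphere_def)

lemma on_sphere_off [simp]: "norm x \<noteq> 1 \<Longrightarrow> on_sphere p x = 0"
  by (simp add: on_sphere_def)

lemma smooth_on_lincomb:
  "smooth_on U f \<Longrightarrow> smooth_on U g \<Longrightarrow> smooth_on U (\<lambda>x. c * f x + d * g x)"
proof (coinduction arbitrary: f g)
  case smooth_on
  obtain D where D: "\<And>x. x \<in> U \<Longrightarrow> (f has_derivative D x) (at x)" "\<And>v. smooth_on U (\<lambda>x. D x v)"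
    using smooth_onE[OF smooth_on(1)] by blast
  obtain D' where D': "\<And>x. x \<in> U \<Longrightarrow> (g has_derivative D' x) (at x)" "\<And>v. smooth_on U (\<lambda>x. D' x v)"
    using smooth_onE[OF smooth_on(2)] by blast
  show ?case
    by (intro exI[of _ "\<lambda>x. c * f x + d * g x"] exI[of _ "\<lambda>x v. c * D x v + d * D' x v"] conjI allI impI
        has_derivative_add has_derivative_mult_right D(1) D'(1) refl)
       (assumption, assumption, rule disjI1, intro exI conjI, rule refl, rule D(2), rule D'(2))
qed

lemma sphere_smooth_lincomb:
  assumes "sphere_smooth f" "sphere_smooth g"
  shows "sphere_smooth (\<lambda>x. c * f x + d * g x)"
  using smooth_on_lincomb[of "- {0}" "radial_extension f" "radial_extension g" c d] assms
  by (simp add: sphere_smooth_def radial_extension_def[abs_def])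

lemma has_derivative_inverse_norm_power:
  fixes x :: "'a::euclidean_space"
  assumes "x \<noteq> 0"
  shows "((\<lambda>x. inverse (norm x) ^ k) has_derivative
      (\<lambda>w. - (real k * (x \<bullet> w) * inverse (norm x) ^ (k + 2)))) (at x)"
proof (induction k)
  case (Suc k)
  have n: "(norm has_derivative (\<lambda>h. h \<bullet> (x /\<^sub>R norm x))) (at x)"
    using has_derivative_norm[OF assms] by (simp add: sgn_div_norm)
  have i: "((\<lambda>x. inverse (norm x)) has_derivative (\<lambda>w. - ((x \<bullet> w) * inverse (norm x) ^ 3))) (at x)"
    by (rule has_derivative_eq_rhs[OF Deriv.has_derivative_inverse[OF _ n]])
       (use assms in \<open>auto simp: fun_eq_iff power3_eq_cube inner_commute field_simps\<close>)
  show ?case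
    unfolding power_Suc
    by (rule has_derivative_eq_rhs[OF has_derivative_mult[OF i Suc.IH]])
       (auto simp: fun_eq_iff algebra_simps power3_eq_cube)
qed simp

text \<open>The functions \<open>p / \<bar>x\<bar>\<^sup>k\<close> with homogeneous \<open>p\<close> form a class that is closed under directional
derivatives, which is what coinduction asks for. The radial extension of a restricted polynomial of
degree \<open>m\<close> is the case \<open>k = m\<close>.\<close>

lemma smooth_on_hpoly_div_norm_power:
  assumes "p \<in> hpoly m" "\<And>x. x \<noteq> 0 \<Longrightarrow> F x = p x * inverse (norm x) ^ k"
  shows "smooth_on (- {0}) F"
  using assms
proof (coinduction arbitrary: F p m k)
  case smooth_on
  note p = smooth_on(1) and F = smooth_on(2)
  obtain D where D: "\<And>x. (p has_derivative D x) (at x)" "\<And>v. (\<lambda>x. D x v) \<in> hpoly (m - 1)"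
    "\<And>x v. m = 0 \<Longrightarrow> D x v = 0"
    by (rule hpoly_derivative[OF p]) (rule that)
  define p' where "p' v x = (x \<bullet> x) * D x v + (- real k) * ((x \<bullet> v) * p x)" for v x
  have p': "p' v \<in> hpoly (Suc m)" for v
  proof -
    have "(\<lambda>x. (x \<bullet> x) * D x v) \<in> hpoly (Suc m)"
    proof (cases "m = 0")
      case True
      then show ?thesis using D(3) hpoly_zero by simp
    next
      case False
      then show ?thesis using hpoly_norm_square_mult[OF D(2)[of v]] by simp
    qed
    then show ?thesis unfolding p'_def by (intro hpoly_add hpoly_cmult hpoly_inner_mult p)
  qed
  define DF where "DF x v = p' v x * inverse (norm x) ^ (k + 2)" for x v
  have "(F has_derivative DF x) (at x)" if x: "x \<in> - {0}" for x
  proof -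
    have x0: "x \<noteq> 0" using x by simp
    have "((\<lambda>x. p x * inverse (norm x) ^ k) has_derivative DF x) (at x)"
    proof (rule has_derivative_eq_rhs[OF has_derivative_mult[OF D(1) has_derivative_inverse_norm_power[OF x0]]])
      have "(x \<bullet> x) * inverse (norm x) ^ (k + 2) = inverse (norm x) ^ k"
      proof -
        have "(x \<bullet> x) * inverse (norm x) ^ (k + 2)
            = inverse (norm x) ^ k * ((norm x * inverse (norm x)) * (norm x * inverse (norm x)))"
          unfolding dot_square_norm power_add power2_eq_square by (simp only: mult_ac)
        then show ?thesis using x0 by simp
      qed
      then show "(\<lambda>h. p x * - (real k * (x \<bullet> h) * inverse (norm x) ^ (k + 2)) + D x h * inverse (norm x) ^ k)
          = DF x"
        by (auto simp: fun_eq_iff DF_def p'_def algebra_simps)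
    qed
    then show ?thesis
      by (rule has_derivative_transform_within_open[of _ _ _ _ "- {0}"]) (use x F in \<open>auto simp: open_Compl\<close>)
  qed
  then show ?case
    by (intro exI[of _ F] exI[of _ DF] conjI allI impI refl)
       (simp, rule disjI1, intro exI conjI, rule refl, rule p', unfold DF_def, intro allI impI, rule refl)
qed

lemma sphere_smooth_restrict_hpoly:
  assumes p: "p \<in> hpoly m"
  shows "sphere_smooth (on_sphere p)"
  unfolding sphere_smooth_def
  by (rule smooth_on_hpoly_div_norm_power[OF p, of _ m])
     (simp add: radial_extension_def hpoly_scale[OF p] power_inverse mult.commute)

text \<open>Here \<open>q\<close> is the Laplacian of \<open>p\<close> in the ambient space. Along a rotation the restriction of \<open>p\<close> agrees with
\<open>p\<close> itself, so its second derivatives there can be computed from those of \<open>p\<close>; Euler's identity turns the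
radial terms into multiples of \<open>p\<close>.\<close>

lemma sphere_laplacian_restrict_hpoly:
  fixes p :: "'a::euclidean_space \<Rightarrow> real"
  assumes p: "p \<in> hpoly m"
  obtains q where "2 \<le> m \<Longrightarrow> q \<in> hpoly (m - 2)" "m < 2 \<Longrightarrow> q = (\<lambda>x. 0)"
    "\<And>x. norm x = 1 \<Longrightarrow> sphere_laplacian (on_sphere p) x
        = q x - real m * (real m + real DIM('a) - 2) * p x"
proof -
  obtain D where D: "\<And>x. (p has_derivative D x) (at x)" "\<And>v. (\<lambda>x. D x v) \<in> hpoly (m - 1)"
    "\<And>x. D x x = real m * p x" "\<And>x v. m = 0 \<Longrightarrow> D x v = 0"
    by (rule hpoly_derivative[OF p]) (rule that)
  have "\<forall>v. \<exists>E. (\<forall>x. ((\<lambda>x. D x v) has_derivative E x) (at x)) \<and> (\<forall>w. (\<lambda>x. E x w) \<in> hpoly (m - 1 - 1)) \<and>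
      (\<forall>x. E x x = real (m - 1) * D x v) \<and> (m - 1 = 0 \<longrightarrow> (\<forall>x w. E x w = 0))"
  proof
    fix v
    show "\<exists>E. (\<forall>x. ((\<lambda>x. D x v) has_derivative E x) (at x)) \<and> (\<forall>w. (\<lambda>x. E x w) \<in> hpoly (m - 1 - 1)) \<and>
      (\<forall>x. E x x = real (m - 1) * D x v) \<and> (m - 1 = 0 \<longrightarrow> (\<forall>x w. E x w = 0))"
      by (rule hpoly_derivative[OF D(2)[of v]]) blast
  qed
  then obtain E' where E': "\<And>v x. ((\<lambda>x. D x v) has_derivative E' v x) (at x)"
    "\<And>v w. (\<lambda>x. E' v x w) \<in> hpoly (m - 1 - 1)" "\<And>v x. E' v x x = real (m - 1) * D x v"
    "\<And>v x w. m - 1 = 0 \<Longrightarrow> E' v x w = 0" by metis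
  define E where "E x v = E' v x" for x v
  have E: "((\<lambda>x. D x v) has_derivative E x v) (at x)" for x v by (simp add: E_def E')
  have linD: "linear (D x)" and linE2: "linear (E x v)" for x v
    using D(1) E has_derivative_linear by blast+
  have linE: "linear (\<lambda>v. E x v w)" for x w
    by (rule linear_second_derivative[OF open_UNIV _ _ E]) (auto simp: linD)
  define q where "q x = (\<Sum>b\<in>Basis. E x b b)" for x
  have q1: "q \<in> hpoly (m - 2)" if "2 \<le> m"
    unfolding q_def E_def using hpoly_sum[of Basis "\<lambda>b x. E' b x b" "m - 2"] E'(2) that
    by (simp add: numeral_2_eq_2)
  have q2: "q = (\<lambda>x. 0)" if "m < 2"
    unfolding q_def E_def using E'(4) that by simp
  have q3: "sphere_laplacian (on_sphere p) x
        = q x - real m * (real m + real DIM('a) - 2) * p x" if x: "norm x = 1" for x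
  proof -
    obtain G H where GH: "\<And>a b x t. a \<in> Basis \<Longrightarrow> b \<in> Basis \<Longrightarrow> norm x = 1 \<Longrightarrow>
        ((\<lambda>t. on_sphere p (rot a b t x)) has_real_derivative G a b (rot a b t x)) (at t)"
      "\<And>a b x t. a \<in> Basis \<Longrightarrow> b \<in> Basis \<Longrightarrow> norm x = 1 \<Longrightarrow>
        ((\<lambda>t. G a b (rot a b t x)) has_real_derivative H a b (rot a b t x)) (at t)"
      "\<And>x. norm x = 1 \<Longrightarrow> (\<Sum>a\<in>Basis. \<Sum>b\<in>Basis. H a b x) = 2 * sphere_laplacian (on_sphere p) x"
      by (rule sphere_smooth_rot[OF sphere_smooth_restrict_hpoly[OF p]]) (rule that)
    have x0: "x \<noteq> 0" using x by auto
    have H: "H a b x = D x (plane_gen a b (plane_gen a b x)) + E x (plane_gen a b x) (plane_gen a b x)"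
      if ab: "a \<in> Basis" "b \<in> Basis" for a b
    proof -
      note d = second_derivative_along_rot[OF D(1) E linE ab x0]
      have "G a b (rot a b t x) = D (rot a b t x) (plane_gen a b (rot a b t x))" for t
        using DERIV_unique[OF GH(1)[OF ab x, of t]] d(1)[of t] ab x by simp
      then show ?thesis
        using DERIV_unique[OF GH(2)[OF ab x, of 0]] d(2)[of 0] by simp
    qed
    have "2 * sphere_laplacian (on_sphere p) x = (\<Sum>a\<in>Basis. \<Sum>b\<in>Basis. H a b x)"
      using GH(3)[OF x] by simp
    also have "\<dots> = (\<Sum>a\<in>Basis. \<Sum>b\<in>Basis. D x (plane_gen a b (plane_gen a b x)) + E x (plane_gen a b x) (plane_gen a b x))"
      by (intro sum.cong refl H)
    also have "\<dots> = 2 * ((x \<bullet> x) * q x - E x x x) - 2 * (real DIM('a) - 1) * D x x"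
      unfolding q_def by (rule sum_plane_gen_second_order[OF linD linE linE2])
    also have "E x x x = real (m - 1) * (real m * p x)" by (simp add: E_def E'(3) D(3))
    also have "real (m - 1) * (real m * p x) = (real m - 1) * (real m * p x)" by (cases m) auto
    finally show ?thesis
      using x by (simp add: D(3) dot_square_norm) (simp add: algebra_simps)
  qed
  show ?thesis by (rule that[OF q1 q2 q3])
qed

section \<open>Spherical harmonics\<close>

abbreviation spoly :: "nat \<Rightarrow> ('a::euclidean_space \<Rightarrow> real) set"
  where "spoly m \<equiv> on_sphere ` hpoly m"

text \<open>The common eigenvalue of the restrictions of harmonic homogeneous polynomials of degree \<open>m\<close>.\<close>

definition eigval :: "'a::euclidean_space itself \<Rightarrow> nat \<Rightarrow> real"
  where "eigval _ m = real m * (real m + real DIM('a) - 2)"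

lemma eigval_strict_mono:
  assumes "DIM('a::euclidean_space) \<ge> 2"
  shows "strict_mono (eigval TYPE('a))"
proof (rule strict_monoI_Suc)
  fix m
  have "real m * (real m + real DIM('a) - 2) < real (Suc m) * (real (Suc m) + real DIM('a) - 2)"
  proof -
    have "real (Suc m) * (real (Suc m) + real DIM('a) - 2)
        = real m * (real m + real DIM('a) - 2) + 2 * real m + real DIM('a) - 1"
      by (simp add: algebra_simps)
    moreover have "real DIM('a) \<ge> 2" using assms by linarith
    ultimately show ?thesis using of_nat_0_le_iff[of m] by linarith
  qed
  then show "eigval TYPE('a) m < eigval TYPE('a) (Suc m)"
    by (simp add: eigval_def)
qed

lemma sphere_laplacian_lincomb:
  fixes f g :: "'a::euclidean_space \<Rightarrow> real"
  assumes f: "sphere_smooth f" and g: "sphere_smooth g" and x: "norm x = 1"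
  shows "sphere_laplacian (\<lambda>x. c * f x + d * g x) x = c * sphere_laplacian f x + d * sphere_laplacian g x"
proof -
  define h where "h = (\<lambda>x. c * f x + d * g x)"
  have "sphere_smooth h" unfolding h_def by (rule sphere_smooth_lincomb[OF f g])
  note lim = sphere_laplacian_pointwise_limit[OF this x]
  have "second_diff h a b t x / t\<^sup>2
      = c * (second_diff f a b t x / t\<^sup>2) + d * (second_diff g a b t x / t\<^sup>2)" for a b t
    unfolding second_diff_def h_def by (simp add: algebra_simps add_divide_distrib diff_divide_distrib)
  then have "(\<lambda>k. \<Sum>a\<in>Basis. \<Sum>b\<in>Basis. second_diff h a b (step k) x / (step k)\<^sup>2)
      = (\<lambda>k. c * (\<Sum>a\<in>Basis. \<Sum>b\<in>Basis. second_diff f a b (step k) x / (step k)\<^sup>2)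
           + d * (\<Sum>a\<in>Basis. \<Sum>b\<in>Basis. second_diff g a b (step k) x / (step k)\<^sup>2))"
    by (simp add: sum.distrib sum_distrib_left)
  also have "\<dots> \<longlonglongrightarrow> c * (2 * sphere_laplacian f x) + d * (2 * sphere_laplacian g x)"
    by (intro tendsto_intros sphere_laplacian_pointwise_limit f g x)
  finally have "2 * sphere_laplacian h x = c * (2 * sphere_laplacian f x) + d * (2 * sphere_laplacian g x)"
    by (rule LIMSEQ_unique[OF lim])
  then show ?thesis by (simp add: h_def)
qed

lemma eigenspaceD:
  assumes "f \<in> eigenspace \<mu>"
  shows "norm x \<noteq> 1 \<Longrightarrow> f x = 0" "sphere_smooth f" "norm x = 1 \<Longrightarrow> sphere_laplacian f x = - \<mu> * f x"
    "cont_sph f"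
proof -
  show "sphere_laplacian f x = - \<mu> * f x" if "norm x = 1"
  proof -
    have "- sphere_laplacian f x = \<mu> * f x" using assms that by (simp add: eigenspace_def)
    then show ?thesis by simp
  qed
qed (use assms sphere_smooth_continuous_on[of f] in \<open>auto simp: eigenspace_def\<close>)

lemma eigenspaceI:
  assumes "\<And>x. norm x \<noteq> 1 \<Longrightarrow> f x = 0" "sphere_smooth f"
    "\<And>x. norm x = 1 \<Longrightarrow> sphere_laplacian f x = - \<mu> * f x"
  shows "f \<in> eigenspace \<mu>"
  using assms by (auto simp: eigenspace_def)

lemma eigenspace_lincomb:
  assumes f: "f \<in> eigenspace \<mu>" and g: "g \<in> eigenspace \<mu>"
  shows "(\<lambda>x. c * f x + d * g x) \<in> eigenspace \<mu>"
  by (rule eigenspaceI)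
     (simp_all add: eigenspaceD[OF f] eigenspaceD[OF g] sphere_smooth_lincomb sphere_laplacian_lincomb algebra_simps)

lemma zero_in_eigenspace: "(\<lambda>x::'a::euclidean_space. 0) \<in> eigenspace \<mu>"
proof (rule eigenspaceI)
  have "on_sphere (\<lambda>x::'a. 0) = (\<lambda>x. 0)" by (simp add: fun_eq_iff on_sphere_def)
  then show s: "sphere_smooth (\<lambda>x::'a. 0 :: real)"
    using sphere_smooth_restrict_hpoly[OF hpoly_zero[of 0], where 'a='a] by simp
  show "sphere_laplacian (\<lambda>x. 0) x = - \<mu> * 0" if "norm x = 1" for x :: 'a
    using sphere_laplacian_lincomb[OF s s that, of 0 0] by simp
qed simp

lemma subspace_eigenspace: "subspace (eigenspace \<mu>)"
proof (rule subspaceI)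
  show "0 \<in> eigenspace \<mu>" using zero_in_eigenspace by (simp add: zero_fun_def)
  show "f + g \<in> eigenspace \<mu>" if "f \<in> eigenspace \<mu>" "g \<in> eigenspace \<mu>" for f g
    using eigenspace_lincomb[OF that, of 1 1] by (simp add: plus_fun_def)
  show "c *\<^sub>R f \<in> eigenspace \<mu>" if "f \<in> eigenspace \<mu>" for c f
    using eigenspace_lincomb[OF that that, of c 0] by (simp add: scaleR_fun_def)
qed

lemma subspace_restrict_hpoly:
  "subspace (spoly m :: ('a::euclidean_space \<Rightarrow> real) set)"
proof (rule subspaceI)
  show "0 \<in> spoly m"
    by (rule image_eqI[OF _ hpoly_zero]) (simp add: fun_eq_iff on_sphere_def)
  show "f + g \<in> spoly m" if "f \<in> spoly m" "g \<in> spoly m" for f g :: "'a \<Rightarrow> real"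
  proof -
    obtain p q where pq: "p \<in> hpoly m" "q \<in> hpoly m" "f = on_sphere p" "g = on_sphere q"
      using \<open>f \<in> _\<close> \<open>g \<in> _\<close> by auto
    show ?thesis
      by (rule image_eqI[OF _ hpoly_add[OF pq(1,2)]]) (simp add: fun_eq_iff on_sphere_def pq)
  qed
  show "c *\<^sub>R f \<in> spoly m" if fr: "f \<in> spoly m" for c and f :: "'a \<Rightarrow> real"
  proof -
    obtain p where p: "p \<in> hpoly m" "f = on_sphere p"
      using fr by auto
    show ?thesis
      by (rule image_eqI[OF _ hpoly_cmult[OF p(1), of c]]) (simp add: fun_eq_iff on_sphere_def p scaleR_fun_def)
  qed
qed

text \<open>The spherical harmonics of degree \<open>m\<close>. They are defined as the polynomial eigenfunctions; that they
exhaust the eigenspace is \<open>eigenspace_eq_harmonics\<close>.\<close>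

definition harmonics :: "nat \<Rightarrow> ('a::euclidean_space \<Rightarrow> real) set"
  where "harmonics m = eigenspace (eigval TYPE('a) m) \<inter> spoly m"

lemma subspace_harmonics: "subspace (harmonics m)"
  unfolding harmonics_def by (intro subspace_inter subspace_eigenspace subspace_restrict_hpoly)

lemma harmonics_continuous: "f \<in> harmonics m \<Longrightarrow> cont_sph f"
  by (auto simp: harmonics_def eigenspaceD)

text \<open>Multiplication by \<open>\<bar>x\<bar>\<^sup>2\<close> raises the degree by two and does not change the values on the sphere.\<close>

lemma restrict_hpoly_mono_parity:
  assumes "j \<le> m" "even (m - j)"
  shows "spoly j \<subseteq> (spoly m :: ('a::euclidean_space \<Rightarrow> real) set)"
proof -
  obtain k where k: "m = j + 2 * k" using assms by (metis dvd_def le_add_diff_inverse)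
  have "spoly j \<subseteq> (spoly (j + 2 * k) :: ('a \<Rightarrow> real) set)"
  proof (induction k)
    case (Suc k)
    have "spoly (j + 2 * k) \<subseteq> (spoly (j + 2 * Suc k) :: ('a \<Rightarrow> real) set)"
    proof
      fix f :: "'a \<Rightarrow> real" assume "f \<in> spoly (j + 2 * k)"
      then obtain p where p: "p \<in> hpoly (j + 2 * k)" "f = on_sphere p" by auto
      show "f \<in> spoly (j + 2 * Suc k)"
      proof (rule image_eqI)
        show "(\<lambda>x. (x \<bullet> x) * p x) \<in> hpoly (j + 2 * Suc k)"
          using hpoly_norm_square_mult[OF p(1)] by simp
        show "f = on_sphere (\<lambda>x. (x \<bullet> x) * p x)"
          by (simp add: fun_eq_iff on_sphere_def p dot_square_norm)
      qed
    qed
    with Suc show ?case by blast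
  qed simp
  then show ?thesis by (simp add: k)
qed

lemma sphere_smooth_sum:
  fixes e :: "'i \<Rightarrow> 'a::euclidean_space \<Rightarrow> real"
  assumes "finite I" "\<And>i. i \<in> I \<Longrightarrow> sphere_smooth (e i)"
  shows "sphere_smooth (\<lambda>x. \<Sum>i\<in>I. c i * e i x) \<and>
    (\<forall>x. norm x = 1 \<longrightarrow> sphere_laplacian (\<lambda>x. \<Sum>i\<in>I. c i * e i x) x = (\<Sum>i\<in>I. c i * sphere_laplacian (e i) x))"
  using assms
proof (induction I rule: finite_induct)
  case empty
  show ?case using eigenspaceD(2,3)[OF zero_in_eigenspace[of 0], where 'a='a] by simp
next
  case (insert i I)
  then have IH: "sphere_smooth (\<lambda>x. \<Sum>i\<in>I. c i * e i x)"
    "\<And>x. norm x = 1 \<Longrightarrow> sphere_laplacian (\<lambda>x. \<Sum>i\<in>I. c i * e i x) x = (\<Sum>i\<in>I. c i * sphere_laplacian (e i) x)"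
    by auto
  have ei: "sphere_smooth (e i)" using insert by simp
  show ?case
    using insert(1,2) sphere_smooth_lincomb[OF ei IH(1), of "c i" 1]
      sphere_laplacian_lincomb[OF ei IH(1), of _ "c i" 1] IH(2) by simp
qed

lemma restrict_hpoly_low_degree:
  fixes p :: "'a::euclidean_space \<Rightarrow> real"
  assumes p: "p \<in> hpoly m" and "m < 2"
  shows "on_sphere p \<in> harmonics m"
proof -
  obtain q where "m < 2 \<Longrightarrow> q = (\<lambda>x. 0)"
    and lap: "\<And>x. norm x = 1 \<Longrightarrow> sphere_laplacian (on_sphere p) x
        = q x - real m * (real m + real DIM('a) - 2) * p x"
    by (rule sphere_laplacian_restrict_hpoly[OF p]) (rule that)
  then show ?thesis
    unfolding harmonics_def using \<open>m < 2\<close>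
    by (intro IntI eigenspaceI imageI p sphere_smooth_restrict_hpoly[OF p]) (auto simp: eigval_def)
qed

text \<open>On the sphere \<open>- \<Delta> - \<mu>\<^sub>m\<close> maps a polynomial of degree \<open>m\<close> to one of degree \<open>m - 2\<close>, which by induction is
a sum of eigenfunctions with eigenvalues other than \<open>\<mu>\<^sub>m\<close>. On these \<open>- \<Delta> - \<mu>\<^sub>m\<close> can be inverted, and subtracting
the result leaves an eigenfunction for \<open>\<mu>\<^sub>m\<close>.\<close>

lemma restrict_hpoly_decomposition:
  fixes p :: "'a::euclidean_space \<Rightarrow> real"
  assumes d: "DIM('a) \<ge> 2" and p: "p \<in> hpoly m"
  shows "\<exists>e. (\<forall>j. e j \<in> harmonics j) \<and> (\<forall>j. odd (m + j) \<longrightarrow> e j = 0) \<and> on_sphere p = (\<lambda>x. \<Sum>j\<le>m. e j x)"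
  using p
proof (induction m arbitrary: p rule: less_induct)
  case (less m)
  let ?\<mu> = "eigval TYPE('a)"
  obtain q where q: "2 \<le> m \<Longrightarrow> q \<in> hpoly (m - 2)"
    and lap: "\<And>x. norm x = 1 \<Longrightarrow> sphere_laplacian (on_sphere p) x
        = q x - real m * (real m + real DIM('a) - 2) * p x"
    by (rule sphere_laplacian_restrict_hpoly[OF less.prems]) (rule that)
  have smooth: "sphere_smooth (on_sphere p)" by (rule sphere_smooth_restrict_hpoly[OF less.prems])
  have zero_in: "(0 :: 'a \<Rightarrow> real) \<in> harmonics j" for j :: nat by (rule subspace_0[OF subspace_harmonics])
  show ?case
  proof (cases "m < 2")
    case True
    with less.prems have "on_sphere p \<in> harmonics m" by (rule restrict_hpoly_low_degree)
    moreover define e where "e j = (if j = m then on_sphere p else 0)" for j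
    ultimately have "e j \<in> harmonics j" "odd (m + j) \<Longrightarrow> e j = 0" for j
      using zero_in by (auto simp: e_def)
    moreover have "(\<Sum>j\<le>m. e j x) = (\<Sum>j\<in>{m}. e j x)" for x
      by (rule sum.mono_neutral_right) (auto simp: e_def)
    then have "on_sphere p = (\<lambda>x. \<Sum>j\<le>m. e j x)" by (simp add: e_def)
    ultimately show ?thesis by blast
  next
    case False
    then have m2: "m - 2 < m" "2 \<le> m" by auto
    obtain e where e: "\<And>j. e j \<in> harmonics j" "\<And>j. odd (m - 2 + j) \<Longrightarrow> e j = 0"
      "on_sphere q = (\<lambda>x. \<Sum>j\<le>m-2. e j x)"
      using less.IH[OF m2(1) q[OF m2(2)]] by blast
    \<comment> \<open>inverse of \<open>- \<Delta> - \<mu>\<^sub>m\<close>, up to sign, on the harmonics of degree \<open>j\<close>\<close>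
    define a where "a j = 1 / (?\<mu> m - ?\<mu> j)" for j
    have \<mu>: "?\<mu> j < ?\<mu> m" if "j \<le> m - 2" for j
      using eigval_strict_mono[OF d] that m2 by (simp add: strict_mono_less)
    define s where "s = (\<lambda>x. \<Sum>j\<le>m-2. a j * e j x)"
    have sm: "sphere_smooth (e j)" for j using e(1)[of j] eigenspaceD(2) by (auto simp: harmonics_def)
    have s_smooth: "sphere_smooth s"
      and s_lap: "\<And>x. norm x = 1 \<Longrightarrow> sphere_laplacian s x = (\<Sum>j\<le>m-2. a j * sphere_laplacian (e j) x)"
      using sphere_smooth_sum[of "{..m-2}" e a] sm by (auto simp: s_def)
    have s_hpoly: "s \<in> spoly m"
    proof -
      have "a j *\<^sub>R e j \<in> spoly m" if "j \<le> m - 2" for j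
      proof (cases "odd (m - 2 + j)")
        case True
        then show ?thesis using e(2) subspace_0[OF subspace_restrict_hpoly[of m]] by simp
      next
        case False
        then have "even (m - j)" using that m2 by auto
        moreover have "j \<le> m" using that by simp
        moreover have "e j \<in> spoly j" using e(1)[of j] by (simp add: harmonics_def)
        ultimately have "e j \<in> spoly m"
          using subsetD[OF restrict_hpoly_mono_parity] by blast
        then show ?thesis by (rule subspace_scale[OF subspace_restrict_hpoly])
      qed
      then have "(\<Sum>j\<le>m-2. a j *\<^sub>R e j) \<in> spoly m"
        by (intro subspace_sum[OF subspace_restrict_hpoly]) auto
      moreover have "(\<Sum>j\<le>m-2. a j *\<^sub>R e j) = s"
        by (simp add: fun_eq_iff s_def scaleR_fun_def)
      ultimately show ?thesis by simp
    qed
    have s_off: "s x = 0" if x: "norm x \<noteq> 1" for x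
    proof -
      have "e j x = 0" for j
        using e(1)[of j] eigenspaceD(1)[OF _ x, of "e j"] by (auto simp: harmonics_def)
      then show ?thesis by (simp add: s_def)
    qed
    define p' where "p' = (\<lambda>x. on_sphere p x - s x)"
    have p'_eigen: "p' \<in> eigenspace (?\<mu> m)"
    proof (rule eigenspaceI)
      show "sphere_smooth p'"
        using sphere_smooth_lincomb[OF smooth s_smooth, of 1 "-1"] by (simp add: p'_def)
      show "p' x = 0" if "norm x \<noteq> 1" for x using that s_off by (simp add: p'_def)
      fix x :: 'a assume x: "norm x = 1"
      have "sphere_laplacian p' x = sphere_laplacian (on_sphere p) x - sphere_laplacian s x"
        using sphere_laplacian_lincomb[OF smooth s_smooth x, of 1 "-1"] by (simp add: p'_def)
      also have "sphere_laplacian (on_sphere p) x = (\<Sum>j\<le>m-2. e j x) - ?\<mu> m * p x"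
        using lap[OF x] fun_cong[OF e(3), of x] x by (simp add: eigval_def)
      also have "sphere_laplacian s x = (\<Sum>j\<le>m-2. a j * (- ?\<mu> j * e j x))"
      proof -
        have "sphere_laplacian (e j) x = - ?\<mu> j * e j x" for j
          using e(1)[of j] by (intro eigenspaceD(3)[OF _ x]) (simp add: harmonics_def)
        then show ?thesis using s_lap[OF x] by simp
      qed
      also have "(\<Sum>j\<le>m-2. e j x) - ?\<mu> m * p x - (\<Sum>j\<le>m-2. a j * (- ?\<mu> j * e j x))
          = (\<Sum>j\<le>m-2. e j x + a j * (?\<mu> j * e j x)) - ?\<mu> m * p x"
        by (simp add: sum.distrib sum_negf)
      also have "(\<Sum>j\<le>m-2. e j x + a j * (?\<mu> j * e j x)) = (\<Sum>j\<le>m-2. ?\<mu> m * (a j * e j x))"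
      proof (rule sum.cong[OF refl])
        fix j assume "j \<in> {..m-2}"
        then have "a j * (?\<mu> m - ?\<mu> j) = 1" using \<mu>[of j] by (simp add: a_def)
        then have "e j x = a j * (?\<mu> m - ?\<mu> j) * e j x" by simp
        then show "e j x + a j * (?\<mu> j * e j x) = ?\<mu> m * (a j * e j x)"
          by (simp add: algebra_simps)
      qed
      also have "\<dots> - ?\<mu> m * p x = - ?\<mu> m * p' x"
        using x by (simp add: p'_def s_def sum_distrib_left[symmetric] right_diff_distrib)
      finally show "sphere_laplacian p' x = - ?\<mu> m * p' x" .
    qed
    have "on_sphere p - s \<in> spoly m"
      by (intro subspace_diff[OF subspace_restrict_hpoly] imageI less.prems s_hpoly)
    moreover have "p' = on_sphere p - s" by (simp add: fun_eq_iff p'_def)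
    ultimately have p': "p' \<in> harmonics m" using p'_eigen by (simp add: harmonics_def)
    define e' where "e' j = (if j = m then p' else if j \<le> m - 2 then a j *\<^sub>R e j else 0)" for j
    have "e' j \<in> harmonics j" for j
      using p' subspace_scale[OF subspace_harmonics e(1)] zero_in by (simp add: e'_def)
    moreover have "e' j = 0" if "odd (m + j)" for j
      using that e(2)[of j] m2 by (auto simp: e'_def)
    moreover have "on_sphere p x = (\<Sum>j\<le>m. e' j x)" for x
    proof -
      have "(\<Sum>j\<le>m. e' j x) = e' m x + (\<Sum>j<m. e' j x)" 
        by (simp add: lessThan_Suc_atMost[symmetric])
      also have "(\<Sum>j<m. e' j x) = (\<Sum>j\<le>m-2. e' j x)"
        by (rule sum.mono_neutral_right) (use m2 in \<open>auto simp: e'_def\<close>)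
      also have "\<dots> = s x"
        unfolding s_def by (rule sum.cong) (use m2 in \<open>auto simp: e'_def scaleR_fun_def\<close>)
      finally show ?thesis by (simp add: e'_def p'_def)
    qed
    ultimately show ?thesis by (intro exI[of _ e']) auto
  qed
qed

section \<open>Orthogonality and completeness\<close>

text \<open>The inner product of \<open>L\<^sup>2\<close>.\<close>

definition sip :: "('a::euclidean_space \<Rightarrow> real) \<Rightarrow> ('a \<Rightarrow> real) \<Rightarrow> real"
  where "sip u v = sph_integral (\<lambda>x. u x * v x)"

lemma sip_commute: "sip u v = sip v u"
  by (simp add: sip_def mult.commute)

lemma continuous_on_fun_ops [continuous_intros]:
  fixes u v :: "'a::topological_space \<Rightarrow> real"
  assumes "continuous_on A u" "continuous_on A v"
  shows "continuous_on A (u + v)" "continuous_on A (u - v)"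
  using continuous_on_add[OF assms] continuous_on_diff[OF assms] by (simp_all add: plus_fun_def fun_diff_def)

lemma continuous_on_fun_scaleR [continuous_intros]:
  fixes u :: "'a::topological_space \<Rightarrow> real"
  assumes "continuous_on A u"
  shows "continuous_on A (c *\<^sub>R u)"
  using continuous_on_mult_left[OF assms, of c] by (simp add: scaleR_fun_def)

lemma continuous_on_fun_sum [continuous_intros]:
  fixes u :: "'i \<Rightarrow> 'a::topological_space \<Rightarrow> real"
  assumes "\<And>i. i \<in> I \<Longrightarrow> continuous_on A (u i)"
  shows "continuous_on A (\<Sum>i\<in>I. u i)"
  using continuous_on_sum[of I A u] assms by (simp add: sum_fun_apply[abs_def, symmetric])

lemma continuous_on_span:
  fixes B :: "('a::topological_space \<Rightarrow> real) set"
  assumes "\<And>b. b \<in> B \<Longrightarrow> continuous_on A b" "v \<in> span B"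
  shows "continuous_on A v"
proof -
  have "subspace {v :: 'a \<Rightarrow> real. continuous_on A v}"
    by (rule subspaceI) (auto intro!: continuous_intros simp: zero_fun_def)
  then have "span B \<subseteq> {v. continuous_on A v}" using assms(1) by (intro span_minimal) auto
  then show ?thesis using assms(2) by auto
qed

context
  fixes u v w :: "'a::euclidean_space \<Rightarrow> real"
  assumes u: "cont_sph u" and v: "cont_sph v"
    and w: "cont_sph w"
begin

lemma sip_add_left: "sip (u + v) w = sip u w + sip v w"
  using sph_integral_add[OF continuous_on_mult[OF u w] continuous_on_mult[OF v w]]
  by (simp add: sip_def algebra_simps)

lemma sip_diff_left: "sip (u - v) w = sip u w - sip v w"
  using sph_integral_diff[OF continuous_on_mult[OF u w] continuous_on_mult[OF v w]]
  by (simp add: sip_def algebra_simps)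

lemma sip_add_right: "sip w (u + v) = sip w u + sip w v"
  using sip_add_left by (simp add: sip_commute)

lemma sip_diff_right: "sip w (u - v) = sip w u - sip w v"
  using sip_diff_left by (simp add: sip_commute)

end

lemma sip_scale_left: "sip (c *\<^sub>R u) v = c * sip u v"
  by (simp add: sip_def scaleR_fun_def mult.assoc sph_integral_cmult)

lemma sip_scale_right: "sip v (c *\<^sub>R u) = c * sip v u"
  using sip_scale_left by (simp add: sip_commute)

lemma sip_sum_right:
  fixes u :: "'i \<Rightarrow> 'a::euclidean_space \<Rightarrow> real"
  assumes "cont_sph w" "\<And>i. i \<in> I \<Longrightarrow> cont_sph (u i)"
  shows "sip w (\<Sum>i\<in>I. u i) = (\<Sum>i\<in>I. sip w (u i))"
  using sph_integral_sum[of I "\<lambda>i x. w x * u i x"] assms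
  by (simp add: sip_def sum_distrib_left continuous_on_mult)

lemma sip_zero [simp]: "sip 0 u = 0" "sip u 0 = 0"
  using sip_scale_left[of 0 u u] sip_scale_right[of u 0 u] by simp_all

lemma sip_zero_fun [simp]: "sip (\<lambda>x. 0) u = 0" "sip u (\<lambda>x. 0) = 0"
  by (simp_all add: sip_def sph_integral_def)

lemma sip_self_nonneg: "sip u u \<ge> 0"
  unfolding sip_def sph_integral_def by (rule Bochner_Integration.integral_nonneg) simp

lemma sip_self_eq_0:
  assumes "cont_sph u" "sip u u = 0" "norm x = 1"
  shows "u x = 0"
  using sph_integral_eq_0[of "\<lambda>x. u x * u x" x] assms by (simp add: sip_def continuous_on_mult)

lemma sip_cong:
  "(\<And>x. norm x = 1 \<Longrightarrow> u x = u' x) \<Longrightarrow> (\<And>x. norm x = 1 \<Longrightarrow> v x = v' x) \<Longrightarrow> sip u v = sip u' v'"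
  unfolding sip_def by (rule sph_integral_cong) simp

lemma sip_orthogonal:
  fixes u v :: "'a::euclidean_space \<Rightarrow> real" and R :: "'a \<Rightarrow> 'a"
  assumes "orthogonal_transformation R" "cont_sph u" "cont_sph v"
  shows "sip (\<lambda>x. u (R x)) (\<lambda>x. v (R x)) = sip u v"
  unfolding sip_def using sph_integral_orthogonal[OF assms(1) continuous_on_mult[OF assms(2,3)]] .

lemma sip_rot:
  fixes u v :: "'a::euclidean_space \<Rightarrow> real"
  assumes u: "cont_sph u" and v: "cont_sph v"
    and ab: "a \<in> Basis" "b \<in> Basis"
  shows "sip u (\<lambda>x. v (rot a b t x)) = sip (\<lambda>x. u (rot a b (- t) x)) v"
  using sip_orthogonal[OF orthogonal_rot[OF ab] u continuous_on_compose_rot[OF v ab, of t], of "- t"]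
  by (simp add: rot_inverse[OF ab])

lemma sip_second_diff:
  fixes u v :: "'a::euclidean_space \<Rightarrow> real"
  assumes u: "cont_sph u" and v: "cont_sph v"
    and ab: "a \<in> Basis" "b \<in> Basis"
  shows "sip u (second_diff v a b t)
    = sip u (\<lambda>x. v (rot a b t x)) + sip u (\<lambda>x. v (rot a b (- t) x)) - 2 * sip u v"
proof -
  have "second_diff v a b t = (\<lambda>x. v (rot a b t x)) + (\<lambda>x. v (rot a b (- t) x)) - 2 *\<^sub>R v"
    by (simp add: fun_eq_iff second_diff_def scaleR_fun_def)
  then show ?thesis
    by (simp add: sip_add_right sip_diff_right sip_scale_right u v continuous_on_compose_rot ab continuous_intros)
qed

lemma sip_second_diff_commute:
  fixes u v :: "'a::euclidean_space \<Rightarrow> real"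
  assumes u: "cont_sph u" and v: "cont_sph v"
    and ab: "a \<in> Basis" "b \<in> Basis"
  shows "sip u (second_diff v a b t) = sip v (second_diff u a b t)"
  using sip_rot[OF u v ab, of t] sip_rot[OF u v ab, of "- t"]
  by (simp add: sip_second_diff[OF u v ab] sip_second_diff[OF v u ab] sip_commute)

lemma sip_second_diff_eigenfunction:
  fixes u f :: "'a::euclidean_space \<Rightarrow> real"
  assumes f: "f \<in> eigenspace \<mu>" and u: "cont_sph u"
  shows "(\<lambda>k. \<Sum>a\<in>Basis. \<Sum>b\<in>Basis. sip u (second_diff f a b (step k)) / (step k)\<^sup>2)
    \<longlonglongrightarrow> - 2 * \<mu> * sip u f"
proof -
  have "sph_integral (\<lambda>x. u x * sphere_laplacian f x) = sph_integral (\<lambda>x. - \<mu> * (u x * f x))"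
    by (rule sph_integral_cong) (simp add: eigenspaceD(3)[OF f])
  also have "\<dots> = - \<mu> * sip u f" by (simp only: sph_integral_cmult sip_def)
  finally show ?thesis
    using sphere_laplacian_weak_limit[OF eigenspaceD(2)[OF f] u] by (simp add: sip_def mult.assoc)
qed

text \<open>The weak Laplacian is symmetric, so \<open>\<mu> \<langle>f, g\<rangle> = \<nu> \<langle>f, g\<rangle>\<close>.\<close>

lemma eigenspaces_orthogonal:
  fixes f g :: "'a::euclidean_space \<Rightarrow> real"
  assumes f: "f \<in> eigenspace \<mu>" and g: "g \<in> eigenspace \<nu>" and "\<mu> \<noteq> \<nu>"
  shows "sip f g = 0"
proof -
  have "(\<lambda>k. \<Sum>a\<in>Basis. \<Sum>b\<in>Basis. sip g (second_diff f a b (step k)) / (step k)\<^sup>2)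
      = (\<lambda>k. \<Sum>a\<in>Basis. \<Sum>b\<in>Basis. sip f (second_diff g a b (step k)) / (step k)\<^sup>2)"
    by (intro ext sum.cong refl) (simp add: sip_second_diff_commute eigenspaceD(4)[OF f] eigenspaceD(4)[OF g])
  then have "- 2 * \<mu> * sip g f = - 2 * \<nu> * sip f g"
    using LIMSEQ_unique[OF sip_second_diff_eigenfunction[OF f eigenspaceD(4)[OF g]]]
      sip_second_diff_eigenfunction[OF g eigenspaceD(4)[OF f]] by simp
  then show ?thesis using \<open>\<mu> \<noteq> \<nu>\<close> by (simp add: sip_commute)
qed

text \<open>One Gram--Schmidt step per spanning function. If the new function agrees on the sphere with one from
the previous span, its orthogonal part \<open>b'\<close> has norm \<open>0\<close>; the coefficient is then the default value \<open>0\<close> of a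
division by zero, which is a correct choice because \<open>b'\<close> is orthogonal to everything.\<close>

lemma orthogonal_projection_exists:
  fixes B :: "('a::euclidean_space \<Rightarrow> real) set"
  assumes "finite B" "\<And>b. b \<in> B \<Longrightarrow> cont_sph b" "cont_sph g"
  shows "\<exists>p\<in>span B. \<forall>v\<in>span B. sip (g - p) v = 0"
  using assms
proof (induction B arbitrary: g rule: finite_induct)
  case empty
  then show ?case by simp
next
  case (insert b B)
  have cB: "cont_sph v" if "v \<in> span B" for v
    using continuous_on_span[of B] insert.prems that by blast
  have cb: "cont_sph b" using insert.prems by simp
  note cg = insert.prems(2)
  obtain p where p: "p \<in> span B" "\<And>v. v \<in> span B \<Longrightarrow> sip (g - p) v = 0"
    using insert.IH[OF _ cg] insert.prems(1) by blast
  obtain q where q: "q \<in> span B" "\<And>v. v \<in> span B \<Longrightarrow> sip (b - q) v = 0"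
    using insert.IH[OF _ cb] insert.prems(1) by blast
  define b' where "b' = b - q"
  have cb': "cont_sph b'" unfolding b'_def by (intro continuous_intros cb cB q)
  define c where "c = sip g b' / sip b' b'"
  have key: "sip g b' = c * sip b' b'"
  proof (cases "sip b' b' = 0")
    case True
    then have "sip g b' = sip g 0"
      using sip_self_eq_0[OF cb'] by (intro sip_cong) auto
    with True show ?thesis by simp
  qed (simp add: c_def)
  have sub: "span B \<subseteq> span (insert b B)" by (rule span_mono) auto
  show ?case
  proof (intro bexI ballI)
    have "b' \<in> span (insert b B)" unfolding b'_def
      by (rule span_diff[OF span_base subsetD[OF sub q(1)]]) simp
    then show "p + c *\<^sub>R b' \<in> span (insert b B)"
      using p(1) sub by (intro span_add span_scale) auto
    fix v assume "v \<in> span (insert b B)"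
    then obtain k where k: "v - k *\<^sub>R b \<in> span B" by (auto simp: span_insert)
    define w where "w = (v - k *\<^sub>R b) + k *\<^sub>R q"
    have w: "w \<in> span B" unfolding w_def using k q(1) by (intro span_add span_scale)
    have v: "v = k *\<^sub>R b' + w" by (simp add: w_def b'_def algebra_simps)
    have e: "g - (p + c *\<^sub>R b') = (g - p) - c *\<^sub>R b'" by simp
    have cgp: "cont_sph (g - p)" by (intro continuous_intros cg cB p)
    have ccb: "cont_sph (c *\<^sub>R b')" by (intro continuous_intros cb')
    have "sip (g - (p + c *\<^sub>R b')) w = 0"
      unfolding e using p(2)[OF w] q(2)[OF w]
      by (simp add: sip_diff_left[OF cgp ccb cB[OF w]] sip_scale_left b'_def[symmetric])
    moreover have "sip (g - (p + c *\<^sub>R b')) b' = 0"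
      unfolding e using q(2)[OF p(1)] key
      by (simp add: sip_diff_left[OF cgp ccb cb'] sip_diff_left[OF cg cB[OF p(1)] cb'] sip_scale_left
          b'_def[symmetric] sip_commute[of p])
    moreover have "sip (g - (p + c *\<^sub>R b')) v = k * sip (g - (p + c *\<^sub>R b')) b' + sip (g - (p + c *\<^sub>R b')) w"
    proof -
      have 1: "cont_sph (g - (p + c *\<^sub>R b'))"
        unfolding e by (intro continuous_intros cgp ccb)
      have 2: "cont_sph (k *\<^sub>R b')" by (intro continuous_intros cb')
      show ?thesis
        unfolding v sip_add_right[OF 2 cB[OF w] 1] sip_scale_right ..
    qed
    ultimately show "sip (g - (p + c *\<^sub>R b')) v = 0" by simp
  qed
qed

lemma finite_basis_exists:
  fixes V :: "'b::real_vector set"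
  assumes "subspace V" "finite F" "V \<subseteq> span F"
  obtains B where "finite B" "B \<subseteq> V" "independent B" "span B = V" "card B = dim V"
proof -
  obtain B where B: "B \<subseteq> V" "independent B" "V \<subseteq> span B" "card B = dim V"
    using basis_exists[of V] by blast
  have "finite B" using independent_span_bound[OF assms(2) B(2)] B(1) assms(3) by blast
  moreover have "span B = V" using B assms(1) by (simp add: span_subspace)
  ultimately show ?thesis using that B by blast
qed

lemma restrict_hpoly_subset_span: "spoly m \<subseteq> span (on_sphere ` monomials m)"
proof
  fix f :: "'a \<Rightarrow> real" assume "f \<in> spoly m"
  then obtain p where p: "p \<in> span (monomials m)" "f = on_sphere p" by (auto simp: hpoly_def)
  from p(1) have "on_sphere p \<in> span (on_sphere ` monomials m)"
  proof (induction rule: span_induct_alt)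
    case base
    have "on_sphere 0 = (0 :: 'a \<Rightarrow> real)" by (simp add: fun_eq_iff on_sphere_def)
    then show ?case using span_zero by metis
  next
    case (step c p q)
    have eq: "on_sphere (c *\<^sub>R p + q) = c *\<^sub>R on_sphere p + on_sphere q"
      by (simp add: fun_eq_iff on_sphere_def scaleR_fun_def)
    show ?case
      unfolding eq by (intro span_add span_scale span_base imageI step)
  qed
  then show "f \<in> span (on_sphere ` monomials m)" by (simp add: p(2))
qed

lemma harmonics_projection_exists:
  fixes g :: "'a::euclidean_space \<Rightarrow> real"
  assumes "cont_sph g"
  shows "\<exists>p\<in>harmonics m. \<forall>v\<in>harmonics m. sip (g - p) v = 0"
proof -
  obtain B :: "('a \<Rightarrow> real) set" where B: "finite B" "B \<subseteq> harmonics m" "span B = harmonics m"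
  proof (rule finite_basis_exists[OF subspace_harmonics])
    show "finite (on_sphere ` monomials m :: ('a \<Rightarrow> real) set)" by (simp add: finite_monomials)
    show "harmonics m \<subseteq> span (on_sphere ` monomials m :: ('a \<Rightarrow> real) set)"
      using restrict_hpoly_subset_span by (auto simp: harmonics_def)
  qed (rule that)
  show ?thesis
    using orthogonal_projection_exists[OF B(1) _ assms] B(2,3) harmonics_continuous by blast
qed

lemma harmonics_approximation:
  fixes g :: "'a::euclidean_space \<Rightarrow> real"
  assumes d: "DIM('a) \<ge> 2" and g: "cont_sph g" and "\<epsilon> > 0"
  obtains n h where "\<And>j. h j \<in> harmonics j" "\<And>x. norm x = 1 \<Longrightarrow> \<bar>g x - (\<Sum>j\<le>n. h j x)\<bar> < \<epsilon>"
proof -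
  obtain q where q: "real_polynomial_function q" "\<And>x. x \<in> sphere 0 1 \<Longrightarrow> \<bar>g x - q x\<bar> < \<epsilon>"
    using Stone_Weierstrass_real_polynomial_function[OF compact_sphere g \<open>\<epsilon> > 0\<close>] by blast
  obtain n where "q \<in> span (\<Union>j\<le>n. hpoly j)"
    using polynomial_is_sum_of_homogeneous[OF q(1)] by blast
  then have "\<exists>h. (\<forall>j. h j \<in> harmonics j) \<and> (\<forall>j>n. h j = 0) \<and> on_sphere q = (\<lambda>x. \<Sum>j\<le>n. h j x)"
  proof (induction rule: span_induct_alt)
    case base
    show ?case
    proof (intro exI conjI allI impI)
      show "(0 :: 'a \<Rightarrow> real) \<in> harmonics j" for j by (rule subspace_0[OF subspace_harmonics])
      show "on_sphere 0 = (\<lambda>x::'a. \<Sum>j\<le>n. 0 x)"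
        by (simp add: fun_eq_iff on_sphere_def)
    qed (rule refl)
  next
    case (step c p q)
    then obtain h where h: "\<And>j. h j \<in> harmonics j" "\<And>j. j > n \<Longrightarrow> h j = 0"
      "on_sphere q = (\<lambda>x. \<Sum>j\<le>n. h j x)" by blast
    obtain m where m: "m \<le> n" "p \<in> hpoly m" using step(1) by auto
    obtain e where e: "\<And>j. e j \<in> harmonics j" "on_sphere p = (\<lambda>x. \<Sum>j\<le>m. e j x)"
      using restrict_hpoly_decomposition[OF d m(2)] by blast
    define e' where "e' j = (if j \<le> m then e j else 0)" for j
    have e': "e' j \<in> harmonics j" for j using e(1)[of j] subspace_0[OF subspace_harmonics[of j]] by (auto simp: e'_def)
    have sp: "on_sphere p x = (\<Sum>j\<le>n. e' j x)" for x
    proof -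
      have "(\<Sum>j\<le>n. e' j x) = (\<Sum>j\<le>m. e' j x)"
        by (rule sum.mono_neutral_right) (use m in \<open>auto simp: e'_def\<close>)
      also have "\<dots> = (\<Sum>j\<le>m. e j x)" by (rule sum.cong) (auto simp: e'_def)
      finally show ?thesis by (simp add: e(2))
    qed
    show ?case
    proof (intro exI[of _ "\<lambda>j. c *\<^sub>R e' j + h j"] conjI allI impI)
      show "c *\<^sub>R e' j + h j \<in> harmonics j" for j
        by (intro subspace_add[OF subspace_harmonics] subspace_scale[OF subspace_harmonics] e' h)
      show "c *\<^sub>R e' j + h j = 0" if "j > n" for j using that h(2) m by (simp add: e'_def)
      have "on_sphere (c *\<^sub>R p + q) x = c * on_sphere p x + on_sphere q x" for x
        by (simp add: on_sphere_def scaleR_fun_def)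
      then show "on_sphere (c *\<^sub>R p + q) = (\<lambda>x. \<Sum>j\<le>n. (c *\<^sub>R e' j + h j) x)"
        by (intro ext) (simp add: sp h(3) scaleR_fun_def sum.distrib sum_distrib_left)
    qed
  qed
  then obtain h where h: "\<And>j. h j \<in> harmonics j" "on_sphere q = (\<lambda>x. \<Sum>j\<le>n. h j x)" by blast
  have "\<bar>g x - (\<Sum>j\<le>n. h j x)\<bar> < \<epsilon>" if "norm x = 1" for x
    using q(2)[of x] that fun_cong[OF h(2), of x] by simp
  with h(1) show ?thesis by (rule that)
qed

text \<open>If \<open>u\<close> is orthogonal to all harmonics and \<open>h\<close> is a sum of harmonics within \<open>\<epsilon>\<close> of \<open>u\<close>, then
\<open>\<langle>u, u\<rangle> = \<langle>u, u - h\<rangle> \<le> \<epsilon> \<integral>\<bar>u\<bar>\<close>.\<close>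

lemma harmonics_complete:
  fixes u :: "'a::euclidean_space \<Rightarrow> real"
  assumes d: "DIM('a) \<ge> 2" and u: "cont_sph u"
    and orth: "\<And>j v. v \<in> harmonics j \<Longrightarrow> sip u v = 0" and x: "norm x = 1"
  shows "u x = 0"
proof -
  define I where "I = sph_integral (\<lambda>x. \<bar>u x\<bar>)"
  have le: "sip u u \<le> \<epsilon> * I" if "\<epsilon> > 0" for \<epsilon>
  proof -
    obtain n h where h: "\<And>j. h j \<in> harmonics j" "\<And>x. norm x = 1 \<Longrightarrow> \<bar>u x - (\<Sum>j\<le>n. h j x)\<bar> < \<epsilon>"
      by (rule harmonics_approximation[OF d u \<open>\<epsilon> > 0\<close>]) (rule that)
    have ch: "cont_sph (\<Sum>j\<le>n. h j)"
      by (intro continuous_on_fun_sum harmonics_continuous[OF h(1)])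
    have "sip u (\<Sum>j\<le>n. h j) = 0"
      using sip_sum_right[OF u, of "{..n}" h] harmonics_continuous[OF h(1)] orth[OF h(1)] by simp
    then have "sip u u = sip u (u - (\<Sum>j\<le>n. h j))"
      using sip_diff_right[OF u ch u] by simp
    also have "\<dots> \<le> sph_integral (\<lambda>x. \<epsilon> * \<bar>u x\<bar>)"
      unfolding sip_def
    proof (rule sph_integral_mono)
      fix x :: 'a assume "x \<in> sphere 0 1"
      then have "\<bar>(u - (\<Sum>j\<le>n. h j)) x\<bar> \<le> \<epsilon>" using h(2)[of x] by simp
      then have "\<bar>u x\<bar> * \<bar>(u - (\<Sum>j\<le>n. h j)) x\<bar> \<le> \<bar>u x\<bar> * \<epsilon>" by (rule mult_left_mono) simp
      then show "u x * (u - (\<Sum>j\<le>n. h j)) x \<le> \<epsilon> * \<bar>u x\<bar>"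
        by (simp add: abs_mult[symmetric] mult.commute)
    qed (intro continuous_intros u ch)+
    finally show ?thesis by (simp add: sph_integral_cmult I_def)
  qed
  have "sip u u \<le> 0"
  proof (rule field_le_epsilon)
    fix e :: real assume "e > 0"
    have "I \<ge> 0" unfolding I_def sph_integral_def by (rule Bochner_Integration.integral_nonneg) simp
    have "sip u u \<le> e / (I + 1) * I" by (rule le) (use \<open>e > 0\<close> \<open>I \<ge> 0\<close> in simp)
    also have "\<dots> \<le> e" using \<open>e > 0\<close> \<open>I \<ge> 0\<close> by (simp add: divide_simps)
    finally show "sip u u \<le> 0 + e" by simp
  qed
  then have "sip u u = 0" using sip_self_nonneg[of u] by simp
  then show ?thesis using sip_self_eq_0[OF u _ x] by simp
qed

lemma harmonics_orthogonal:
  fixes f g :: "'a::euclidean_space \<Rightarrow> real"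
  assumes "DIM('a) \<ge> 2" "f \<in> harmonics i" "g \<in> harmonics j" "i \<noteq> j"
  shows "sip f g = 0"
  using eigenspaces_orthogonal[of f _ g] eigval_strict_mono[OF assms(1)] assms(2-4)
  unfolding harmonics_def by (metis IntD1 strict_mono_eq)

text \<open>An eigenfunction is orthogonal to all harmonics of other eigenvalues. If its own eigenvalue is not
among the \<open>\<mu>\<^sub>m\<close>, completeness makes it zero; otherwise completeness is applied to its difference from its
projection to the harmonics of degree \<open>m\<close>.\<close>

lemma eigenfunction_in_harmonics:
  fixes f :: "'a::euclidean_space \<Rightarrow> real"
  assumes d: "DIM('a) \<ge> 2" and f: "eigenfunction \<mu> f"
  obtains m where "\<mu> = eigval TYPE('a) m" "f \<in> harmonics m"
proof -
  have fe: "f \<in> eigenspace \<mu>" and f0: "f \<noteq> (\<lambda>x. 0)" using f by (auto simp: eigenfunction_def)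
  have "\<exists>m. \<mu> = eigval TYPE('a) m"
  proof (rule ccontr)
    assume "\<nexists>m. \<mu> = eigval TYPE('a) m"
    then have "sip f v = 0" if "v \<in> harmonics j" for v j
      using that eigenspaces_orthogonal[OF fe, of v] by (auto simp: harmonics_def)
    then have "f x = 0" for x
      using harmonics_complete[OF d eigenspaceD(4)[OF fe]] eigenspaceD(1)[OF fe] by (cases "norm x = 1") auto
    then show False using f0 by auto
  qed
  then obtain m where m: "\<mu> = eigval TYPE('a) m" by blast
  obtain p where p: "p \<in> harmonics m" "\<And>v. v \<in> harmonics m \<Longrightarrow> sip (f - p) v = 0"
    using harmonics_projection_exists[OF eigenspaceD(4)[OF fe]] by blast
  have pe: "p \<in> eigenspace \<mu>" using p(1) by (simp add: harmonics_def m)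
  have fp: "f - p \<in> eigenspace \<mu>" by (rule subspace_diff[OF subspace_eigenspace fe pe])
  have "sip (f - p) v = 0" if "v \<in> harmonics j" for v j
  proof (cases "j = m")
    case True
    then show ?thesis using p(2) that by simp
  next
    case False
    then have "\<mu> \<noteq> eigval TYPE('a) j"
      using eigval_strict_mono[OF d] by (simp add: m strict_mono_eq)
    then show ?thesis using eigenspaces_orthogonal[OF fp] that by (auto simp: harmonics_def)
  qed
  then have "(f - p) x = 0" for x
    using harmonics_complete[OF d eigenspaceD(4)[OF fp]] eigenspaceD(1)[OF fp] by (cases "norm x = 1") blast+
  then have "f = p" by (simp add: fun_eq_iff)
  then show ?thesis using that m p(1) by blast
qed

section \<open>Energy of piecewise multiples of an eigenfunction\<close>

lemma sip_orthogonal_le: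
  fixes h q :: "'a::euclidean_space \<Rightarrow> real"
  assumes h: "cont_sph h" and q: "cont_sph q"
    and orth: "sip (h - q) q = 0"
  shows "sip q q \<le> sip h h"
proof -
  have hq: "cont_sph (h - q)" by (intro continuous_intros h q)
  have "0 \<le> sip (h - q) (h - q)" by (rule sip_self_nonneg)
  also have "\<dots> = sip (h - q) h - sip (h - q) q" by (rule sip_diff_right[OF h q hq])
  also have "\<dots> = sip h h - sip q h" using orth sip_diff_left[OF h q h] by simp
  also have "sip q h = sip q q" using orth sip_diff_left[OF h q q] by (simp add: sip_commute)
  finally show ?thesis by simp
qed

lemma nodal_set_complement_openin:
  assumes "cont_sph (f :: 'a::euclidean_space \<Rightarrow> real)"
  shows "openin (top_of_set (sphere 0 1)) (nonzero_set f)"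
proof -
  have "openin (top_of_set (sphere 0 1)) (sphere 0 1 \<inter> f -` (- {0}))"
    by (rule continuous_openin_preimage_gen[OF assms]) (simp add: open_Compl)
  moreover have "sphere 0 1 \<inter> f -` (- {0}) = nonzero_set f" by auto
  ultimately show ?thesis by simp
qed

lemma openin_nodal_component:
  fixes f :: "'a::euclidean_space \<Rightarrow> real"
  assumes f: "cont_sph f"
  defines "N \<equiv> nonzero_set f"
  shows "openin (top_of_set (sphere 0 1)) (connected_component_set N x)"
proof -
  have N: "openin (top_of_set (sphere 0 1)) N"
    unfolding N_def by (rule nodal_set_complement_openin[OF f])
  have "locally connected N"
    by (rule locally_open_subset[OF locally_connected_sphere N])
  then show ?thesis
    using openin_connected_component_locally_connected openin_trans N by blast
qed

text \<open>Nodal domains are open, which gives continuity off the zero set; at a zero of \<open>f\<close> the product is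
squeezed by \<open>C \<bar>f\<bar>\<close>.\<close>

lemma continuous_on_piecewise_multiple:
  fixes f c :: "'a::euclidean_space \<Rightarrow> real"
  assumes f: "cont_sph f"
    and const: "\<And>x y. connected_component (nonzero_set f) x y \<Longrightarrow> c x = c y"
    and C: "\<And>x. \<bar>c x\<bar> \<le> C"
  shows "cont_sph (\<lambda>x. c x * f x)"
  unfolding continuous_on_def
proof
  fix x :: 'a assume x: "x \<in> sphere 0 1"
  have fx: "(f \<longlongrightarrow> f x) (at x within sphere 0 1)"
    using f x by (simp add: continuous_on_def)
  show "((\<lambda>x. c x * f x) \<longlongrightarrow> c x * f x) (at x within sphere 0 1)"
  proof (cases "f x = 0")
    case True
    have "((\<lambda>y. c y * f y) \<longlongrightarrow> 0) (at x within sphere 0 1)"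
    proof (rule Lim_null_comparison)
      show "\<forall>\<^sub>F y in at x within sphere 0 1. norm (c y * f y) \<le> C * \<bar>f y\<bar>"
        using C by (intro always_eventually allI) (simp add: abs_mult mult_right_mono)
      show "((\<lambda>y. C * \<bar>f y\<bar>) \<longlongrightarrow> 0) (at x within sphere 0 1)"
        using tendsto_mult_right_zero[OF tendsto_rabs_zero[of f]] fx True by simp
    qed
    with True show ?thesis by simp
  next
    case False
    show ?thesis
    proof (rule Lim_transform_within_openin)
      show "((\<lambda>y. c x * f y) \<longlongrightarrow> c x * f x) (at x within sphere 0 1)"
        by (intro tendsto_intros fx)
      show "openin (top_of_set (sphere 0 1)) (connected_component_set (nonzero_set f) x)"
        by (rule openin_nodal_component[OF f])
      show "x \<in> connected_component_set (nonzero_set f) x"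
        using x False by simp
      show "c x * f y = c y * f y" if "y \<in> connected_component_set (nonzero_set f) x" for y
        using const[of x y] that by simp
    qed
  qed
qed

lemma continuous_on_piecewise_square_multiple:
  fixes f c :: "'a::euclidean_space \<Rightarrow> real"
  assumes f: "cont_sph f"
    and const: "\<And>x y. connected_component (nonzero_set f) x y \<Longrightarrow> c x = c y"
    and C: "\<And>x. \<bar>c x\<bar> \<le> C"
  shows "cont_sph (\<lambda>x. (c x)\<^sup>2 * f x)"
proof (rule continuous_on_piecewise_multiple[OF f])
  show "\<bar>(c x)\<^sup>2\<bar> \<le> C\<^sup>2" for x using C[of x] by (metis abs_ge_zero abs_power2 power2_abs power_mono)
  show "(c x)\<^sup>2 = (c y)\<^sup>2" if "connected_component (nonzero_set f) x y" for x y
    using const[OF that] by simp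
qed

lemma connected_rot_path: "connected ((\<lambda>s. rot a b s x) ` {0..t})"
proof (rule connected_continuous_image)
  show "continuous_on {0..t} (\<lambda>s. rot a b s x)"
    unfolding rot_def by (intro continuous_intros)
qed simp

text \<open>If \<open>c\<close> differs at the two ends of the arc from \<open>x\<close> to its rotated image, the arc leaves the nodal domain of
\<open>x\<close>, so \<open>f\<close> has a zero on it and is at most \<open>L t\<close> in absolute value at both ends.\<close>

lemma same_sign_interaction_bound:
  fixes f c :: "'a::euclidean_space \<Rightarrow> real"
  assumes ab: "a \<in> Basis" "b \<in> Basis" and x: "norm x = 1" and t: "t > 0"
    and const: "\<And>x y. connected_component (nonzero_set f) x y \<Longrightarrow> c x = c y"
    and C: "\<And>x. \<bar>c x\<bar> \<le> C"
    and L: "L \<ge> 0" "\<And>x s t. norm x = 1 \<Longrightarrow> \<bar>f (rot a b s x) - f (rot a b t x)\<bar> \<le> L * \<bar>s - t\<bar>"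
  shows "(c x - c (rot a b t x))\<^sup>2 * (f x * f (rot a b t x))
    \<le> 4 * C\<^sup>2 * L\<^sup>2 * t\<^sup>2 * (if 0 < \<bar>f x\<bar> \<and> \<bar>f x\<bar> \<le> L * t then 1 else 0)"
proof (cases "(c x - c (rot a b t x))\<^sup>2 * (f x * f (rot a b t x)) \<le> 0")
  case True
  have "0 \<le> 4 * C\<^sup>2 * L\<^sup>2 * t\<^sup>2 * (if 0 < \<bar>f x\<bar> \<and> \<bar>f x\<bar> \<le> L * t then 1 else 0)" by simp
  with True show ?thesis by linarith
next
  case False
  define y where "y = rot a b t x"
  have ne: "c x \<noteq> c y" "f x \<noteq> 0" using False by (auto simp: y_def)
  \<comment> \<open>otherwise the whole arc would lie in one nodal domain\<close>
  have "\<exists>s\<in>{0..t}. f (rot a b s x) = 0"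
  proof (rule ccontr)
    assume "\<not> ?thesis"
    then have "(\<lambda>s. rot a b s x) ` {0..t} \<subseteq> nonzero_set f"
      using ab x by auto
    moreover have "x \<in> (\<lambda>s. rot a b s x) ` {0..t}" using t by (intro image_eqI[of _ _ 0]) auto
    moreover have "y \<in> (\<lambda>s. rot a b s x) ` {0..t}" using t by (auto simp: y_def)
    ultimately have "connected_component (nonzero_set f) x y"
      unfolding connected_component_def using connected_rot_path by blast
    then show False using const ne by blast
  qed
  then obtain s where s: "0 \<le> s" "s \<le> t" "f (rot a b s x) = 0" by auto
  have "\<bar>f x\<bar> \<le> L * s" using L(2)[OF x, of 0 s] s by simp
  also have "\<dots> \<le> L * t" using s L(1) by (intro mult_left_mono)
  finally have fx: "\<bar>f x\<bar> \<le> L * t" .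
  have "\<bar>f y\<bar> \<le> L * (t - s)" using L(2)[OF x, of t s] s by (simp add: y_def)
  also have "\<dots> \<le> L * t" using s L(1) by (intro mult_left_mono) auto
  finally have fy: "\<bar>f y\<bar> \<le> L * t" .
  have "f x * f y \<le> \<bar>f x\<bar> * \<bar>f y\<bar>" by (metis abs_ge_self abs_mult)
  also have "\<dots> \<le> (L * t) * (L * t)" using fx fy L(1) t by (intro mult_mono) auto
  finally have ff: "f x * f y \<le> L\<^sup>2 * t\<^sup>2" by (simp add: power2_eq_square mult_ac)
  have "\<bar>c x - c y\<bar> \<le> 2 * C" using C[of x] C[of y] by linarith
  then have "(c x - c y)\<^sup>2 \<le> (2 * C)\<^sup>2" by (metis abs_ge_zero power2_abs power_mono)
  then have cc: "(c x - c y)\<^sup>2 \<le> 4 * C\<^sup>2" by (simp add: power_mult_distrib)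
  have "(c x - c y)\<^sup>2 * (f x * f y) \<le> (c x - c y)\<^sup>2 * (L\<^sup>2 * t\<^sup>2)"
    using ff by (intro mult_left_mono) auto
  also have "\<dots> \<le> 4 * C\<^sup>2 * (L\<^sup>2 * t\<^sup>2)" using cc by (intro mult_right_mono) auto
  finally show ?thesis using fx ne by (simp add: y_def mult.assoc)
qed

text \<open>The sets where \<open>0 < \<bar>f\<bar> \<le> \<delta>\<close> decrease to the empty set as \<open>\<delta>\<close> decreases to \<open>0\<close>.\<close>

lemma small_values_integral_tendsto_0:
  fixes f :: "'a::euclidean_space \<Rightarrow> real"
  assumes f: "cont_sph f" and L: "L \<ge> 0"
  shows "(\<lambda>k. sph_integral (\<lambda>x. if 0 < \<bar>f x\<bar> \<and> \<bar>f x\<bar> \<le> L * step k then 1 else 0)) \<longlonglongrightarrow> 0"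
proof -
  have [measurable]: "f \<in> borel_measurable sph_measure" by (rule borel_measurable_sphere[OF f])
  have "(\<lambda>k. sph_integral (\<lambda>x. if 0 < \<bar>f x\<bar> \<and> \<bar>f x\<bar> \<le> L * step k then 1 else 0))
      \<longlonglongrightarrow> sph_integral (\<lambda>x::'a. 0)"
    unfolding sph_integral_def
  proof (rule integral_dominated_convergence[where w="\<lambda>x. 1"])
    show "integrable sph_measure (\<lambda>x::'a. 1 :: real)"
      by (intro integrable_sphere continuous_intros)
    show "AE x in sph_measure. (\<lambda>k. if 0 < \<bar>f x\<bar> \<and> \<bar>f x\<bar> \<le> L * step k then 1 else 0) \<longlonglongrightarrow> (0::real)"
    proof (rule AE_I2)
      fix x :: 'a
      show "(\<lambda>k. if 0 < \<bar>f x\<bar> \<and> \<bar>f x\<bar> \<le> L * step k then 1 else 0) \<longlonglongrightarrow> (0::real)"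
      proof (cases "f x = 0")
        case False
        have "(\<lambda>k. L * step k) \<longlonglongrightarrow> L * 0" by (intro tendsto_intros step_tendsto_0)
        then have "\<forall>\<^sub>F k in sequentially. L * step k < \<bar>f x\<bar>"
          using False by (intro order_tendstoD(2)) auto
        then have "\<forall>\<^sub>F k in sequentially. (if 0 < \<bar>f x\<bar> \<and> \<bar>f x\<bar> \<le> L * step k then 1 else 0) = (0::real)"
          by eventually_elim auto
        then show ?thesis by (rule tendsto_eventually)
      qed simp
    qed
  qed auto
  then show ?thesis by (simp add: sph_integral_def)
qed

lemma integrable_small_values:
  fixes f :: "'a::euclidean_space \<Rightarrow> real"
  assumes f: "cont_sph f"
  shows "integrable sph_measure (\<lambda>x. if 0 < \<bar>f x\<bar> \<and> \<bar>f x\<bar> \<le> \<delta> then 1 else (0::real))"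
proof (rule finite_measure.integrable_const_bound[OF finite_measure_sph_measure, of _ 1])
  have [measurable]: "f \<in> borel_measurable sph_measure" by (rule borel_measurable_sphere[OF f])
  show "(\<lambda>x. if 0 < \<bar>f x\<bar> \<and> \<bar>f x\<bar> \<le> \<delta> then 1 else (0::real)) \<in> borel_measurable sph_measure"
    by measurable
qed auto

text \<open>Summed over all pairs of axes and divided by \<open>2 t\<^sup>2\<close> this approximates the Dirichlet integral of \<open>g\<close>.\<close>

abbreviation rot_energy :: "('a::euclidean_space \<Rightarrow> real) \<Rightarrow> 'a \<Rightarrow> 'a \<Rightarrow> real \<Rightarrow> real"
  where "rot_energy g a b t \<equiv> sip (g - (\<lambda>x. g (rot a b t x))) (g - (\<lambda>x. g (rot a b t x)))"

text \<open>With \<open>y\<close> the rotated point, \<open>(g x - g y)\<^sup>2\<close> equals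
\<open>c(x)\<^sup>2 f(x) (f(x) - f(y)) + c(y)\<^sup>2 f(y) (f(y) - f(x)) + (c(x) - c(y))\<^sup>2 f(x) f(y)\<close>. By invariance of the
measure the first two terms integrate to minus the integral of \<open>c\<^sup>2 f\<close> times the second difference of the
smooth function \<open>f\<close>, and the integral of the last one is bounded above by \<open>o(t\<^sup>2)\<close>. This replaces
integration by parts on the nodal domains.\<close>

lemma rotation_energy_upper_bound:
  fixes f c :: "'a::euclidean_space \<Rightarrow> real"
  assumes ab: "a \<in> Basis" "b \<in> Basis"
    and f: "sphere_smooth f"
    and const: "\<And>x y. connected_component (nonzero_set f) x y \<Longrightarrow> c x = c y"
    and C: "\<And>x. \<bar>c x\<bar> \<le> C"
  defines "g \<equiv> \<lambda>x. c x * f x" and "w \<equiv> \<lambda>x. (c x)\<^sup>2 * f x"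
  obtains \<epsilon> where "\<epsilon> \<longlonglongrightarrow> 0"
    "\<And>k. rot_energy g a b (step k) / (step k)\<^sup>2
        \<le> - sip w (second_diff f a b (step k)) / (step k)\<^sup>2 + \<epsilon> k"
proof -
  have cf: "cont_sph f" by (rule sphere_smooth_continuous_on[OF f])
  have cg: "cont_sph g"
    unfolding g_def by (rule continuous_on_piecewise_multiple[OF cf const C])
  have cw: "cont_sph w"
    unfolding w_def by (rule continuous_on_piecewise_square_multiple[OF cf const C])
  obtain L where L: "L \<ge> 0" "\<And>x s t. norm x = 1 \<Longrightarrow> \<bar>f (rot a b s x) - f (rot a b t x)\<bar> \<le> L * \<bar>s - t\<bar>"
    by (rule sphere_smooth_lipschitz_rot[OF f ab]) (rule that)
  define \<theta> where "\<theta> t x = (if 0 < \<bar>f x\<bar> \<and> \<bar>f x\<bar> \<le> L * t then 1 else (0::real))" for t x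
  define K where "K = 4 * C\<^sup>2 * L\<^sup>2"
  have bound: "rot_energy g a b t
      \<le> - sip w (second_diff f a b t) + K * t\<^sup>2 * sph_integral (\<theta> t)" if t: "t > 0" for t
  proof -
    define R where "R = rot a b t"
    have comp: "cont_sph (\<lambda>x. u (R x))" if "cont_sph u" for u :: "'a \<Rightarrow> real"
      unfolding R_def by (rule continuous_on_compose_rot[OF that ab])
    define r where "r x = (g x - g (R x))\<^sup>2 - (w x * (f x - f (R x)) + w (R x) * (f (R x) - f x))" for x
    have r: "r x = (c x - c (R x))\<^sup>2 * (f x * f (R x))" for x
      unfolding r_def g_def w_def by algebra
    have cr: "cont_sph r"
      unfolding r_def by (intro continuous_intros cg cw cf comp)
    have "sph_integral r \<le> sph_integral (\<lambda>x. K * t\<^sup>2 * \<theta> t x)"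
      unfolding sph_integral_def
    proof (rule integral_mono[OF integrable_sphere[OF cr]])
      show "integrable sph_measure (\<lambda>x. K * t\<^sup>2 * \<theta> t x)"
        unfolding \<theta>_def by (intro integrable_mult_right integrable_small_values[OF cf])
      show "r x \<le> K * t\<^sup>2 * \<theta> t x" if "x \<in> space sph_measure" for x
      proof -
        have x: "norm x = 1" using that by simp
        have "(c x - c (rot a b t x))\<^sup>2 * (f x * f (rot a b t x))
            \<le> 4 * C\<^sup>2 * L\<^sup>2 * t\<^sup>2 * (if 0 < \<bar>f x\<bar> \<and> \<bar>f x\<bar> \<le> L * t then 1 else 0)"
          by (rule same_sign_interaction_bound[OF ab x t _ C L]) (rule const)
        then show ?thesis by (simp only: r R_def K_def \<theta>_def)
      qed
    qed
    then have ri: "sph_integral r \<le> K * t\<^sup>2 * sph_integral (\<theta> t)"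
      by (simp add: sph_integral_cmult)
    have split: "sph_integral (\<lambda>x. w x * (f x - f (R x)) + w (R x) * (f (R x) - f x))
        = - sip w (second_diff f a b t)"
    proof -
      have "sph_integral (\<lambda>x. w x * (f x - f (R x)) + w (R x) * (f (R x) - f x))
          = sph_integral (\<lambda>x. (w x * f x - w x * f (R x)) + (w (R x) * f (R x) - w (R x) * f x))"
        by (simp add: right_diff_distrib)
      also have "\<dots> = (sip w f - sip w (\<lambda>x. f (R x))) + (sip (\<lambda>x. w (R x)) (\<lambda>x. f (R x)) - sip (\<lambda>x. w (R x)) f)"
        unfolding sip_def
        by (simp add: sph_integral_add sph_integral_diff continuous_on_mult continuous_on_diff cw cf comp)
      also have "sip (\<lambda>x. w (R x)) (\<lambda>x. f (R x)) = sip w f"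
        unfolding R_def by (rule sip_orthogonal[OF orthogonal_rot[OF ab] cw cf])
      also have "sip (\<lambda>x. w (R x)) f = sip w (\<lambda>x. f (rot a b (- t) x))"
        using sip_rot[OF cw cf ab, of "- t"] by (simp add: R_def)
      finally show ?thesis
        by (simp add: sip_second_diff[OF cw cf ab] R_def)
    qed
    have "sip (g - (\<lambda>x. g (R x))) (g - (\<lambda>x. g (R x)))
        = sph_integral (\<lambda>x. (w x * (f x - f (R x)) + w (R x) * (f (R x) - f x)) + r x)"
      unfolding sip_def by (rule sph_integral_cong) (simp add: r_def power2_eq_square)
    also have "\<dots> = - sip w (second_diff f a b t) + sph_integral r"
      unfolding split[symmetric]
      by (intro sph_integral_add continuous_intros cw cf cr comp)
    finally show ?thesis using ri by (simp add: R_def)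
  qed
  show ?thesis
  proof (rule that[of "\<lambda>k. K * sph_integral (\<theta> (step k))"])
    have "(\<lambda>k. K * sph_integral (\<theta> (step k))) \<longlonglongrightarrow> K * 0"
      unfolding \<theta>_def by (intro tendsto_intros small_values_integral_tendsto_0[OF cf L(1)])
    then show "(\<lambda>k. K * sph_integral (\<theta> (step k))) \<longlonglongrightarrow> 0" by simp
    fix k
    have "rot_energy g a b (step k) / (step k)\<^sup>2
        \<le> (- sip w (second_diff f a b (step k)) + K * (step k)\<^sup>2 * sph_integral (\<theta> (step k))) / (step k)\<^sup>2"
      by (intro divide_right_mono bound) auto
    also have "\<dots> = - sip w (second_diff f a b (step k)) / (step k)\<^sup>2 + K * sph_integral (\<theta> (step k))"
      by (simp add: add_divide_distrib diff_divide_distrib)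
    finally show "rot_energy g a b (step k) / (step k)\<^sup>2
        \<le> - sip w (second_diff f a b (step k)) / (step k)\<^sup>2 + K * sph_integral (\<theta> (step k))" .
  qed
qed

lemma orthogonal_to_restrict_hpoly:
  fixes u :: "'a::euclidean_space \<Rightarrow> real"
  assumes d: "DIM('a) \<ge> 2" and u: "cont_sph u"
    and orth: "\<And>i v. i \<le> j \<Longrightarrow> even (i + j) \<Longrightarrow> v \<in> harmonics i \<Longrightarrow> sip u v = 0"
    and v: "v \<in> spoly j"
  shows "sip u v = 0"
proof -
  obtain p where p: "p \<in> hpoly j" "v = on_sphere p" using v by auto
  obtain e where e: "\<And>i. e i \<in> harmonics i" "\<And>i. odd (j + i) \<Longrightarrow> e i = 0"
    "on_sphere p = (\<lambda>x. \<Sum>i\<le>j. e i x)"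
    using restrict_hpoly_decomposition[OF d p(1)] by blast
  have "v = (\<Sum>i\<le>j. e i)" by (simp add: p(2) e(3) fun_eq_iff)
  then have "sip u v = (\<Sum>i\<le>j. sip u (e i))"
    using sip_sum_right[OF u, of "{..j}" e] harmonics_continuous[OF e(1)] by simp
  also have "\<dots> = 0"
  proof (rule sum.neutral, rule ballI)
    fix i assume "i \<in> {..j}"
    then show "sip u (e i) = 0"
      using orth[of i "e i"] e by (cases "odd (j + i)") (auto simp: add.commute)
  qed
  finally show ?thesis .
qed

lemma sip_sum_of_projections:
  fixes p :: "nat \<Rightarrow> 'a::euclidean_space \<Rightarrow> real" and n :: nat
  assumes d: "DIM('a) \<ge> 2" and p: "\<And>j. p j \<in> harmonics j" and v: "v \<in> harmonics i" and i: "i \<le> n"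
  shows "sip v (\<Sum>j\<le>n. p j) = sip v (p i)"
proof -
  have "sip v (\<Sum>j\<le>n. p j) = (\<Sum>j\<le>n. sip v (p j))"
    by (rule sip_sum_right[OF harmonics_continuous[OF v] harmonics_continuous[OF p]])
  also have "\<dots> = (\<Sum>j\<in>{i}. sip v (p j))"
    by (rule sum.mono_neutral_right) (use i harmonics_orthogonal[OF d v p] in auto)
  finally show ?thesis by simp
qed

text \<open>Rotations preserve the space of polynomials of degree at most \<open>n\<close> and hence its orthogonal complement, so
\<open>g - g \<circ> R\<close> splits orthogonally into the contributions of \<open>P\<close> and of \<open>g - P\<close>, and the second one is dropped.\<close>

lemma rotation_energy_lower_bound:
  fixes g :: "'a::euclidean_space \<Rightarrow> real" and p :: "nat \<Rightarrow> 'a \<Rightarrow> real" and n :: nat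
  assumes d: "DIM('a) \<ge> 2" and ab: "a \<in> Basis" "b \<in> Basis"
    and g: "cont_sph g"
    and p: "\<And>j. p j \<in> harmonics j" and orth: "\<And>j v. v \<in> harmonics j \<Longrightarrow> sip (g - p j) v = 0"
  defines "P \<equiv> \<Sum>j\<le>n. p j"
  shows "- sip P (second_diff P a b t)
    \<le> rot_energy g a b t"
proof -
  have cp: "cont_sph (p j)" for j by (rule harmonics_continuous[OF p])
  have cP: "cont_sph P" unfolding P_def by (intro continuous_on_fun_sum cp)
  have cgP: "cont_sph (g - P)" by (intro continuous_intros g cP)
  have orth': "sip (g - P) v = 0" if v: "v \<in> harmonics i" and i: "i \<le> n" for i v
  proof -
    note cv = harmonics_continuous[OF v]
    have "sip v P = sip v (p i)"
      unfolding P_def by (rule sip_sum_of_projections[OF d p v i])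
    also have "\<dots> = sip v g"
      using orth[OF v] sip_diff_left[OF g cp cv] by (simp add: sip_commute)
    finally show ?thesis using sip_diff_left[OF g cP cv] by (simp add: sip_commute)
  qed
  have orth_poly: "sip (g - P) v = 0" if v: "v \<in> spoly j" and j: "j \<le> n" for v j
  proof (rule orthogonal_to_restrict_hpoly[OF d cgP _ v])
    show "sip (g - P) u = 0" if "i \<le> j" "u \<in> harmonics i" for i u
      by (rule orth'[OF that(2) order_trans[OF that(1) j]])
  qed
  have rot_poly: "on_sphere (\<lambda>x. q (rot a b s x)) \<in> spoly j" if "q \<in> hpoly j" for q j s
    using hpoly_compose_linear[OF that linear_rot] by blast
  have orth_rot: "sip (g - P) (\<lambda>x. P (rot a b s x)) = 0" for s
  proof -
    have "sip (g - P) (\<lambda>x. p j (rot a b s x)) = 0" if j: "j \<le> n" for j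
    proof -
      obtain q where q: "q \<in> hpoly j" "p j = on_sphere q" using p[of j] by (auto simp: harmonics_def)
      have "(\<lambda>x. p j (rot a b s x)) = on_sphere (\<lambda>x. q (rot a b s x))"
        using ab by (simp add: q fun_eq_iff on_sphere_def)
      then show ?thesis using orth_poly[OF rot_poly[OF q(1)] j] by simp
    qed
    moreover have "(\<lambda>x. P (rot a b s x)) = (\<Sum>j\<le>n. (\<lambda>x. p j (rot a b s x)))"
      by (simp add: P_def fun_eq_iff)
    ultimately show ?thesis
      using sip_sum_right[OF cgP, of "{..n}" "\<lambda>j x. p j (rot a b s x)"] continuous_on_compose_rot[OF cp ab]
      by simp
  qed
  define PR where "PR = (\<lambda>x. P (rot a b t x))"
  define gR where "gR = (\<lambda>x. g (rot a b t x))"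
  have cPR: "cont_sph PR" unfolding PR_def by (rule continuous_on_compose_rot[OF cP ab])
  have cgR: "cont_sph gR" unfolding gR_def by (rule continuous_on_compose_rot[OF g ab])
  have cq: "cont_sph (P - PR)" by (intro continuous_intros cP cPR)
  have ch: "cont_sph (g - gR)" by (intro continuous_intros g cgR)
  have 1: "sip (g - P) (P - PR) = 0"
    unfolding sip_diff_right[OF cP cPR cgP]
    using orth_rot[of 0] orth_rot[of t] by (simp add: PR_def)
  have 2: "sip (gR - PR) (P - PR) = 0"
  proof -
    have eq: "gR - PR = (\<lambda>x. (g - P) (rot a b t x))" by (simp add: fun_eq_iff gR_def PR_def)
    have eq': "(\<lambda>x. (P - PR) (rot a b (- t) x)) = (\<lambda>x. P (rot a b (- t) x)) - P"
      by (simp add: fun_eq_iff PR_def rot_inverse[OF ab])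
    have "sip (gR - PR) (P - PR) = sip (g - P) (\<lambda>x. (P - PR) (rot a b (- t) x))"
      unfolding eq using sip_rot[OF cgP cq ab, of "- t"] by (simp only: minus_minus)
    also have "\<dots> = sip (g - P) (\<lambda>x. P (rot a b (- t) x)) - sip (g - P) P"
      unfolding eq' by (rule sip_diff_right[OF continuous_on_compose_rot[OF cP ab] cP cgP])
    also have "\<dots> = 0" using orth_rot[of "- t"] orth_rot[of 0] by simp
    finally show ?thesis .
  qed
  have "sip ((g - gR) - (P - PR)) (P - PR) = sip ((g - P) - (gR - PR)) (P - PR)"
    by (rule sip_cong) (simp_all)
  also have "\<dots> = 0"
    using 1 2 sip_diff_left[OF cgP _ cq, of "gR - PR"] by (simp add: continuous_intros cgR cPR)
  finally have "sip (P - PR) (P - PR) \<le> sip (g - gR) (g - gR)"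
    by (rule sip_orthogonal_le[OF ch cq])
  moreover have "sip (P - PR) (P - PR) = - sip P (second_diff P a b t)"
  proof -
    have "sip PR PR = sip P P"
      unfolding PR_def by (rule sip_orthogonal[OF orthogonal_rot[OF ab] cP cP])
    moreover have "sip P (\<lambda>x. P (rot a b (- t) x)) = sip P PR"
      using sip_rot[OF cP cP ab, of "- t"] by (simp add: PR_def sip_commute)
    ultimately show ?thesis
      unfolding sip_second_diff[OF cP cP ab]
      by (simp add: sip_diff_left[OF cP cPR cq] sip_diff_right[OF cP cPR cP] sip_diff_right[OF cP cPR cPR]
          sip_commute[of PR P] PR_def[symmetric])
  qed
  ultimately show ?thesis by (simp add: gR_def)
qed

lemma sip_second_diff_sum:
  fixes p :: "nat \<Rightarrow> 'a::euclidean_space \<Rightarrow> real"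
  assumes ab: "a \<in> Basis" "b \<in> Basis" and u: "cont_sph u"
    and p: "\<And>j. cont_sph (p j)"
  shows "sip u (second_diff (\<Sum>j\<le>n. p j) a b t) = (\<Sum>j\<le>n. sip u (second_diff (p j) a b t))"
proof -
  have "second_diff (\<Sum>j\<le>n. p j) a b t = (\<Sum>j\<le>n. second_diff (p j) a b t)"
    by (simp add: fun_eq_iff second_diff_def sum.distrib sum_subtractf sum_distrib_left)
  then show ?thesis
    using sip_sum_right[OF u, of "{..n}" "\<lambda>j. second_diff (p j) a b t"]
      continuous_on_second_diff[OF p ab] by simp
qed

text \<open>Dividing both energy bounds by \<open>t\<^sup>2\<close>, summing over the pairs of axes and letting \<open>t\<close> tend to \<open>0\<close>: the energy of
the low frequency part of \<open>g\<close> is at most \<open>\<mu>\<close> times the square norm of \<open>g\<close>.\<close>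

lemma spectral_energy_bound:
  fixes f c :: "'a::euclidean_space \<Rightarrow> real" and p :: "nat \<Rightarrow> 'a \<Rightarrow> real" and n :: nat
  assumes d: "DIM('a) \<ge> 2" and f: "f \<in> eigenspace \<mu>"
    and const: "\<And>x y. connected_component (nonzero_set f) x y \<Longrightarrow> c x = c y"
    and C: "\<And>x. \<bar>c x\<bar> \<le> C"
  defines "g \<equiv> \<lambda>x. c x * f x"
  assumes p: "\<And>j. p j \<in> harmonics j" and orth: "\<And>j v. v \<in> harmonics j \<Longrightarrow> sip (g - p j) v = 0"
  shows "(\<Sum>j\<le>n. eigval TYPE('a) j * sip (p j) (p j)) \<le> \<mu> * sip g g"
proof -
  let ?\<mu> = "eigval TYPE('a)"
  define P where "P = (\<Sum>j\<le>n. p j)"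
  define w where "w = (\<lambda>x. (c x)\<^sup>2 * f x)"
  have fs: "sphere_smooth f" by (rule eigenspaceD(2)[OF f])
  have cf: "cont_sph f" by (rule eigenspaceD(4)[OF f])
  have cg: "cont_sph g"
    unfolding g_def by (rule continuous_on_piecewise_multiple[OF cf const C])
  have cw: "cont_sph w"
    unfolding w_def by (rule continuous_on_piecewise_square_multiple[OF cf const C])
  have cp: "cont_sph (p j)" for j by (rule harmonics_continuous[OF p])
  have cP: "cont_sph P" unfolding P_def by (intro continuous_on_fun_sum cp)
  have "\<exists>\<epsilon>. \<epsilon> \<longlonglongrightarrow> 0 \<and> (\<forall>k.
      rot_energy g a b (step k) / (step k)\<^sup>2
        \<le> - sip w (second_diff f a b (step k)) / (step k)\<^sup>2 + \<epsilon> k)"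
    if ab: "a \<in> Basis" "b \<in> Basis" for a b
    unfolding g_def w_def
    by (rule rotation_energy_upper_bound[where f=f and c=c and C=C, OF ab fs const C]) blast+
  then obtain \<epsilon> where \<epsilon>: "\<And>a b. a \<in> Basis \<Longrightarrow> b \<in> Basis \<Longrightarrow> \<epsilon> a b \<longlonglongrightarrow> 0"
    and ub: "\<And>a b k. a \<in> Basis \<Longrightarrow> b \<in> Basis \<Longrightarrow>
      rot_energy g a b (step k) / (step k)\<^sup>2
        \<le> - sip w (second_diff f a b (step k)) / (step k)\<^sup>2 + \<epsilon> a b k"
    by metis
  have le: "- (\<Sum>a\<in>Basis. \<Sum>b\<in>Basis. sip P (second_diff P a b (step k)) / (step k)\<^sup>2)
      \<le> - (\<Sum>a\<in>Basis. \<Sum>b\<in>Basis. sip w (second_diff f a b (step k)) / (step k)\<^sup>2)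
        + (\<Sum>a\<in>Basis. \<Sum>b\<in>Basis. \<epsilon> a b k)" for k
  proof -
    have "(\<Sum>a\<in>Basis. \<Sum>b\<in>Basis. - sip P (second_diff P a b (step k)) / (step k)\<^sup>2)
      \<le> (\<Sum>a\<in>Basis. \<Sum>b\<in>Basis. - sip w (second_diff f a b (step k)) / (step k)\<^sup>2 + \<epsilon> a b k)"
    proof (intro sum_mono)
      fix a b :: 'a assume ab: "a \<in> Basis" "b \<in> Basis"
      have "- sip P (second_diff P a b (step k)) / (step k)\<^sup>2
          \<le> rot_energy g a b (step k) / (step k)\<^sup>2"
        unfolding P_def
        by (intro divide_right_mono rotation_energy_lower_bound[OF d ab cg p orth]) auto
      also note ub[OF ab]
      finally show "- sip P (second_diff P a b (step k)) / (step k)\<^sup>2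
          \<le> - sip w (second_diff f a b (step k)) / (step k)\<^sup>2 + \<epsilon> a b k" .
    qed
    then show ?thesis by (simp add: sum.distrib sum_negf sum_subtractf)
  qed
  have sPj: "sip P (p j) = sip (p j) (p j)" if "j \<le> n" for j
    using sip_sum_of_projections[OF d p p that] by (simp add: P_def sip_commute)
  have lim1: "(\<lambda>k. - (\<Sum>a\<in>Basis. \<Sum>b\<in>Basis. sip P (second_diff P a b (step k)) / (step k)\<^sup>2))
      \<longlonglongrightarrow> - (\<Sum>j\<le>n. - 2 * ?\<mu> j * sip P (p j))"
  proof -
    have "(\<Sum>a\<in>Basis. \<Sum>b\<in>Basis. sip P (second_diff P a b (step k)) / (step k)\<^sup>2)
        = (\<Sum>j\<le>n. \<Sum>a\<in>Basis. \<Sum>b\<in>Basis. sip P (second_diff (p j) a b (step k)) / (step k)\<^sup>2)" for k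
    proof -
      have "(\<Sum>a\<in>Basis. \<Sum>b\<in>Basis. sip P (second_diff P a b (step k)) / (step k)\<^sup>2)
        = (\<Sum>a\<in>Basis. \<Sum>b\<in>Basis. \<Sum>j\<le>n. sip P (second_diff (p j) a b (step k)) / (step k)\<^sup>2)"
        by (intro sum.cong refl)
           (simp add: P_def sip_second_diff_sum[OF _ _ cP[unfolded P_def] cp] sum_divide_distrib)
      also have "\<dots> = (\<Sum>a\<in>Basis. \<Sum>j\<le>n. \<Sum>b\<in>Basis. sip P (second_diff (p j) a b (step k)) / (step k)\<^sup>2)"
        by (rule sum.cong[OF refl]) (rule sum.swap)
      also have "\<dots> = (\<Sum>j\<le>n. \<Sum>a\<in>Basis. \<Sum>b\<in>Basis. sip P (second_diff (p j) a b (step k)) / (step k)\<^sup>2)"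
        by (rule sum.swap)
      finally show ?thesis .
    qed
    moreover have "(\<lambda>k. - (\<Sum>j\<le>n. \<Sum>a\<in>Basis. \<Sum>b\<in>Basis. sip P (second_diff (p j) a b (step k)) / (step k)\<^sup>2))
      \<longlonglongrightarrow> - (\<Sum>j\<le>n. - 2 * ?\<mu> j * sip P (p j))"
      using p by (intro tendsto_minus tendsto_sum sip_second_diff_eigenfunction cP) (auto simp: harmonics_def)
    ultimately show ?thesis by simp
  qed
  have lim2: "(\<lambda>k. - (\<Sum>a\<in>Basis. \<Sum>b\<in>Basis. sip w (second_diff f a b (step k)) / (step k)\<^sup>2)
        + (\<Sum>a\<in>Basis. \<Sum>b\<in>Basis. \<epsilon> a b k)) \<longlonglongrightarrow> - (- 2 * \<mu> * sip w f) + (\<Sum>a\<in>(Basis::'a set). \<Sum>b\<in>(Basis::'a set). 0)"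
    by (intro tendsto_add tendsto_minus tendsto_sum \<epsilon> sip_second_diff_eigenfunction[OF f cw])
  have "- (\<Sum>j\<le>n. - 2 * ?\<mu> j * sip P (p j)) \<le> - (- 2 * \<mu> * sip w f) + (\<Sum>a\<in>(Basis::'a set). \<Sum>b\<in>(Basis::'a set). 0)"
    using le by (intro LIMSEQ_le[OF lim1 lim2]) blast
  also have "sip w f = sip g g"
    unfolding sip_def w_def g_def by (rule sph_integral_cong) (simp add: power2_eq_square)
  also have "- (\<Sum>j\<le>n. - 2 * ?\<mu> j * sip P (p j)) = 2 * (\<Sum>j\<le>n. ?\<mu> j * sip (p j) (p j))"
    by (simp add: sum_negf sum_distrib_left sPj mult.assoc)
  finally show ?thesis by simp
qed

text \<open>The orthogonal projection is at least as close to \<open>g\<close> in \<open>L\<^sup>2\<close> as the uniform approximation that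
comes from the Stone--Weierstrass theorem.\<close>

lemma projection_error_bound:
  fixes g :: "'a::euclidean_space \<Rightarrow> real" and p :: "nat \<Rightarrow> 'a \<Rightarrow> real"
  assumes d: "DIM('a) \<ge> 2" and g: "cont_sph g"
    and p: "\<And>j. p j \<in> harmonics j" and orth: "\<And>j v. v \<in> harmonics j \<Longrightarrow> sip (g - p j) v = 0"
    and "\<delta> > 0"
  shows "\<exists>n\<ge>m. sip g g - (\<Sum>j\<le>n. sip (p j) (p j)) \<le> \<delta>\<^sup>2 * sph_integral (\<lambda>x::'a. 1)"
proof -
  obtain n h where h: "\<And>j. h j \<in> harmonics j" "\<And>x. norm x = 1 \<Longrightarrow> \<bar>g x - (\<Sum>j\<le>n. h j x)\<bar> < \<delta>"
    by (rule harmonics_approximation[OF d g \<open>\<delta> > 0\<close>]) (rule that)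
  define N where "N = max m n"
  define P where "P = (\<Sum>j\<le>N. p j)"
  define H where "H = (\<Sum>j\<le>n. h j)"
  have cp: "cont_sph (p j)" for j by (rule harmonics_continuous[OF p])
  have ch: "cont_sph (h j)" for j by (rule harmonics_continuous[OF h(1)])
  have cP: "cont_sph P" unfolding P_def by (intro continuous_on_fun_sum cp)
  have cH: "cont_sph H" unfolding H_def by (intro continuous_on_fun_sum ch)
  have cgP: "cont_sph (g - P)" by (intro continuous_intros g cP)
  have cgH: "cont_sph (g - H)" by (intro continuous_intros g cH)
  have sP: "sip v P = sip v (p i)" "sip v g = sip v (p i)" if v: "v \<in> harmonics i" and i: "i \<le> N" for i v
  proof -
    note cv = harmonics_continuous[OF v]
    show "sip v P = sip v (p i)"
      unfolding P_def by (rule sip_sum_of_projections[OF d p v i])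
    show "sip v g = sip v (p i)"
      using orth[OF v] sip_diff_left[OF g cp cv] by (simp add: sip_commute)
  qed
  have o: "sip (g - P) v = 0" if "v \<in> harmonics i" "i \<le> N" for i v
    using sP[OF that] sip_diff_left[OF g cP harmonics_continuous[OF that(1)]] by (simp add: sip_commute)
  have oP: "sip (g - P) P = 0"
    using sip_sum_right[OF cgP, of "{..N}" p] cp o[OF p] by (simp add: P_def[symmetric])
  have oH: "sip (g - P) H = 0"
    using sip_sum_right[OF cgP, of "{..n}" h] ch o[OF h(1)] by (simp add: H_def[symmetric] N_def)
  have "sip ((g - H) - (g - P)) (g - P) = sip (P - H) (g - P)"
    by (rule sip_cong) simp_all
  also have "\<dots> = 0"
    using oP oH sip_diff_left[OF cP cH cgP] by (simp add: sip_commute)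
  finally have "sip (g - P) (g - P) \<le> sip (g - H) (g - H)"
    by (rule sip_orthogonal_le[OF cgH cgP])
  also have "\<dots> \<le> sph_integral (\<lambda>x::'a. \<delta>\<^sup>2 * 1)"
    unfolding sip_def
  proof (rule sph_integral_mono)
    fix x :: 'a assume "x \<in> sphere 0 1"
    then have "\<bar>(g - H) x\<bar> \<le> \<delta>" using h(2)[of x] by (simp add: H_def)
    then have "\<bar>(g - H) x\<bar>\<^sup>2 \<le> \<delta>\<^sup>2" by (rule power_mono) simp
    then show "(g - H) x * (g - H) x \<le> \<delta>\<^sup>2 * 1" by (simp add: power2_eq_square)
  qed (intro continuous_intros cgH)+
  also have "\<dots> = \<delta>\<^sup>2 * sph_integral (\<lambda>x::'a. 1)" by (rule sph_integral_cmult)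
  also have "sip (g - P) (g - P) = sip g g - (\<Sum>j\<le>N. sip (p j) (p j))"
  proof -
    have "sip (g - P) (g - P) = sip (g - P) g"
      using oP sip_diff_right[OF g cP cgP] by simp
    also have "\<dots> = sip g g - sip g P"
      using sip_diff_left[OF g cP g] sip_commute[of P g] by simp
    also have "sip g P = (\<Sum>j\<le>N. sip g (p j))"
      unfolding P_def by (rule sip_sum_right[OF g cp])
    also have "\<dots> = (\<Sum>j\<le>N. sip (p j) (p j))"
      by (intro sum.cong refl) (use sP(2)[OF p] in \<open>simp add: sip_commute\<close>)
    finally show ?thesis .
  qed
  finally show ?thesis by (intro exI[of _ N]) (simp add: N_def)
qed

text \<open>Let \<open>A j\<close> be the square norm of the degree \<open>j\<close> component of \<open>g\<close>. The energy bound says \<open>\<Sum> \<mu>\<^sub>j A j \<le> \<mu>\<^sub>l \<Sum> A j\<close>,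
and only degrees \<open>j \<ge> l\<close> occur, so no degree \<open>j > l\<close> can contribute. Working with the partial sums up to \<open>n\<close>
costs an error \<open>\<mu>\<^sub>l \<delta>\<^sup>2\<close> times a constant, with \<open>\<delta>\<close> arbitrary.\<close>

lemma minimizer_is_eigenfunction:
  fixes f c :: "'a::euclidean_space \<Rightarrow> real"
  assumes d: "DIM('a) \<ge> 2" and f: "f \<in> harmonics l"
    and const: "\<And>x y. connected_component (nonzero_set f) x y \<Longrightarrow> c x = c y"
    and C: "\<And>x. \<bar>c x\<bar> \<le> C"
  defines "g \<equiv> \<lambda>x. c x * f x"
  assumes low: "\<And>j v. j < l \<Longrightarrow> v \<in> harmonics j \<Longrightarrow> sip g v = 0"
  obtains h where "h \<in> harmonics l" "\<And>x. norm x = 1 \<Longrightarrow> g x = h x"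
proof -
  let ?\<mu> = "eigval TYPE('a)"
  have fe: "f \<in> eigenspace (?\<mu> l)" using f by (simp add: harmonics_def)
  have cg: "cont_sph g"
    unfolding g_def by (rule continuous_on_piecewise_multiple[OF harmonics_continuous[OF f] const C])
  obtain p where p: "\<And>j. p j \<in> harmonics j" and orth: "\<And>j v. v \<in> harmonics j \<Longrightarrow> sip (g - p j) v = 0"
    using harmonics_projection_exists[OF cg] by metis
  have cp: "cont_sph (p j)" for j by (rule harmonics_continuous[OF p])
  have gp: "sip g v = sip (p j) v" if "v \<in> harmonics j" for j v
    using orth[OF that] sip_diff_left[OF cg cp harmonics_continuous[OF that]] by simp
  define A where "A j = sip (p j) (p j)" for j
  have A0: "A j \<ge> 0" for j by (simp add: A_def sip_self_nonneg)
  have Alow: "A j = 0" if "j < l" for j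
    using low[OF that p] gp[OF p] by (simp add: A_def)
  have \<mu>mono: "?\<mu> i \<le> ?\<mu> j \<longleftrightarrow> i \<le> j" "?\<mu> i < ?\<mu> j \<longleftrightarrow> i < j" for i j
    using eigval_strict_mono[OF d] by (simp_all add: strict_mono_less_eq strict_mono_less)
  have \<mu>0: "?\<mu> l \<ge> 0" using \<mu>mono(1)[of 0 l] by (simp add: eigval_def)
  define M where "M = sph_integral (\<lambda>x::'a. 1)"
  have M0: "M \<ge> 0" unfolding M_def sph_integral_def by (rule Bochner_Integration.integral_nonneg) simp
  have Ahigh: "A i = 0" if i: "l < i" for i
  proof -
    have key: "(?\<mu> i - ?\<mu> l) * A i \<le> ?\<mu> l * (\<delta>\<^sup>2 * M)" if "\<delta> > 0" for \<delta>
    proof -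
      obtain n where n: "n \<ge> i" "sip g g - (\<Sum>j\<le>n. A j) \<le> \<delta>\<^sup>2 * M"
        using projection_error_bound[OF d cg p orth \<open>\<delta> > 0\<close>, of i] by (auto simp: A_def M_def)
      have "(?\<mu> i - ?\<mu> l) * A i \<le> (\<Sum>j\<le>n. (?\<mu> j - ?\<mu> l) * A j)"
      proof (rule member_le_sum)
        show "0 \<le> (?\<mu> j - ?\<mu> l) * A j" for j
        proof (cases "j < l")
          case False
          then show ?thesis using A0[of j] \<mu>mono(1)[of l j] by (intro mult_nonneg_nonneg) auto
        qed (simp add: Alow)
      qed (use n in auto)
      also have "\<dots> = (\<Sum>j\<le>n. ?\<mu> j * A j) - ?\<mu> l * (\<Sum>j\<le>n. A j)"
        by (simp add: left_diff_distrib sum_subtractf sum_distrib_left)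
      also have "(\<Sum>j\<le>n. ?\<mu> j * A j) \<le> ?\<mu> l * sip g g"
        unfolding A_def g_def
        by (rule spectral_energy_bound[OF d fe const C p orth[unfolded g_def]])
      finally have "(?\<mu> i - ?\<mu> l) * A i \<le> ?\<mu> l * (sip g g - (\<Sum>j\<le>n. A j))"
        by (simp add: right_diff_distrib)
      also have "\<dots> \<le> ?\<mu> l * (\<delta>\<^sup>2 * M)" using n(2) \<mu>0 by (rule mult_left_mono)
      finally show ?thesis .
    qed
    have "(?\<mu> i - ?\<mu> l) * A i \<le> 0"
    proof (rule field_le_epsilon)
      fix e :: real assume e: "e > 0"
      \<comment> \<open>the \<open>1\<close> keeps the denominator positive when \<open>\<mu>\<^sub>l\<close> is zero\<close>
      define \<delta> where "\<delta> = sqrt (e / (?\<mu> l * M + 1))"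
      have pos: "?\<mu> l * M + 1 > 0" using \<mu>0 M0 by (simp add: add_nonneg_pos)
      then have "\<delta> > 0" "\<delta>\<^sup>2 = e / (?\<mu> l * M + 1)" using e by (simp_all add: \<delta>_def)
      then have "(?\<mu> i - ?\<mu> l) * A i \<le> ?\<mu> l * (e / (?\<mu> l * M + 1) * M)" using key by metis
      also have "\<dots> = e * ((?\<mu> l * M) / (?\<mu> l * M + 1))" by simp
      also have "\<dots> \<le> e * 1" using e pos by (intro mult_left_mono) (auto simp: divide_le_eq)
      finally show "(?\<mu> i - ?\<mu> l) * A i \<le> 0 + e" by simp
    qed
    moreover have "?\<mu> i - ?\<mu> l > 0" using \<mu>mono(2)[of l i] i by simp
    ultimately have "A i \<le> 0" by (simp add: mult_le_0_iff)
    then show ?thesis using A0[of i] by simp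
  qed
  have "(g - p l) x = 0" if x: "norm x = 1" for x
  proof (rule harmonics_complete[OF d _ _ x])
    show "cont_sph (g - p l)" by (intro continuous_intros cg cp)
    fix j and v :: "'a \<Rightarrow> real" assume v: "v \<in> harmonics j"
    show "sip (g - p l) v = 0"
    proof (cases "j = l")
      case True
      then show ?thesis using orth v by simp
    next
      case False
      then have "A j = 0" using Alow Ahigh by (meson linorder_neqE_nat)
      then have "sip (p j) v = sip 0 v"
        using sip_self_eq_0[OF cp] by (intro sip_cong) (auto simp: A_def)
      moreover have "sip (p l) v = 0" using harmonics_orthogonal[OF d p v] False by simp
      ultimately show ?thesis
        using gp[OF v] sip_diff_left[OF cg cp harmonics_continuous[OF v]] by simp
    qed
  qed
  then show ?thesis using that[OF p[of l]] by simp
qed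

section \<open>Bounding the number of nodal domains\<close>

text \<open>Gaussian elimination of one equation at a time.\<close>

lemma underdetermined_system:
  fixes M :: "'i \<Rightarrow> 'b \<Rightarrow> real"
  assumes "finite B" "finite I" "card B < card I"
  shows "\<exists>\<gamma>. (\<exists>i\<in>I. \<gamma> i \<noteq> 0) \<and> (\<forall>b\<in>B. (\<Sum>i\<in>I. \<gamma> i * M i b) = 0)"
  using assms
proof (induction B arbitrary: I M rule: finite_induct)
  case empty
  then obtain i where "i \<in> I" by fastforce
  then show ?case by (intro exI[of _ "\<lambda>_. 1"]) auto
next
  case (insert b B)
  show ?case
  proof (cases "\<forall>i\<in>I. M i b = 0")
    case True
    have "card B < card I" using insert by simp
    from insert.IH[OF insert.prems(1) this, of M] True show ?thesis by auto
  next
    case False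
    then obtain k where k: "k \<in> I" "M k b \<noteq> 0" by blast
    \<comment> \<open>eliminate the unknown of index \<open>k\<close> by means of the equation \<open>b\<close>\<close>
    define M' where "M' i b' = M i b' - M i b / M k b * M k b'" for i b'
    have "card B < card (I - {k})" using insert k by simp
    from insert.IH[OF _ this, of M'] insert.prems(1)
    obtain \<gamma> where \<gamma>: "\<exists>i\<in>I - {k}. \<gamma> i \<noteq> 0" "\<And>b'. b' \<in> B \<Longrightarrow> (\<Sum>i\<in>I - {k}. \<gamma> i * M' i b') = 0"
      by auto
    define s where "s = - (\<Sum>i\<in>I - {k}. \<gamma> i * (M i b / M k b))"
    define \<gamma>' where "\<gamma>' = \<gamma>(k := s)"
    have sum: "(\<Sum>i\<in>I. \<gamma>' i * M i b') = s * M k b' + (\<Sum>i\<in>I - {k}. \<gamma> i * M i b')" for b'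
    proof -
      have "(\<Sum>i\<in>I. \<gamma>' i * M i b') = \<gamma>' k * M k b' + (\<Sum>i\<in>I - {k}. \<gamma>' i * M i b')"
        using insert.prems(1) k(1) by (rule sum.remove)
      also have "(\<Sum>i\<in>I - {k}. \<gamma>' i * M i b') = (\<Sum>i\<in>I - {k}. \<gamma> i * M i b')"
        by (intro sum.cong) (auto simp: \<gamma>'_def)
      finally show ?thesis by (simp add: \<gamma>'_def)
    qed
    have rel: "(\<Sum>i\<in>I. \<gamma>' i * M i b') = (\<Sum>i\<in>I - {k}. \<gamma> i * M' i b')" for b'
      unfolding sum s_def M'_def
      by (simp add: right_diff_distrib sum_subtractf sum_distrib_right mult.assoc)
    have "M' i b = 0" for i using k(2) by (simp add: M'_def)
    then have "(\<Sum>i\<in>I. \<gamma>' i * M i b) = 0" by (simp add: rel)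
    moreover have "\<exists>i\<in>I. \<gamma>' i \<noteq> 0" using \<gamma>(1) by (auto simp: \<gamma>'_def)
    ultimately show ?thesis using \<gamma>(2) rel by (intro exI[of _ \<gamma>']) auto
  qed
qed

lemma orthogonal_transformation_uminus: "orthogonal_transformation (uminus :: 'a::real_inner \<Rightarrow> 'a)"
  by (simp add: orthogonal_transformation_def linear_iff)

lemma harmonics_minus: "v \<in> harmonics j \<Longrightarrow> v (- x) = (- 1) ^ j * v x"
  by (auto simp: harmonics_def on_sphere_def hpoly_minus)

lemma sip_opposite_parity:
  fixes u v :: "'a::euclidean_space \<Rightarrow> real"
  assumes u: "cont_sph u" "\<And>x. norm x = 1 \<Longrightarrow> u (- x) = (- 1) ^ l * u x"
    and v: "cont_sph v" "\<And>x. norm x = 1 \<Longrightarrow> v (- x) = (- 1) ^ j * v x"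
    and "odd (l + j)"
  shows "sip u v = 0"
proof -
  have "(- 1 :: real) ^ l * (- 1) ^ j = - 1" using \<open>odd (l + j)\<close> by (simp flip: power_add)
  then have *: "((- 1) ^ l * a) * ((- 1) ^ j * b) = - (a * b)" for a b :: real
    by (metis mult.assoc mult.left_commute mult_minus1)
  have "sip u v = sip (\<lambda>x. u (- x)) (\<lambda>x. v (- x))"
    by (rule sip_orthogonal[OF orthogonal_transformation_uminus u(1) v(1), symmetric])
  also have "\<dots> = sph_integral (\<lambda>x. - 1 * (u x * v x))"
    unfolding sip_def by (rule sph_integral_cong) (simp only: u(2) v(2) mem_sphere_0 * mult_minus1)
  also have "\<dots> = - sip u v" 
    unfolding sip_def using sph_integral_cmult[of "- 1" "\<lambda>x. u x * v x"] by simp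
  finally show ?thesis by simp
qed

lemma connected_component_uminus:
  fixes N :: "'a::euclidean_space set"
  assumes N: "\<And>x. x \<in> N \<Longrightarrow> - x \<in> N" and "connected_component N x y"
  shows "connected_component N (- x) (- y)"
proof -
  obtain T where T: "connected T" "T \<subseteq> N" "x \<in> T" "y \<in> T"
    using assms(2) by (auto simp: connected_component_def)
  have "connected (uminus ` T)" using T(1) by (intro connected_continuous_image continuous_intros)
  then show ?thesis
    unfolding connected_component_def using T N by (intro exI[of _ "uminus ` T"]) auto
qed

text \<open>Courant's argument for the functions with the parity of \<open>l\<close>. Here \<open>B\<close> spans the restrictions of the
homogeneous polynomials of degree \<open>l - 2\<close>, which contain all harmonics of degree less than \<open>l\<close> and of the same
parity; harmonics of the other parity are orthogonal for free, since \<open>c\<close> takes the same value at antipodal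
points. One of the antipodal groups is kept out of the linear system in order to have an open set on which
\<open>g\<close> vanishes.\<close>

lemma nodal_domains_le:
  fixes f :: "'a::euclidean_space \<Rightarrow> real" and B :: "('a \<Rightarrow> real) set"
  assumes d: "DIM('a) \<ge> 2" and f: "f \<in> harmonics l" and fin: "finite (nodal_domains f)"
    and B: "finite B" and spanB: "2 \<le> l \<Longrightarrow> span B = spoly (l - 2)"
  shows "card (nodal_domains f) \<le> 2 * card B + 2"
proof (rule ccontr)
  assume contr: "\<not> ?thesis"
  define N where "N = nonzero_set f"
  define comp where "comp x = connected_component_set N x" for x
  define orb where "orb x = comp x \<union> comp (- x)" for x
  have cf: "cont_sph f" by (rule harmonics_continuous[OF f])
  have fm: "f (- x) = (- 1) ^ l * f x" for x by (rule harmonics_minus[OF f])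
  have Nm: "- x \<in> N" if "x \<in> N" for x using that by (simp add: N_def fm)
  have D: "nodal_domains f = comp ` N" by (simp add: nodal_domains_def N_def comp_def components_def)
  have comp_eq: "comp x = comp y" if "connected_component N x y" for x y
    unfolding comp_def using that connected_component_eq by fastforce
  have orb_eq: "orb x = orb y" if "connected_component N x y" for x y
    using comp_eq[OF that] comp_eq[OF connected_component_uminus[OF Nm that]] by (simp add: orb_def)
  have orb_minus: "orb (- x) = orb x" for x by (auto simp: orb_def)
  define Orb where "Orb = orb ` N"
  have finOrb: "finite Orb"
  proof (rule finite_subset)
    show "Orb \<subseteq> (\<lambda>(A, B). A \<union> B) ` (nodal_domains f \<times> nodal_domains f)"
      unfolding Orb_def orb_def D using Nm by (force intro: imageI)
  qed (use fin in simp)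
  \<comment> \<open>each antipodal group contains at most two nodal domains\<close>
  have "nodal_domains f \<subseteq> (\<Union>U\<in>Orb. {A \<in> nodal_domains f. A \<subseteq> U})"
    unfolding Orb_def D orb_def by auto
  then have "card (nodal_domains f) \<le> card (\<Union>U\<in>Orb. {A \<in> nodal_domains f. A \<subseteq> U})"
    using fin finOrb by (intro card_mono) auto
  also have "\<dots> \<le> (\<Sum>U\<in>Orb. card {A \<in> nodal_domains f. A \<subseteq> U})"
    by (rule card_UN_le[OF finOrb])
  also have "\<dots> \<le> (\<Sum>U\<in>Orb. 2)"
  proof (rule sum_mono)
    fix U assume "U \<in> Orb"
    then obtain x where x: "x \<in> N" "U = orb x" by (auto simp: Orb_def)
    have "{A \<in> nodal_domains f. A \<subseteq> U} \<subseteq> {comp x, comp (- x)}"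
    proof
      fix A assume "A \<in> {A \<in> nodal_domains f. A \<subseteq> U}"
      then obtain y where y: "y \<in> N" "A = comp y" "A \<subseteq> orb x" using x by (auto simp: D)
      then have "y \<in> comp x \<union> comp (- x)" by (auto simp: orb_def comp_def)
      then have "connected_component N x y \<or> connected_component N (- x) y" by (auto simp: comp_def)
      then show "A \<in> {comp x, comp (- x)}" using comp_eq y(2) by auto
    qed
    then have "card {A \<in> nodal_domains f. A \<subseteq> U} \<le> card {comp x, comp (- x)}"
      by (intro card_mono) auto
    also have "\<dots> \<le> 2" by (simp add: card_insert_if)
    finally show "card {A \<in> nodal_domains f. A \<subseteq> U} \<le> 2" .
  qed
  finally have cardOrb: "card Orb \<ge> card B + 2" using contr by simp
  then obtain U0 where U0: "U0 \<in> Orb" by fastforce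
  define I where "I = Orb - {U0}"
  have finI: "finite I" and cardI: "card B < card I" using finOrb U0 cardOrb by (simp_all add: I_def)
  define cU where "cU U x = (if x \<in> N \<and> orb x = U then 1 else 0 :: real)" for U x
  define fU where "fU U = (\<lambda>x. cU U x * f x)" for U
  obtain \<gamma> where \<gamma>: "\<exists>U\<in>I. \<gamma> U \<noteq> 0" "\<And>b. b \<in> B \<Longrightarrow> (\<Sum>U\<in>I. \<gamma> U * sip (fU U) b) = 0"
    using underdetermined_system[OF B finI cardI, of "\<lambda>U. sip (fU U)"] by blast
  \<comment> \<open>\<open>c\<close> is zero on \<open>U0\<close>, which is not in \<open>I\<close>\<close>
  define c where "c x = (if x \<in> N \<and> orb x \<in> I then \<gamma> (orb x) else 0)" for x
  define g where "g = (\<lambda>x. c x * f x)"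
  have inN: "x \<in> N \<and> y \<in> N" if "connected_component N x y" for x y
    using that connected_component_in by blast
  have const: "c x = c y" if "connected_component (nonzero_set f) x y" for x y
    using orb_eq[of x y] inN[of x y] that by (simp add: c_def N_def)
  have constU: "cU U x = cU U y" if "connected_component (nonzero_set f) x y" for U x y
    using orb_eq[of x y] inN[of x y] that by (simp add: cU_def N_def)
  define C where "C = (\<Sum>U\<in>I. \<bar>\<gamma> U\<bar>)"
  have C: "\<bar>c x\<bar> \<le> C" for x
    using finI by (auto simp: c_def C_def intro: member_le_sum sum_nonneg)
  have cg: "cont_sph g"
    unfolding g_def by (rule continuous_on_piecewise_multiple[OF cf const C])
  have cfU: "cont_sph (fU U)" for U
    unfolding fU_def
    by (rule continuous_on_piecewise_multiple[where c="cU U" and C=1 for U, OF cf constU]) (simp_all add: cU_def)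
  have g_sum: "g = (\<Sum>U\<in>I. \<gamma> U *\<^sub>R fU U)"
  proof
    fix x
    have "(\<Sum>U\<in>I. \<gamma> U * cU U x) = c x"
    proof (cases "x \<in> N \<and> orb x \<in> I")
      case True
      have "(\<Sum>U\<in>I. \<gamma> U * cU U x) = (\<Sum>U\<in>{orb x}. \<gamma> U * cU U x)"
        by (rule sum.mono_neutral_right) (use True finI in \<open>auto simp: cU_def\<close>)
      then show ?thesis using True by (simp add: cU_def c_def)
    next
      case False
      then show ?thesis by (auto simp: cU_def c_def intro!: sum.neutral)
    qed
    then have "g x = (\<Sum>U\<in>I. \<gamma> U * cU U x) * f x" by (simp add: g_def)
    then show "g x = (\<Sum>U\<in>I. \<gamma> U *\<^sub>R fU U) x"
      by (simp add: fU_def scaleR_fun_def sum_distrib_right mult.assoc)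
  qed
  have gB: "sip g b = 0" if b: "b \<in> B" and cb: "cont_sph b" for b
  proof -
    have "sip b g = (\<Sum>U\<in>I. sip b (\<gamma> U *\<^sub>R fU U))"
      unfolding g_sum by (rule sip_sum_right[OF cb]) (intro continuous_intros cfU)
    also have "\<dots> = (\<Sum>U\<in>I. \<gamma> U * sip (fU U) b)"
      by (simp add: sip_scale_right sip_commute)
    finally show ?thesis using \<gamma>(2)[OF b] by (simp add: sip_commute)
  qed
  have gm: "g (- x) = (- 1) ^ l * g x" if "norm x = 1" for x
    using Nm[of x] Nm[of "- x"] by (auto simp: g_def c_def orb_minus fm)
  have low: "sip g v = 0" if j: "j < l" and v: "v \<in> harmonics j" for j v
  proof (cases "odd (l + j)")
    case True
    show ?thesis
      by (rule sip_opposite_parity[OF cg gm harmonics_continuous[OF v] harmonics_minus[OF v] True])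
  next
    case False
    \<comment> \<open>\<open>j\<close> has the parity of \<open>l\<close> and is smaller, so it is at most \<open>l - 2\<close>\<close>
    then have l: "2 \<le> l" "j \<le> l - 2" "even (l - 2 - j)" using j by (presburger)+
    have "v \<in> spoly (l - 2)"
      using v subsetD[OF restrict_hpoly_mono_parity[OF l(2,3)]] by (auto simp: harmonics_def)
    then have vB: "v \<in> span B" by (simp add: spanB[OF l(1)])
    have cB: "cont_sph b" if "b \<in> span B" for b
      using that spanB[OF l(1)] sphere_smooth_continuous_on[OF sphere_smooth_restrict_hpoly] by auto
    from vB have "cont_sph v \<and> sip g v = 0"
    proof (induction rule: span_induct_alt)
      case base
      then show ?case by (simp add: zero_fun_def)
    next
      case (step k b v)
      then have cb: "cont_sph b" using cB span_base by blast
      then have ckb: "cont_sph (k *\<^sub>R b)" by (intro continuous_intros)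
      have cv: "cont_sph v" using step by simp
      have "sip g (k *\<^sub>R b + v) = sip g (k *\<^sub>R b) + sip g v" by (rule sip_add_right[OF ckb cv cg])
      also have "\<dots> = 0" using gB[OF step(1) cb] step(2) by (simp only: sip_scale_right)
      finally show ?case using continuous_on_fun_ops(1)[OF ckb cv] by (rule conjI[rotated])
    qed
    then show ?thesis ..
  qed
  obtain h where h: "h \<in> harmonics l" "\<And>x. norm x = 1 \<Longrightarrow> g x = h x"
  proof (rule minimizer_is_eigenfunction[where c=c and C=C, OF d f const C])
    show "sip (\<lambda>x. c x * f x) v = 0" if "j < l" "v \<in> harmonics j" for j v
      using low[OF that] by (simp only: g_def)
  qed (simp_all add: g_def)
  obtain q where q: "q \<in> hpoly l" "h = on_sphere q" using h(1) by (auto simp: harmonics_def)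
  obtain x0 where x0: "x0 \<in> N" "U0 = orb x0" using U0 by (auto simp: Orb_def)
  have "openin (top_of_set (sphere 0 1)) (comp x0)"
    unfolding comp_def N_def by (rule openin_nodal_component[OF cf])
  then obtain T where T: "open T" "comp x0 = sphere 0 1 \<inter> T" by (auto simp: openin_open)
  have g0: "g x = 0" if "x \<in> comp x0" for x
  proof -
    have "orb x = U0" using orb_eq[of x0 x] that x0 by (simp add: comp_def)
    then show ?thesis by (simp add: g_def c_def I_def)
  qed
  have "q = (\<lambda>x. 0)"
  proof (rule hpoly_zero_on_open[OF q(1)])
    have "continuous_on (- {0}) (\<lambda>x::'a. x /\<^sub>R norm x)" by (intro continuous_intros) auto
    then show "open (- {0} \<inter> (\<lambda>x. x /\<^sub>R norm x) -` T)"
      by (rule continuous_open_preimage) (use T in \<open>auto simp: open_Compl\<close>)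
    have "x0 \<in> comp x0" using x0 by (simp add: comp_def)
    then have "x0 \<in> - {0} \<inter> (\<lambda>x. x /\<^sub>R norm x) -` T" using T by auto
    then show "- {0} \<inter> (\<lambda>x. x /\<^sub>R norm x) -` T \<noteq> {}" by blast
    fix x assume x: "x \<in> - {0} \<inter> (\<lambda>x. x /\<^sub>R norm x) -` T"
    then have nx: "norm (x /\<^sub>R norm x) = 1" by simp
    have "x /\<^sub>R norm x \<in> comp x0" using x nx T(2) by auto
    then have "q (x /\<^sub>R norm x) = 0" using g0 h(2)[OF nx] nx by (simp only: q(2) on_sphere_on)
    then have "(inverse (norm x)) ^ l * q x = 0" using hpoly_scale[OF q(1), of "inverse (norm x)" x] by simp
    then show "q x = 0" using x by simp
  qed
  then have gz: "g x = 0" if "norm x = 1" for x using h(2)[OF that] that by (simp add: q(2))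
  obtain U where U: "U \<in> I" "\<gamma> U \<noteq> 0" using \<gamma>(1) by blast
  then obtain x where x: "x \<in> N" "U = orb x" by (auto simp: I_def Orb_def)
  have "g x = \<gamma> U * f x" using x U by (simp add: g_def c_def)
  moreover have "f x \<noteq> 0" "norm x = 1" using x(1) by (simp_all add: N_def)
  ultimately show False using gz U(2) by simp
qed

section \<open>Counting eigenvalues\<close>

abbreviation harmonics_dim :: "'a::euclidean_space itself \<Rightarrow> nat \<Rightarrow> nat"
  where "harmonics_dim T m \<equiv> dim (harmonics m :: ('a \<Rightarrow> real) set)"

abbreviation spoly_dim :: "'a::euclidean_space itself \<Rightarrow> nat \<Rightarrow> nat"
  where "spoly_dim T m \<equiv> dim (spoly m :: ('a \<Rightarrow> real) set)"

lemma eigenspace_eq_harmonics: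
  assumes d: "DIM('a::euclidean_space) \<ge> 2"
  shows "eigenspace (eigval TYPE('a) m) = (harmonics m :: ('a \<Rightarrow> real) set)"
proof
  show "eigenspace (eigval TYPE('a) m) \<subseteq> (harmonics m :: ('a \<Rightarrow> real) set)"
  proof
    fix f :: "'a \<Rightarrow> real" assume f: "f \<in> eigenspace (eigval TYPE('a) m)"
    show "f \<in> harmonics m"
    proof (cases "f = (\<lambda>x. 0)")
      case True
      then show ?thesis using subspace_0[OF subspace_harmonics[of m, where 'a='a]] by (simp add: zero_fun_def)
    next
      case False
      then have "eigenfunction (eigval TYPE('a) m) f" using f by (simp add: eigenfunction_def)
      then obtain k where "eigval TYPE('a) m = eigval TYPE('a) k" "f \<in> harmonics k"
        by (rule eigenfunction_in_harmonics[OF d])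
      then show ?thesis using eigval_strict_mono[OF d] by (simp add: strict_mono_eq)
    qed
  qed
qed (auto simp: harmonics_def)

lemma harmonics_basis:
  obtains B :: "('a::euclidean_space \<Rightarrow> real) set"
  where "finite B" "B \<subseteq> harmonics m" "independent B" "span B = harmonics m" "card B = harmonics_dim TYPE('a) m"
proof (rule finite_basis_exists[OF subspace_harmonics])
  show "finite (on_sphere ` monomials m :: ('a \<Rightarrow> real) set)" by (simp add: finite_monomials)
  show "harmonics m \<subseteq> span (on_sphere ` monomials m :: ('a \<Rightarrow> real) set)"
    using restrict_hpoly_subset_span by (auto simp: harmonics_def)
qed (rule that)

lemma restrict_hpoly_basis:
  obtains B :: "('a::euclidean_space \<Rightarrow> real) set"
  where "finite B" "B \<subseteq> spoly m" "independent B" "span B = spoly m"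
    "card B = spoly_dim TYPE('a) m"
proof (rule finite_basis_exists[OF subspace_restrict_hpoly])
  show "finite (on_sphere ` monomials m :: ('a \<Rightarrow> real) set)" by (simp add: finite_monomials)
qed (rule restrict_hpoly_subset_span, rule that)

lemma independent_card_le_sum_dim:
  fixes X :: "('a::euclidean_space \<Rightarrow> real) set"
  assumes "finite J" "independent X" "X \<subseteq> span (\<Union>j\<in>J. harmonics j)"
  shows "card X \<le> (\<Sum>j\<in>J. harmonics_dim TYPE('a) j)"
proof -
  have "\<exists>B :: ('a \<Rightarrow> real) set. finite B \<and> span B = harmonics j \<and> card B = harmonics_dim TYPE('a) j" for j
  proof -
    obtain B :: "('a \<Rightarrow> real) set" where "finite B" "B \<subseteq> harmonics j" "independent B" "span B = harmonics j"
      "card B = harmonics_dim TYPE('a) j"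
      by (rule harmonics_basis)
    show ?thesis by (intro exI[of _ B] conjI) fact+
  qed
  then obtain B :: "nat \<Rightarrow> ('a \<Rightarrow> real) set" where B: "\<And>j. finite (B j)" "\<And>j. span (B j) = harmonics j"
    "\<And>j. card (B j) = harmonics_dim TYPE('a) j" by metis
  have "harmonics j \<subseteq> span (\<Union>j\<in>J. B j)" if "j \<in> J" for j
    using span_mono[of "B j" "\<Union>j\<in>J. B j"] that B(2) by auto
  then have "span (\<Union>j\<in>J. harmonics j) \<subseteq> span (\<Union>j\<in>J. B j)"
    by (intro span_minimal) auto
  then have "X \<subseteq> span (\<Union>j\<in>J. B j)" using assms(3) by blast
  moreover have "finite (\<Union>j\<in>J. B j)" using assms(1) B(1) by blast
  ultimately have "card X \<le> card (\<Union>j\<in>J. B j)"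
    using independent_span_bound[OF _ assms(2)] by blast
  also have "\<dots> \<le> (\<Sum>j\<in>J. card (B j))" by (rule card_UN_le[OF assms(1)])
  finally show ?thesis by (simp add: B(3))
qed

lemma restrict_hpoly_subset_span_harmonics:
  assumes d: "DIM('a::euclidean_space) \<ge> 2"
  shows "spoly m \<subseteq> span (\<Union>j\<in>{j. j \<le> m \<and> even (m + j)}. harmonics j :: ('a \<Rightarrow> real) set)"
proof
  fix f :: "'a \<Rightarrow> real" assume "f \<in> spoly m"
  then obtain p where p: "p \<in> hpoly m" "f = on_sphere p" by auto
  obtain e where e: "\<And>j. e j \<in> harmonics j" "\<And>j. odd (m + j) \<Longrightarrow> e j = 0"
    "on_sphere p = (\<lambda>x. \<Sum>j\<le>m. e j x)"
    using restrict_hpoly_decomposition[OF d p(1)] by blast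
  have "e j \<in> span (\<Union>j\<in>{j. j \<le> m \<and> even (m + j)}. harmonics j)" if "j \<le> m" for j
  proof (cases "odd (m + j)")
    case True
    show ?thesis unfolding e(2)[OF True] by (rule span_zero)
  next
    case False
    then show ?thesis using e(1)[of j] that by (intro span_base) auto
  qed
  then have "(\<Sum>j\<le>m. e j) \<in> span (\<Union>j\<in>{j. j \<le> m \<and> even (m + j)}. harmonics j)"
    by (intro span_sum) auto
  moreover have "(\<Sum>j\<le>m. e j) = f" by (simp add: fun_eq_iff p(2) e(3))
  ultimately show "f \<in> span (\<Union>j\<in>{j. j \<le> m \<and> even (m + j)}. harmonics j)" by simp
qed

text \<open>Multiplication by one coordinate embeds degree \<open>m\<close> into degree \<open>m + 1\<close>. The powers of two further
coordinates are new: at the corresponding basis vectors \<open>e2\<close> and \<open>e3\<close> all multiples of the first coordinate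
vanish. This is where three dimensions are needed.\<close>

lemma independent_in_spoly_Suc:
  assumes d: "DIM('a::euclidean_space) \<ge> 3"
  obtains Y :: "('a::euclidean_space \<Rightarrow> real) set" where "finite Y" "independent Y" "Y \<subseteq> spoly (Suc m)"
    "card Y = spoly_dim TYPE('a) m + 2"
proof -
  obtain E :: "'a set" where E: "E \<subseteq> Basis" "card E = 3"
    by (rule obtain_subset_with_card_n[OF d]) (rule that)
  then obtain e1 e2 e3 :: 'a where "E = {e1, e2, e3}" "e1 \<noteq> e2" "e2 \<noteq> e3" "e1 \<noteq> e3"
    unfolding card_3_iff by blast
  with E(1) have e: "e1 \<in> Basis" "e2 \<in> Basis" "e3 \<in> Basis" "e1 \<noteq> e2" "e1 \<noteq> e3" "e2 \<noteq> e3"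
    by auto
  obtain B :: "('a \<Rightarrow> real) set" where B: "finite B" "B \<subseteq> spoly m" "independent B"
    "span B = spoly m" "card B = spoly_dim TYPE('a) m"
    by (rule restrict_hpoly_basis)
  define T where "T w = (\<lambda>x. (x \<bullet> e1) * w x)" for w :: "'a \<Rightarrow> real"
  have linT: "linear T"
    by (rule linearI) (simp_all add: T_def fun_eq_iff scaleR_fun_def algebra_simps)
  have injT: "inj_on T (span B)"
  proof (rule inj_onI)
    fix u v assume uv: "u \<in> span B" "v \<in> span B" "T u = T v"
    have "u - v \<in> spoly m" using span_diff[OF uv(1,2)] B(4) by simp
    then obtain p where p: "p \<in> hpoly m" "u - v = on_sphere p" by auto
    have "p = (\<lambda>x. 0)"
    proof (rule hpoly_zero_on_open[OF p(1)])
      show "open {x. x \<bullet> e1 > 0}" by (intro open_Collect_less continuous_intros)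
      have "e1 \<in> {x. x \<bullet> e1 > 0}" using e by simp
      then show "{x. x \<bullet> e1 > 0} \<noteq> {}" by blast
      fix x assume x: "x \<in> {x. x \<bullet> e1 > 0}"
      then have x0: "x \<noteq> 0" by auto
      then have nx: "norm (x /\<^sub>R norm x) = 1" by simp
      have "((x /\<^sub>R norm x) \<bullet> e1) * (u - v) (x /\<^sub>R norm x) = 0"
        using fun_cong[OF uv(3), of "x /\<^sub>R norm x"] by (simp add: T_def right_diff_distrib)
      then have "p (x /\<^sub>R norm x) = 0"
        unfolding p(2) on_sphere_on[OF nx] using x x0 by simp
      then show "p x = 0" using hpoly_scale[OF p(1), of "inverse (norm x)" x] x0 by simp
    qed
    then have "(u - v) x = 0" for x unfolding p(2) by (simp add: on_sphere_def)
    then show "u = v" by (simp add: fun_eq_iff)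
  qed
  define y where "y e = on_sphere (\<lambda>x. (x \<bullet> e) ^ Suc m)" for e :: 'a
  have pw: "(\<lambda>x. (x \<bullet> e) ^ k) \<in> hpoly k" if "e \<in> Basis" for e :: 'a and k
  proof (induction k)
    case (Suc k)
    then show ?case using hpoly_coord_mult[OF that Suc] by simp
  qed (simp add: hpoly_one)
  have indT: "independent (T ` B)"
    by (rule linear_independent_injective_image[OF linT B(3) injT])
  have vanish: "v e' = 0" if "v \<in> span V" "\<And>w. w \<in> V \<Longrightarrow> w e' = 0" for V v and e' :: 'a
    using that(1)
  proof (induction rule: span_induct_alt)
    case (step c u v)
    then show ?case using that(2) by (simp add: scaleR_fun_def)
  qed simp
  have T0: "w e' = 0" if "w \<in> T ` B" "e' \<in> {e2, e3}" for w e'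
    using that e by (auto simp: T_def inner_Basis)
  have y2: "y e2 \<notin> span (T ` B)"
    using vanish[of "y e2" "T ` B" e2] T0 e by (auto simp: y_def inner_Basis)
  then have ind2: "independent (insert (y e2) (T ` B))"
    using indT by (simp add: independent_insert)
  have "w e3 = 0" if "w \<in> insert (y e2) (T ` B)" for w
    using that T0[of w e3] e by (auto simp: y_def inner_Basis)
  then have y3: "y e3 \<notin> span (insert (y e2) (T ` B))"
    using vanish[of "y e3" "insert (y e2) (T ` B)" e3] e by (auto simp: y_def inner_Basis)
  show ?thesis
  proof (rule that[of "insert (y e3) (insert (y e2) (T ` B))"])
    show "finite (insert (y e3) (insert (y e2) (T ` B)))" using B(1) by simp
    show "independent (insert (y e3) (insert (y e2) (T ` B)))"
      using ind2 y3 by (simp add: independent_insert)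
    have "T w \<in> spoly (Suc m)" if w: "w \<in> B" for w
    proof -
      obtain p where p: "p \<in> hpoly m" "w = on_sphere p" using w B(2) by auto
      show ?thesis
        by (rule image_eqI[OF _ hpoly_coord_mult[OF e(1) p(1)]])
           (simp add: T_def p(2) fun_eq_iff on_sphere_def)
    qed
    moreover have "y e' \<in> spoly (Suc m)" if "e' \<in> Basis" for e'
      unfolding y_def using pw[OF that] by (rule imageI)
    ultimately show "insert (y e3) (insert (y e2) (T ` B)) \<subseteq> spoly (Suc m)"
      using e by auto
    have "y e2 \<notin> T ` B" "y e3 \<notin> insert (y e2) (T ` B)"
      using y2 y3 by (meson span_base)+
    moreover have "card (T ` B) = card B"
      using inj_on_subset[OF injT span_superset] by (rule card_image)
    ultimately show "card (insert (y e3) (insert (y e2) (T ` B))) = spoly_dim TYPE('a) m + 2"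
      using B(1,5) by simp
  qed
qed

text \<open>The harmonics of degree at most \<open>m + 1\<close> split by parity. One parity class spans the restricted polynomials
of degree \<open>m\<close>, the other one those of degree \<open>m + 1\<close>, whose dimension is larger by at least two.\<close>

lemma sum_harmonics_dim_ge:
  assumes d: "DIM('a::euclidean_space) \<ge> 3"
  shows "2 * spoly_dim TYPE('a) m + 2
    \<le> (\<Sum>j<Suc (Suc m). harmonics_dim TYPE('a) j)"
proof -
  have d2: "DIM('a) \<ge> 2" using d by simp
  let ?J = "{j. j \<le> m \<and> even (m + j)}" and ?J' = "{j. j \<le> Suc m \<and> even (Suc m + j)}"
  let ?D = "\<lambda>j. harmonics_dim TYPE('a) j"
  obtain B :: "('a \<Rightarrow> real) set" where B: "finite B" "B \<subseteq> spoly m" "independent B"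
    "span B = spoly m" "card B = spoly_dim TYPE('a) m"
    by (rule restrict_hpoly_basis)
  obtain Y :: "('a \<Rightarrow> real) set" where Y: "finite Y" "independent Y" "Y \<subseteq> spoly (Suc m)"
    "card Y = spoly_dim TYPE('a) m + 2"
    by (rule independent_in_spoly_Suc[OF d])
  have "card B \<le> sum ?D ?J"
    using B(2,3) restrict_hpoly_subset_span_harmonics[OF d2] by (intro independent_card_le_sum_dim) auto
  moreover have "card Y \<le> sum ?D ?J'"
    by (intro independent_card_le_sum_dim Y(2) order_trans[OF Y(3)] restrict_hpoly_subset_span_harmonics[OF d2]) auto
  moreover have "sum ?D {..<Suc (Suc m)} = sum ?D ?J + sum ?D ?J'"
  proof -
    have "{..<Suc (Suc m)} = ?J \<union> ?J'" by (auto simp: less_Suc_eq_le le_Suc_eq)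
    moreover have "?J \<inter> ?J' = {}" by auto
    ultimately show ?thesis by (simp add: sum.union_disjoint)
  qed
  ultimately show ?thesis using B(5) Y(4) by linarith
qed

text \<open>This makes the total multiplicity of the eigenvalues unbounded, so that \<open>\<lambda>\<^sub>n\<close> exists for every \<open>n\<close>.\<close>

lemma spoly_dim_ge:
  assumes d: "DIM('a::euclidean_space) \<ge> 3"
  shows "m \<le> spoly_dim TYPE('a) m"
proof (induction m)
  case (Suc m)
  obtain Y :: "('a \<Rightarrow> real) set" where Y: "finite Y" "independent Y" "Y \<subseteq> spoly (Suc m)"
    "card Y = spoly_dim TYPE('a) m + 2"
    by (rule independent_in_spoly_Suc[OF d])
  obtain B :: "('a \<Rightarrow> real) set" where B: "finite B" "span B = spoly (Suc m)"
    "card B = spoly_dim TYPE('a) (Suc m)"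
    by (rule restrict_hpoly_basis)
  have "card Y \<le> card B" using independent_span_bound[OF B(1) Y(2)] Y(3) B(2) by blast
  then show ?case using Suc Y(4) B(3) by simp
qed simp

section \<open>The two Courant sharp cases\<close>

lemma eigenvalues_subset:
  assumes "DIM('a::euclidean_space) \<ge> 2"
  shows "eigenvalues TYPE('a) \<subseteq> range (eigval TYPE('a))"
proof
  fix \<mu> assume "\<mu> \<in> eigenvalues TYPE('a)"
  then obtain f :: "'a \<Rightarrow> real" where "eigenfunction \<mu> f" by (auto simp: eigenvalues_def)
  then obtain m where "\<mu> = eigval TYPE('a) m" "f \<in> harmonics m"
    by (rule eigenfunction_in_harmonics[OF assms])
  then show "\<mu> \<in> range (eigval TYPE('a))" by simp
qed

lemma harmonics_dim_eq_0_iff: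
  assumes d: "DIM('a::euclidean_space) \<ge> 2"
  shows "harmonics_dim TYPE('a) m = 0 \<longleftrightarrow> eigval TYPE('a) m \<notin> eigenvalues TYPE('a)"
proof -
  obtain B :: "('a \<Rightarrow> real) set" where B: "finite B" "B \<subseteq> harmonics m" "independent B" "span B = harmonics m"
    "card B = harmonics_dim TYPE('a) m"
    by (rule harmonics_basis)
  have "harmonics_dim TYPE('a) m = 0 \<longleftrightarrow> B = {}" using B(1,5) by (metis card_0_eq)
  also have "\<dots> \<longleftrightarrow> harmonics m \<subseteq> {0 :: 'a \<Rightarrow> real}"
  proof
    assume "B = {}"
    then show "harmonics m \<subseteq> {0 :: 'a \<Rightarrow> real}" using B(4) span_empty by simp
  next
    assume "harmonics m \<subseteq> {0 :: 'a \<Rightarrow> real}"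
    moreover have "0 \<notin> B" using B(3) dependent_zero by blast
    ultimately show "B = {}" using B(2) by blast
  qed
  also have "\<dots> \<longleftrightarrow> eigval TYPE('a) m \<notin> eigenvalues TYPE('a)"
    unfolding eigenvalues_def eigenfunction_def eigenspace_eq_harmonics[OF d] mem_Collect_eq zero_fun_def by blast
  finally show ?thesis .
qed

text \<open>Degrees whose harmonics are zero do not yield eigenvalues, but they add nothing to the sum over degrees.\<close>

lemma sum_multiplicities:
  assumes d: "DIM('a::euclidean_space) \<ge> 2"
  shows "(\<Sum>\<nu>\<in>{\<nu>\<in>eigenvalues TYPE('a). \<nu> < eigval TYPE('a) l}. multiplicity_of TYPE('a) \<nu>)
      = (\<Sum>j<l. harmonics_dim TYPE('a) j)"
    and "(\<Sum>\<nu>\<in>{\<nu>\<in>eigenvalues TYPE('a). \<nu> \<le> eigval TYPE('a) l}. multiplicity_of TYPE('a) \<nu>)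
      = (\<Sum>j<Suc l. harmonics_dim TYPE('a) j)"
proof -
  let ?\<mu> = "eigval TYPE('a)"
  have sm: "strict_mono ?\<mu>" by (rule eigval_strict_mono[OF d])
  have *: "(\<Sum>\<nu>\<in>{\<nu>\<in>eigenvalues TYPE('a). \<nu> \<in> ?\<mu> ` A}. multiplicity_of TYPE('a) \<nu>)
      = (\<Sum>j\<in>A. harmonics_dim TYPE('a) j)" if "finite A" for A
  proof -
    have "(\<Sum>\<nu>\<in>{\<nu>\<in>eigenvalues TYPE('a). \<nu> \<in> ?\<mu> ` A}. multiplicity_of TYPE('a) \<nu>)
        = (\<Sum>\<nu>\<in>?\<mu> ` {j\<in>A. ?\<mu> j \<in> eigenvalues TYPE('a)}. multiplicity_of TYPE('a) \<nu>)"
      by (rule sum.cong) auto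
    also have "\<dots> = (\<Sum>j\<in>{j\<in>A. ?\<mu> j \<in> eigenvalues TYPE('a)}. multiplicity_of TYPE('a) (?\<mu> j))"
      using sum.reindex[OF inj_on_subset[OF strict_mono_imp_inj_on[OF sm] subset_UNIV]] by (simp add: o_def)
    also have "\<dots> = (\<Sum>j\<in>{j\<in>A. ?\<mu> j \<in> eigenvalues TYPE('a)}. harmonics_dim TYPE('a) j)"
      by (simp add: multiplicity_of_def eigenspace_eq_harmonics[OF d])
    also have "\<dots> = (\<Sum>j\<in>A. harmonics_dim TYPE('a) j)"
      by (rule sum.mono_neutral_left) (use that harmonics_dim_eq_0_iff[OF d] in auto)
    finally show ?thesis .
  qed
  have 1: "{\<nu>\<in>eigenvalues TYPE('a). \<nu> < ?\<mu> l} = {\<nu>\<in>eigenvalues TYPE('a). \<nu> \<in> ?\<mu> ` {..<l}}"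
    using eigenvalues_subset[OF d] strict_mono_less[OF sm] by auto
  have 2: "{\<nu>\<in>eigenvalues TYPE('a). \<nu> \<le> ?\<mu> l} = {\<nu>\<in>eigenvalues TYPE('a). \<nu> \<in> ?\<mu> ` {..<Suc l}}"
    using eigenvalues_subset[OF d] strict_mono_less_eq[OF sm] by (auto simp: less_Suc_eq_le)
  show "(\<Sum>\<nu>\<in>{\<nu>\<in>eigenvalues TYPE('a). \<nu> < ?\<mu> l}. multiplicity_of TYPE('a) \<nu>)
      = (\<Sum>j<l. harmonics_dim TYPE('a) j)"
    unfolding 1 by (rule *) simp
  show "(\<Sum>\<nu>\<in>{\<nu>\<in>eigenvalues TYPE('a). \<nu> \<le> ?\<mu> l}. multiplicity_of TYPE('a) \<nu>)
      = (\<Sum>j<Suc l. harmonics_dim TYPE('a) j)"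
    unfolding 2 by (rule *) simp
qed

lemma nth_eigenvalue_eqI:
  assumes d: "DIM('a::euclidean_space) \<ge> 2"
    and lower: "(\<Sum>j<l. harmonics_dim TYPE('a) j) < n"
    and upper: "n \<le> (\<Sum>j<Suc l. harmonics_dim TYPE('a) j)"
  shows "nth_eigenvalue TYPE('a) n = eigval TYPE('a) l"
  unfolding nth_eigenvalue_def
proof (rule Least_equality)
  have "harmonics_dim TYPE('a) l \<noteq> 0" using lower upper by auto
  then show "eigval TYPE('a) l \<in> eigenvalues TYPE('a) \<and>
      n \<le> (\<Sum>\<nu>\<in>{\<nu>\<in>eigenvalues TYPE('a). \<nu> \<le> eigval TYPE('a) l}. multiplicity_of TYPE('a) \<nu>)"
    using upper harmonics_dim_eq_0_iff[OF d] by (simp only: sum_multiplicities[OF d]) blast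
  fix \<mu> assume \<mu>: "\<mu> \<in> eigenvalues TYPE('a) \<and>
      n \<le> (\<Sum>\<nu>\<in>{\<nu>\<in>eigenvalues TYPE('a). \<nu> \<le> \<mu>}. multiplicity_of TYPE('a) \<nu>)"
  then obtain m where m: "\<mu> = eigval TYPE('a) m"
    using eigenvalues_subset[OF d] by blast
  have "l \<le> m"
  proof (rule ccontr)
    assume "\<not> l \<le> m"
    then have "(\<Sum>j<Suc m. harmonics_dim TYPE('a) j) \<le> (\<Sum>j<l. harmonics_dim TYPE('a) j)"
      by (intro sum_mono2) auto
    moreover have "n \<le> (\<Sum>j<Suc m. harmonics_dim TYPE('a) j)"
      using \<mu> by (simp only: m sum_multiplicities[OF d])
    ultimately show False using lower by linarith
  qed
  then show "eigval TYPE('a) l \<le> \<mu>"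
    using strict_mono_less_eq[OF eigval_strict_mono[OF d]] by (simp add: m)
qed

lemma nth_eigenvalue_exists:
  assumes d: "DIM('a::euclidean_space) \<ge> 3" and n: "n \<ge> 1"
  obtains l where "nth_eigenvalue TYPE('a) n = eigval TYPE('a) l"
    "(\<Sum>j<l. harmonics_dim TYPE('a) j) < n"
proof -
  let ?S = "\<lambda>l. (\<Sum>j<l. harmonics_dim TYPE('a) j)"
  have "n \<le> ?S (Suc (Suc n))"
    using sum_harmonics_dim_ge[OF d, of n] spoly_dim_ge[OF d, of n] by linarith
  then have ex: "\<exists>l. n \<le> ?S (Suc l)" by blast
  define l where "l = (LEAST l. n \<le> ?S (Suc l))"
  have up: "n \<le> ?S (Suc l)" unfolding l_def by (rule LeastI_ex[OF ex])
  have low: "?S l < n"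
  proof (cases l)
    case 0
    then show ?thesis using n by simp
  next
    case (Suc k)
    then have "\<not> n \<le> ?S (Suc k)" using not_less_Least[of k "\<lambda>l. n \<le> ?S (Suc l)"] by (simp add: l_def)
    then show ?thesis by (simp add: Suc)
  qed
  have d2: "DIM('a) \<ge> 2" using d by simp
  show ?thesis by (rule that[OF nth_eigenvalue_eqI[OF d2 low up] low])
qed

lemma harmonics_eigenfunctionI:
  assumes "f \<in> harmonics m" "f x \<noteq> 0"
  shows "eigenfunction (eigval TYPE('a::euclidean_space) m) (f :: 'a \<Rightarrow> real)"
  using assms by (auto simp: eigenfunction_def harmonics_def)

lemma harmonics_dim_0:
  assumes d: "DIM('a::euclidean_space) \<ge> 2"
  shows "harmonics_dim TYPE('a) 0 = 1"
proof -
  obtain e :: 'a where e: "e \<in> Basis" using nonempty_Basis by blast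
  have "on_sphere (\<lambda>x::'a. 1) \<in> harmonics 0"
    by (rule restrict_hpoly_low_degree[OF hpoly_one]) simp
  then have "eigenfunction (eigval TYPE('a) 0) (on_sphere (\<lambda>x::'a. 1))"
    by (rule harmonics_eigenfunctionI[of _ _ e]) (use e in simp)
  then have "harmonics_dim TYPE('a) 0 \<noteq> 0"
    unfolding harmonics_dim_eq_0_iff[OF d] eigenvalues_def by blast
  moreover have "harmonics_dim TYPE('a) 0 \<le> card (on_sphere ` monomials 0 :: ('a \<Rightarrow> real) set)"
    using restrict_hpoly_subset_span[of 0] by (intro dim_le_card) (auto simp: harmonics_def)
  ultimately show ?thesis by simp
qed

lemma connected_open_hemisphere:
  fixes e :: "'a::euclidean_space"
  shows "connected (sphere 0 1 \<inter> {x. 0 < e \<bullet> x})"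
proof -
  have "connected ((\<lambda>x. x /\<^sub>R norm x) ` {x. 0 < e \<bullet> x})"
  proof (rule connected_continuous_image)
    show "continuous_on {x. 0 < e \<bullet> x} (\<lambda>x. x /\<^sub>R norm x)" by (intro continuous_intros) auto
    show "connected {x. 0 < e \<bullet> x}" by (intro convex_connected convex_halfspace_gt)
  qed
  moreover have "(\<lambda>x. x /\<^sub>R norm x) ` {x. 0 < e \<bullet> x} = sphere 0 1 \<inter> {x. 0 < e \<bullet> x}"
  proof (intro equalityI subsetI)
    fix y assume "y \<in> (\<lambda>x. x /\<^sub>R norm x) ` {x. 0 < e \<bullet> x}"
    then obtain x where x: "0 < e \<bullet> x" "y = x /\<^sub>R norm x" by auto
    then have "x \<noteq> 0" by auto
    then show "y \<in> sphere 0 1 \<inter> {x. 0 < e \<bullet> x}" using x by simp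
  next
    fix y assume "y \<in> sphere 0 1 \<inter> {x. 0 < e \<bullet> x}"
    then show "y \<in> (\<lambda>x. x /\<^sub>R norm x) ` {x. 0 < e \<bullet> x}" by (intro image_eqI[of _ _ y]) auto
  qed
  ultimately show ?thesis by simp
qed

text \<open>Each open hemisphere is connected, and a connected subset of the complement of the equator cannot meet
both of them.\<close>

lemma nodal_domains_of_coordinate:
  fixes e :: "'a::euclidean_space"
  assumes e: "e \<in> Basis"
  shows "nodal_domains (on_sphere (\<lambda>x. (x \<bullet> e) * 1)) =
    {sphere 0 1 \<inter> {x. 0 < e \<bullet> x}, sphere 0 1 \<inter> {x. 0 < - e \<bullet> x}}"
proof -
  define N where "N = sphere 0 1 - {x. on_sphere (\<lambda>x. (x \<bullet> e) * 1) x = 0}"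
  define H where "H u = sphere 0 1 \<inter> {x. 0 < u \<bullet> x}" for u :: 'a
  have N: "N = H e \<union> H (- e)"
    by (auto simp: N_def H_def inner_commute)
  have "connected_component_set N x = H u" if u: "u = e \<or> u = - e" and x: "x \<in> H u" for u x
  proof (rule connected_component_unique)
    show "x \<in> H u" "H u \<subseteq> N" using x u N by auto
    show "connected (H u)" unfolding H_def by (rule connected_open_hemisphere)
    show "T \<subseteq> H u" if T: "x \<in> T" "T \<subseteq> N" "connected T" for T
    proof
      fix y assume y: "y \<in> T"
      show "y \<in> H u"
      proof (rule ccontr)
        assume "y \<notin> H u"
        then have "u \<bullet> y \<le> 0" using y T(2) by (auto simp: N_def H_def)
        moreover have "0 \<le> u \<bullet> x" using x by (simp add: H_def)
        ultimately obtain z where "z \<in> T" "u \<bullet> z = 0"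
          using connected_ivt_hyperplane[OF T(3) y T(1)] by blast
        then show False using T(2) u N by (auto simp: H_def)
      qed
    qed
  qed
  note comp = this
  have mem: "e \<in> H e" "- e \<in> H (- e)" using e by (simp_all add: H_def)
  have "components N = {H e, H (- e)}"
  proof
    show "components N \<subseteq> {H e, H (- e)}"
      using comp N by (auto simp: components_def)
    have "connected_component_set N e = H e" "connected_component_set N (- e) = H (- e)"
      using comp mem by blast+
    then show "{H e, H (- e)} \<subseteq> components N"
      unfolding components_def using mem N by blast
  qed
  then show ?thesis by (simp add: nodal_domains_def N_def H_def)
qed

theorem courant_sharp_sphere:
  assumes d: "DIM('a::euclidean_space) \<ge> 3" and n: "n \<ge> 1"
  shows "courant_sharp TYPE('a) n \<longleftrightarrow> n \<in> {1, 2}"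
proof
  have d2: "DIM('a) \<ge> 2" using d by simp
  obtain e :: 'a where e: "e \<in> Basis" using nonempty_Basis by blast
  let ?D = "\<lambda>j. harmonics_dim TYPE('a) j"
  have coord: "on_sphere (\<lambda>x. (x \<bullet> e) * 1) \<in> harmonics (Suc 0)"
    by (rule restrict_hpoly_low_degree[OF hpoly_coord_mult[OF e hpoly_one]]) simp
  have coord_eigen: "eigenfunction (eigval TYPE('a) (Suc 0)) (on_sphere (\<lambda>x. (x \<bullet> e) * 1))"
    by (rule harmonics_eigenfunctionI[OF coord, of e]) (use e in simp)
  have D0: "?D 0 = 1" by (rule harmonics_dim_0[OF d2])
  have D1: "?D (Suc 0) \<ge> 1"
    using coord_eigen harmonics_dim_eq_0_iff[OF d2, of "Suc 0"] unfolding eigenvalues_def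
    by (metis (mono_tags, lifting) One_nat_def Suc_leI mem_Collect_eq not_gr_zero)
  {
    assume "n \<in> {1, 2}"
    then consider "n = 1" | "n = 2" by auto
    then show "courant_sharp TYPE('a) n"
    proof cases
      case 1
      have nth: "nth_eigenvalue TYPE('a) n = eigval TYPE('a) 0"
        by (rule nth_eigenvalue_eqI[OF d2]) (simp_all add: 1 D0)
      have one: "on_sphere (\<lambda>x::'a. 1) \<in> harmonics 0"
        by (rule restrict_hpoly_low_degree[OF hpoly_one]) simp
      have "eigenfunction (nth_eigenvalue TYPE('a) n) (on_sphere (\<lambda>x::'a. 1))"
        unfolding nth by (rule harmonics_eigenfunctionI[OF one, of e]) (use e in simp)
      moreover have "nodal_domains (on_sphere (\<lambda>x::'a. 1)) = {sphere 0 1}"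
      proof -
        have "sphere 0 1 - {x. on_sphere (\<lambda>x::'a. 1) x = 0} = sphere 0 1"
          by (auto simp: on_sphere_def)
        moreover have "e \<in> sphere 0 1" using e by simp
        ultimately show ?thesis
          using connected_sphere[OF d2, of "0::'a" 1] unfolding nodal_domains_def
          by (metis components_eq_sing_iff empty_iff)
      qed
      ultimately show ?thesis unfolding courant_sharp_def
        by (intro exI[of _ "on_sphere (\<lambda>x::'a. 1)"]) (simp add: 1)
    next
      case 2
      have nth: "nth_eigenvalue TYPE('a) n = eigval TYPE('a) (Suc 0)"
        by (rule nth_eigenvalue_eqI[OF d2]) (use D1 in \<open>simp_all add: 2 D0\<close>)
      let ?f = "on_sphere (\<lambda>x. (x \<bullet> e) * 1)"
      have "sphere 0 1 \<inter> {x. 0 < e \<bullet> x} \<noteq> sphere 0 1 \<inter> {x. 0 < - e \<bullet> x}"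
      proof -
        have "e \<in> sphere 0 1 \<inter> {x. 0 < e \<bullet> x}" "e \<notin> sphere 0 1 \<inter> {x. 0 < - e \<bullet> x}" using e by simp_all
        then show ?thesis by blast
      qed
      then have "card (nodal_domains ?f) = n" "finite (nodal_domains ?f)"
        unfolding nodal_domains_of_coordinate[OF e] by (simp_all add: 2)
      then show ?thesis
        unfolding courant_sharp_def nth using coord_eigen by blast
    qed
  }
  assume "courant_sharp TYPE('a) n"
  then obtain f :: "'a \<Rightarrow> real" where f: "eigenfunction (nth_eigenvalue TYPE('a) n) f"
    "finite (nodal_domains f)" "card (nodal_domains f) = n"
    unfolding courant_sharp_def by blast
  obtain l where l: "nth_eigenvalue TYPE('a) n = eigval TYPE('a) l" "sum ?D {..<l} < n"
    by (rule nth_eigenvalue_exists[OF d n]) (rule that)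
  have "f \<in> eigenspace (eigval TYPE('a) l)" using f(1) by (simp add: eigenfunction_def l(1))
  then have fl: "f \<in> harmonics l" by (simp add: eigenspace_eq_harmonics[OF d2])
  show "n \<in> {1, 2}"
  proof (cases "2 \<le> l")
    case True
    then obtain m where m: "l = Suc (Suc m)" by (metis add_2_eq_Suc le_Suc_ex)
    obtain B :: "('a \<Rightarrow> real) set" where B: "finite B" "span B = spoly m"
      "card B = spoly_dim TYPE('a) m"
      by (rule restrict_hpoly_basis)
    have "n \<le> 2 * card B + 2"
      using nodal_domains_le[OF d2 fl f(2) B(1)] B(2) f(3) by (simp add: m)
    also have "\<dots> \<le> sum ?D {..<l}" using sum_harmonics_dim_ge[OF d, of m] by (simp only: B(3) m)
    finally show ?thesis using l(2) by simp
  next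
    case False
    then have "n \<le> 2" using nodal_domains_le[OF d2 fl f(2), of "{}"] f(3) by simp
    then show ?thesis using n by auto
  qed
qed

theorem theorem3p1:
  fixes n :: nat
  assumes "CARD('d::finite) \<ge> 3" and "n \<ge> 1"
  shows "courant_sharp TYPE(real ^ 'd) n \<longleftrightarrow> n \<in> {1, 2}"
  by (rule courant_sharp_sphere) (use assms in simp_all)

end
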